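(* There is a Hopf algebra isomorphism $\widetilde\Phi_\sharp:\widetilde{\mathbf U}\to(\widetilde{\mathbf B}\otimes\widetilde{\mathbf B})^\imath$ given by $$E_i\mapsto\vartheta_i\otimes1,\quad F_i\mapsto1\otimes\vartheta_i,\quad K_i\mapsto h_i\otimes1,\quad K_i'\mapsto1\otimes h_i,\qquad i\in\mathbb I.$$ Moreover, $\widetilde\Phi_\sharp(\widehat{\mathbf U})=(\widehat{\mathbf B}\otimes\widehat{\mathbf B})^\imath$.
   Context: Let $C=(c_{ij})_{i,j\in\mathbb I}$ be a symmetrizable generalized Cartan matrix, $\mathbb I$ finite, with symmetrizer $D=\mathrm{diag}(d_i)$, $d_i\in\mathbb Z_{>0}$; $v$ an indeterminate, $v_i=v^{d_i}$, base field $\mathbb Q(v^{1/2})$; $\left[{m\atop r}\right]_{v_i}$ symmetric quantum binomials. $\widehat{\mathbf U}$ is generated by $E_i,F_i,K_i,K_i'$ $(i\in\mathbb I)$ with relations: all $K_i,K_j'$ commute; $[E_i,F_j]=\delta_{ij}(v_i^{-1}-v_i)(K_i-K_i')$; $K_iE_j=v_i^{c_{ij}}E_jK_i$, $K_iF_j=v_i^{-c_{ij}}F_jK_i$, $K_i'E_j=v_i^{-c_{ij}}E_jK_i'$, $K_i'F_j=v_i^{c_{ij}}F_jK_i'$; for $i\neq j$, $\sum_{r=0}^{1-c_{ij}}(-1)^r\left[{1-c_{ij}\atop r}\right]_{v_i}X_i^rX_jX_i^{1-c_{ij}-r}=0$ for $X=E,F$. $\widetilde{\mathbf U}\supset\widehat{\mathbf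 U}$ has the same generators and relations with all $K_i,K_i'$ invertible; it is a Hopf algebra with $\Delta(E_i)=E_i\otimes1+K_i\otimes E_i$, $\Delta(F_i)=1\otimes F_i+F_i\otimes K_i'$, $\Delta(K_i)=K_i\otimes K_i$, $\Delta(K_i')=K_i'\otimes K_i'$, $\varepsilon(E_i)=\varepsilon(F_i)=0$, $\varepsilon(K_i)=\varepsilon(K_i')=1$, $S(E_i)=-K_i^{-1}E_i$, $S(F_i)=-F_iK_i'^{-1}$, $S(K_i)=K_i^{-1}$, $S(K_i')=K_i'^{-1}$. $\widetilde{\mathbf B}$ is generated by $\vartheta_i,h_i^{\pm1}$ with relations $h_ih_j=h_jh_i$, $h_i\vartheta_j=v_i^{c_{ij}}\vartheta_jh_i$, and $\sum_{r=0}^{1-c_{ij}}(-1)^r\left[{1-c_{ij}\atop r}\right]_{v_i}\vartheta_i^r\vartheta_j\vartheta_i^{1-c_{ij}-r}=0$ $(i\ne j)$; $\widehat{\mathbf B}\subset\widetilde{\mathbf B}$ is the subalgebra generated by all $\vartheta_i,h_i$. $\widetilde{\mathbf B}$ is a Hopf algebra with $\Delta(\vartheta_i)=\vartheta_i\otimes1+h_i\otimes\vartheta_i$, $\Delta(h_i)=h_i\otimes h_i$, $\varepsilon(\vartheta_i)=0$, $\varepsilon(h_i)=1$, $S(\vartheta_i)=-h_i^{-1}\vartheta_i$, $S(h_i)=h_i^{-1}$, with Hopf pairing $\varphi$ ($\varphi(a,bb')=\varphi(\Delta a,b\otimes b')$, $\varphi(aa',b)=\varphi(a\otimes a',\Delta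 b)$, $\varphi(a,1)=\varepsilon(a)=\varphi(1,a)$, $\varphi(a,S(b))=\varphi(S(a),b)$) determined by $\varphi(\vartheta_i,\vartheta_j)=\delta_{ij}(v_i-v_i^{-1})$, $\varphi(h_i,h_j)=v_i^{c_{ij}}$, $\varphi(\vartheta_i,h_j)=0$. $(\widetilde{\mathbf B}\otimes\widetilde{\mathbf B})^\imath$ is the vector space $\widetilde{\mathbf B}\otimes\widetilde{\mathbf B}$ with product $(a\otimes b)\ast(c\otimes d)=\sum\varphi(a_{(1)},d_{(2)})\varphi(c_{(2)},b_{(1)})\,a_{(2)}c_{(1)}\otimes b_{(2)}d_{(1)}$, unit $1\otimes1$, coproduct $\Delta^\imath(a\otimes b)=\sum\varphi(a_{(2)},b_{(2)})(a_{(1)}\otimes b_{(3)})\otimes(a_{(3)}\otimes b_{(1)})$, counit $\varepsilon^\imath(a\otimes b)=\varphi(a,S^{-1}(b))$ and antipode $S^\imath(a\otimes b)=S(a)\otimes S^{-1}(b)$; $(\widehat{\mathbf B}\otimes\widehat{\mathbf B})^\imath$ is its subalgebra on $\widehat{\mathbf B}\otimes\widehat{\mathbf B}$. *)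

theory Defs
  imports
    Complex_Main
    "HOL-Library.Poly_Mapping"
    "HOL-Computational_Algebra.Polynomial"
    "HOL-Computational_Algebra.Fraction_Field"
begin

section \<open>The base field\<close>

text \<open>
  The field of rational functions over the rationals in one indeterminate, which plays the role of
  the square root of \<open>v\<close>. A separate type is needed because the scalars have to be an instance of
  the class of vector spaces over themselves.
\<close>

typedef qv = "UNIV :: rat poly fract set"
  morphisms rep_qv abs_qv ..

setup_lifting type_definition_qv

instantiation qv :: field
begin
lift_definition zero_qv :: qv is 0 .
lift_definition one_qv :: qv is 1 .
lift_definition plus_qv :: "qv \<Rightarrow> qv \<Rightarrow> qv" is "(+)" .
lift_definition minus_qv :: "qv \<Rightarrow> qv \<Rightarrow> qv" is "(-)" .
lift_definition uminus_qv :: "qv \<Rightarrow> qv" is "uminus" .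
lift_definition times_qv :: "qv \<Rightarrow> qv \<Rightarrow> qv" is "(*)" .
lift_definition inverse_qv :: "qv \<Rightarrow> qv" is "inverse" .
lift_definition divide_qv :: "qv \<Rightarrow> qv \<Rightarrow> qv" is "(/)" .
instance
  by standard (transfer; simp add: algebra_simps divide_inverse)+
end

definition v_half :: qv where
  "v_half = abs_qv (Fract [:0, 1:] 1)"

definition vv :: qv where
  "vv = v_half ^ 2"

text \<open>Symmetric quantum integers, factorials and binomials at \<open>q\<close> (used for \<open>r \<le> m\<close> and \<open>q\<close>
  a positive power of \<^term>\<open>vv\<close>, so that no denominator vanishes).\<close>

definition qint :: "qv \<Rightarrow> nat \<Rightarrow> qv" where
  "qint q n = (q ^ n - inverse q ^ n) / (q - inverse q)"

definition qfact :: "qv \<Rightarrow> nat \<Rightarrow> qv" where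
  "qfact q n = (\<Prod>k = 1..n. qint q k)"

definition qbinom :: "qv \<Rightarrow> nat \<Rightarrow> nat \<Rightarrow> qv" where
  "qbinom q m r = qfact q m / (qfact q r * qfact q (m - r))"


section \<open>Vector spaces over the base field\<close>

class qvs = ab_group_add +
  fixes scaleQ :: "qv \<Rightarrow> 'a \<Rightarrow> 'a" (infixr \<open>*\<^sub>Q\<close> 75)
  assumes scaleQ_add_right: "a *\<^sub>Q (x + y) = a *\<^sub>Q x + a *\<^sub>Q y"
    and scaleQ_add_left: "(a + b) *\<^sub>Q x = a *\<^sub>Q x + b *\<^sub>Q x"
    and scaleQ_scaleQ: "a *\<^sub>Q b *\<^sub>Q x = (a * b) *\<^sub>Q x"
    and scaleQ_one: "1 *\<^sub>Q x = x"

global_interpretation qvs: vector_space "scaleQ :: qv \<Rightarrow> 'a \<Rightarrow> 'a::qvs"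
  by unfold_locales
    (simp_all add: scaleQ_add_right scaleQ_add_left scaleQ_scaleQ scaleQ_one)

instantiation qv :: qvs
begin
definition scaleQ_qv :: "qv \<Rightarrow> qv \<Rightarrow> qv" where
  "scaleQ_qv a x = a * x"
instance
  by standard (simp_all add: scaleQ_qv_def algebra_simps)
end

abbreviation linearQ :: "('a::qvs \<Rightarrow> 'b::qvs) \<Rightarrow> bool" where
  "linearQ \<equiv> Vector_Spaces.linear scaleQ scaleQ"

definition bilinearQ :: "('a::qvs \<Rightarrow> 'b::qvs \<Rightarrow> 'c::qvs) \<Rightarrow> bool" where
  "bilinearQ f \<longleftrightarrow> (\<forall>a. linearQ (f a)) \<and> (\<forall>b. linearQ (\<lambda>a. f a b))"

lemma linearQ_iff:
  "linearQ f \<longleftrightarrow> (\<forall>x y. f (x + y) = f x + f y) \<and> (\<forall>c x. f (c *\<^sub>Q x) = c *\<^sub>Q f x)"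
  by (auto simp: Vector_Spaces.linear_iff qvs.vector_space_axioms)


subsection \<open>Free vector spaces\<close>

instantiation poly_mapping :: (type, qvs) qvs
begin
lift_definition scaleQ_poly_mapping :: "qv \<Rightarrow> ('a \<Rightarrow>\<^sub>0 'b) \<Rightarrow> ('a \<Rightarrow>\<^sub>0 'b)" is
  "\<lambda>c f k. c *\<^sub>Q f k"
proof -
  fix c :: qv and f :: "'a \<Rightarrow> 'b"
  assume "finite {x. f x \<noteq> 0}"
  moreover have "{x. c *\<^sub>Q f x \<noteq> 0} \<subseteq> {x. f x \<noteq> 0}" by auto
  ultimately show "finite {x. c *\<^sub>Q f x \<noteq> 0}" by (rule rev_finite_subset)
qed
instance
  by standard (transfer; simp add: fun_eq_iff scaleQ_add_right scaleQ_add_left scaleQ_scaleQ scaleQ_one)+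
end

text \<open>Linear extension of a map on the basis of a free vector space.\<close>

definition lin_ext :: "('x \<Rightarrow> 'a::qvs) \<Rightarrow> ('x \<Rightarrow>\<^sub>0 qv) \<Rightarrow> 'a" where
  "lin_ext f p = (\<Sum>k\<in>Poly_Mapping.keys p. Poly_Mapping.lookup p k *\<^sub>Q f k)"

lemma lin_ext_superset:
  assumes "finite S" "Poly_Mapping.keys p \<subseteq> S"
  shows "lin_ext f p = (\<Sum>k\<in>S. Poly_Mapping.lookup p k *\<^sub>Q f k)"
  unfolding lin_ext_def using assms
  by (intro sum.mono_neutral_left) (auto simp: in_keys_iff)

lemma lin_ext_single: "lin_ext f (Poly_Mapping.single k 1) = f k"
  by (simp add: lin_ext_def scaleQ_one)

lemma linearQ_lin_ext: "linearQ (lin_ext f)"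
  unfolding linearQ_iff
proof (intro conjI allI)
  fix p q :: "'a \<Rightarrow>\<^sub>0 qv"
  let ?S = "Poly_Mapping.keys p \<union> Poly_Mapping.keys q"
  have "finite ?S" "Poly_Mapping.keys p \<subseteq> ?S" "Poly_Mapping.keys q \<subseteq> ?S"
    "Poly_Mapping.keys (p + q) \<subseteq> ?S"
    using Poly_Mapping.keys_add[of p q] by auto
  then show "lin_ext f (p + q) = lin_ext f p + lin_ext f q"
    by (simp add: lin_ext_superset[of ?S] lookup_add scaleQ_add_left sum.distrib)
next
  fix c and p :: "'a \<Rightarrow>\<^sub>0 qv"
  have "Poly_Mapping.keys (c *\<^sub>Q p) \<subseteq> Poly_Mapping.keys p"
    by (auto simp: in_keys_iff scaleQ_poly_mapping.rep_eq)
  then show "lin_ext f (c *\<^sub>Q p) = c *\<^sub>Q lin_ext f p"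
    by (simp add: lin_ext_superset[of "Poly_Mapping.keys p"] scaleQ_poly_mapping.rep_eq
        scaleQ_qv_def scaleQ_scaleQ qvs.scale_sum_right)
qed


section \<open>Tensor products\<close>

abbreviation (input) basis_pair :: "'a \<Rightarrow> 'b \<Rightarrow> ('a \<times> 'b \<Rightarrow>\<^sub>0 qv)" where
  "basis_pair a b \<equiv> Poly_Mapping.single (a, b) 1"

definition tensor_relators :: "('a::qvs \<times> 'b::qvs \<Rightarrow>\<^sub>0 qv) set" where
  "tensor_relators =
     {basis_pair (a + a') b - basis_pair a b - basis_pair a' b | a a' b. True} \<union>
     {basis_pair a (b + b') - basis_pair a b - basis_pair a b' | a b b'. True} \<union>
     {basis_pair (c *\<^sub>Q a) b - c *\<^sub>Q basis_pair a b | c a b. True} \<union>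
     {basis_pair a (c *\<^sub>Q b) - c *\<^sub>Q basis_pair a b | c a b. True}"

definition tensor_rel :: "('a::qvs \<times> 'b::qvs \<Rightarrow>\<^sub>0 qv) \<Rightarrow> ('a \<times> 'b \<Rightarrow>\<^sub>0 qv) \<Rightarrow> bool" where
  "tensor_rel p q \<longleftrightarrow> p - q \<in> qvs.span tensor_relators"

lemma equivp_tensor_rel: "equivp tensor_rel"
proof (rule equivpI)
  show "reflp tensor_rel"
    by (simp add: reflp_def tensor_rel_def qvs.span_zero)
  show "symp tensor_rel"
    unfolding symp_def tensor_rel_def by (auto dest: qvs.span_neg)
  show "transp tensor_rel"
    unfolding transp_def tensor_rel_def
    by (intro allI impI, drule (1) qvs.span_add) simp
qed

quotient_type (overloaded) ('a, 'b) tensor =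
  "('a::qvs \<times> 'b::qvs) \<Rightarrow>\<^sub>0 qv" / tensor_rel
  by (rule equivp_tensor_rel)

instantiation tensor :: (qvs, qvs) qvs
begin
lift_definition zero_tensor :: "('a, 'b) tensor" is 0 .
lift_definition plus_tensor :: "('a, 'b) tensor \<Rightarrow> ('a, 'b) tensor \<Rightarrow> ('a, 'b) tensor" is "(+)"
  unfolding tensor_rel_def by (drule (1) qvs.span_add) (simp add: algebra_simps)
lift_definition minus_tensor :: "('a, 'b) tensor \<Rightarrow> ('a, 'b) tensor \<Rightarrow> ('a, 'b) tensor" is "(-)"
  unfolding tensor_rel_def by (drule (1) qvs.span_diff) (simp add: algebra_simps)
lift_definition uminus_tensor :: "('a, 'b) tensor \<Rightarrow> ('a, 'b) tensor" is "uminus"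
  unfolding tensor_rel_def by (drule qvs.span_neg) simp
lift_definition scaleQ_tensor :: "qv \<Rightarrow> ('a, 'b) tensor \<Rightarrow> ('a, 'b) tensor" is "scaleQ"
  unfolding tensor_rel_def
  by (simp add: qvs.scale_right_diff_distrib[symmetric] qvs.span_scale)
instance
  by standard
    (transfer; simp add: tensor_rel_def qvs.span_zero algebra_simps
      scaleQ_add_right scaleQ_add_left scaleQ_scaleQ scaleQ_one)+
end

lift_definition tens :: "'a::qvs \<Rightarrow> 'b::qvs \<Rightarrow> ('a, 'b) tensor" (infixl \<open>\<otimes>\<close> 76) is
  "\<lambda>a b. basis_pair a b" .

text \<open>
  The linear map induced by a bilinear map (lemma \<open>tlift_tens\<close> below). It has the junk value \<open>0\<close>
  when the argument is not bilinear.
\<close>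

lift_definition tlift :: "('a::qvs \<Rightarrow> 'b::qvs \<Rightarrow> 'c::qvs) \<Rightarrow> ('a, 'b) tensor \<Rightarrow> 'c" is
  "\<lambda>f p. if bilinearQ f then lin_ext (\<lambda>(a, b). f a b) p else 0"
proof -
  fix f :: "'a \<Rightarrow> 'b \<Rightarrow> 'c" and p q :: "'a \<times> 'b \<Rightarrow>\<^sub>0 qv"
  assume pq: "tensor_rel p q"
  let ?l = "lin_ext (\<lambda>(a, b). f a b)"
  interpret l: Vector_Spaces.linear scaleQ scaleQ ?l by (rule linearQ_lin_ext)
  have "?l p = ?l q" if f: "bilinearQ f"
  proof -
    have gens: "?l r = 0" if "r \<in> tensor_relators" for r
      using that f unfolding tensor_relators_def bilinearQ_def linearQ_iff
      by (auto simp: l.diff l.scale lin_ext_single)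
    have "?l (p - q) = 0"
      using gens pq unfolding tensor_rel_def by (rule l.eq_0_on_span)
    then show ?thesis by (simp add: l.diff)
  qed
  then show "(if bilinearQ f then ?l p else 0) = (if bilinearQ f then ?l q else 0)" by simp
qed

lemma tens_add_left: "(a + a') \<otimes> b = a \<otimes> b + a' \<otimes> b"
proof (transfer, unfold tensor_rel_def)
  fix a a' :: 'a and b :: 'b
  have "basis_pair (a + a') b - basis_pair a b - basis_pair a' b \<in> qvs.span tensor_relators"
    by (rule qvs.span_base, unfold tensor_relators_def) blast
  then show "basis_pair (a + a') b - (basis_pair a b + basis_pair a' b) \<in> qvs.span tensor_relators"
    by (simp only: diff_diff_eq)
qed

lemma tens_add_right: "a \<otimes> (b + b') = a \<otimes> b + a \<otimes> b'"
proof (transfer, unfold tensor_rel_def)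
  fix a :: 'a and b b' :: 'b
  have "basis_pair a (b + b') - basis_pair a b - basis_pair a b' \<in> qvs.span tensor_relators"
    by (rule qvs.span_base, unfold tensor_relators_def) blast
  then show "basis_pair a (b + b') - (basis_pair a b + basis_pair a b') \<in> qvs.span tensor_relators"
    by (simp only: diff_diff_eq)
qed

lemma tens_scale_left: "(c *\<^sub>Q a) \<otimes> b = c *\<^sub>Q (a \<otimes> b)"
proof (transfer, unfold tensor_rel_def)
  fix c and a :: 'a and b :: 'b
  show "basis_pair (c *\<^sub>Q a) b - c *\<^sub>Q basis_pair a b \<in> qvs.span tensor_relators"
    by (rule qvs.span_base, unfold tensor_relators_def) blast
qed

lemma tens_scale_right: "a \<otimes> (c *\<^sub>Q b) = c *\<^sub>Q (a \<otimes> b)"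
proof (transfer, unfold tensor_rel_def)
  fix c and a :: 'a and b :: 'b
  show "basis_pair a (c *\<^sub>Q b) - c *\<^sub>Q basis_pair a b \<in> qvs.span tensor_relators"
    by (rule qvs.span_base, unfold tensor_relators_def) blast
qed

lemma bilinearQ_tens: "bilinearQ (\<otimes>)"
  by (simp add: bilinearQ_def linearQ_iff tens_add_left tens_add_right tens_scale_left tens_scale_right)

lemma tlift_tens: "bilinearQ f \<Longrightarrow> tlift f (a \<otimes> b) = f a b"
  by transfer (simp add: lin_ext_single)

lemma linearQ_tlift: "linearQ (tlift f)"
  unfolding linearQ_iff
proof (intro conjI allI)
  have add: "lin_ext g (p + q) = lin_ext g p + lin_ext g q"
    and scale: "lin_ext g (c *\<^sub>Q p) = c *\<^sub>Q lin_ext g p"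
    for g :: "'a \<times> 'b \<Rightarrow> 'c" and p q c
    using linearQ_lin_ext[of g] unfolding linearQ_iff by blast+
  show "tlift f (s + t) = tlift f s + tlift f t" for s t
    by transfer (simp add: add)
  show "tlift f (c *\<^sub>Q t) = c *\<^sub>Q tlift f t" for c t
    by transfer (simp add: scale)
qed

definition tmap :: "('a::qvs \<Rightarrow> 'c::qvs) \<Rightarrow> ('b::qvs \<Rightarrow> 'd::qvs) \<Rightarrow> ('a, 'b) tensor \<Rightarrow> ('c, 'd) tensor" where
  "tmap f g = tlift (\<lambda>a b. f a \<otimes> g b)"

definition tassoc :: "(('a::qvs, 'b::qvs) tensor, 'c::qvs) tensor \<Rightarrow> ('a, ('b, 'c) tensor) tensor" where
  "tassoc = tlift (\<lambda>s c. tlift (\<lambda>a b. a \<otimes> (b \<otimes> c)) s)"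


section \<open>Algebras and Hopf algebras\<close>

text \<open>
  The multiplication is not a class operation, since one vector space carries several products
  below.
\<close>

record 'a alg =
  amult :: "'a \<Rightarrow> 'a \<Rightarrow> 'a"
  aone :: 'a

record (overloaded) ('a::qvs) hopf = "'a alg" +
  comult :: "'a \<Rightarrow> ('a, 'a) tensor"
  counit :: "'a \<Rightarrow> qv"
  antipode :: "'a \<Rightarrow> 'a"

definition algebra :: "('a::qvs, 'z) alg_scheme \<Rightarrow> bool" where
  "algebra A \<longleftrightarrow> bilinearQ (amult A) \<and>
     (\<forall>a b c. amult A (amult A a b) c = amult A a (amult A b c)) \<and>
     (\<forall>a. amult A (aone A) a = a \<and> amult A a (aone A) = a)"

definition alg_hom :: "('a::qvs, 'y) alg_scheme \<Rightarrow> ('b::qvs, 'z) alg_scheme \<Rightarrow> ('a \<Rightarrow> 'b) \<Rightarrow> bool" where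
  "alg_hom A B f \<longleftrightarrow> linearQ f \<and> f (aone A) = aone B \<and>
     (\<forall>a b. f (amult A a b) = amult B (f a) (f b))"

definition base_alg :: "qv alg" where
  "base_alg = \<lparr>amult = (*), aone = 1\<rparr>"

definition tensor_alg ::
  "('a::qvs, 'y) alg_scheme \<Rightarrow> ('b::qvs, 'z) alg_scheme \<Rightarrow> ('a, 'b) tensor alg" where
  "tensor_alg A B =
     \<lparr>amult = (\<lambda>s t. tlift (\<lambda>a b. tlift (\<lambda>a' b'. amult A a a' \<otimes> amult B b b') t) s),
      aone = aone A \<otimes> aone B\<rparr>"

definition hopf_algebra :: "'a::qvs hopf \<Rightarrow> bool" where
  "hopf_algebra H \<longleftrightarrow> algebra H \<and>
     alg_hom H (tensor_alg H H) (comult H) \<and>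
     alg_hom H base_alg (counit H) \<and>
     (\<forall>a. tassoc (tmap (comult H) id (comult H a)) = tmap id (comult H) (comult H a)) \<and>
     (\<forall>a. tlift (\<lambda>b c. counit H b *\<^sub>Q c) (comult H a) = a) \<and>
     (\<forall>a. tlift (\<lambda>b c. counit H c *\<^sub>Q b) (comult H a) = a) \<and>
     linearQ (antipode H) \<and>
     (\<forall>a. tlift (\<lambda>b c. amult H (antipode H b) c) (comult H a) = counit H a *\<^sub>Q aone H) \<and>
     (\<forall>a. tlift (\<lambda>b c. amult H b (antipode H c)) (comult H a) = counit H a *\<^sub>Q aone H)"

definition hopf_iso :: "'a::qvs hopf \<Rightarrow> 'b::qvs hopf \<Rightarrow> ('a \<Rightarrow> 'b) \<Rightarrow> bool" where
  "hopf_iso H H' f \<longleftrightarrow> hopf_algebra H \<and> hopf_algebra H' \<and> bij f \<and> alg_hom H H' f \<and>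
     (\<forall>a. comult H' (f a) = tmap f f (comult H a)) \<and>
     (\<forall>a. counit H' (f a) = counit H a) \<and>
     (\<forall>a. antipode H' (f a) = f (antipode H a))"

definition subalgebra :: "('a::qvs, 'z) alg_scheme \<Rightarrow> 'a set \<Rightarrow> bool" where
  "subalgebra A V \<longleftrightarrow> qvs.subspace V \<and> aone A \<in> V \<and> (\<forall>a\<in>V. \<forall>b\<in>V. amult A a b \<in> V)"

text \<open>Sweedler notation: \<open>sw2 H a f\<close> is the sum of \<open>f a\<^sub>(\<^sub>1\<^sub>) a\<^sub>(\<^sub>2\<^sub>)\<close>, for bilinear \<open>f\<close>, and
  \<open>sw3 H a f\<close> is the sum of \<open>f a\<^sub>(\<^sub>1\<^sub>) a\<^sub>(\<^sub>2\<^sub>) a\<^sub>(\<^sub>3\<^sub>)\<close>, for trilinear \<open>f\<close>.\<close>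

definition sw2 :: "'a::qvs hopf \<Rightarrow> 'a \<Rightarrow> ('a \<Rightarrow> 'a \<Rightarrow> 'c::qvs) \<Rightarrow> 'c" where
  "sw2 H a f = tlift f (comult H a)"

definition sw3 :: "'a::qvs hopf \<Rightarrow> 'a \<Rightarrow> ('a \<Rightarrow> 'a \<Rightarrow> 'a \<Rightarrow> 'c::qvs) \<Rightarrow> 'c" where
  "sw3 H a f = tlift (\<lambda>a1 t. tlift (\<lambda>a2 a3. f a1 a2 a3) t) (tmap id (comult H) (comult H a))"


subsection \<open>Presentations by generators and relations\<close>

text \<open>
  The free algebra on a type of generators is the monoid algebra of the words; its product is
  the convolution product of \<^theory>\<open>HOL-Library.Poly_Mapping\<close>.
\<close>

datatype 'g word = Word (letters: "'g list")

instantiation word :: (type) monoid_add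
begin
definition zero_word :: "'a word" where
  "zero_word = Word []"
definition plus_word :: "'a word \<Rightarrow> 'a word \<Rightarrow> 'a word" where
  "plus_word x y = Word (letters x @ letters y)"
instance
  by standard (simp_all add: zero_word_def plus_word_def)
end

type_synonym 'g free_alg = "'g word \<Rightarrow>\<^sub>0 qv"

definition gen :: "'g \<Rightarrow> 'g free_alg" where
  "gen g = Poly_Mapping.single (Word [g]) 1"

definition eval_free :: "('a::qvs, 'z) alg_scheme \<Rightarrow> ('g \<Rightarrow> 'a) \<Rightarrow> 'g free_alg \<Rightarrow> 'a" where
  "eval_free A x = lin_ext (\<lambda>w. foldr (amult A) (map x (letters w)) (aone A))"

definition two_sided_ideal :: "'g free_alg set \<Rightarrow> 'g free_alg set" where
  "two_sided_ideal R = qvs.span {a * r * b | a r b. r \<in> R}"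

text \<open>The algebra \<open>A\<close> is generated by the elements \<open>x g\<close> subject to the relations \<open>r = 0\<close> for
  \<open>r \<in> R\<close>, that is, evaluation at \<open>x\<close> identifies \<open>A\<close> with the quotient of the free algebra by the
  two-sided ideal generated by \<open>R\<close>.\<close>

definition presented_by :: "('a::qvs, 'z) alg_scheme \<Rightarrow> ('g \<Rightarrow> 'a) \<Rightarrow> 'g free_alg set \<Rightarrow> bool" where
  "presented_by A x R \<longleftrightarrow> algebra A \<and> surj (eval_free A x) \<and>
     {p. eval_free A x p = 0} = two_sided_ideal R"


section \<open>The algebras attached to a Cartan matrix\<close>

definition symmetrizable_GCM :: "('i \<Rightarrow> 'i \<Rightarrow> int) \<Rightarrow> ('i \<Rightarrow> nat) \<Rightarrow> bool" where
  "symmetrizable_GCM C d \<longleftrightarrow>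
     (\<forall>i. C i i = 2) \<and>
     (\<forall>i j. i \<noteq> j \<longrightarrow> C i j \<le> 0) \<and>
     (\<forall>i j. C i j = 0 \<longleftrightarrow> C j i = 0) \<and>
     (\<forall>i. d i > 0) \<and>
     (\<forall>i j. int (d i) * C i j = int (d j) * C j i)"

definition serre :: "('i \<Rightarrow> 'i \<Rightarrow> int) \<Rightarrow> ('i \<Rightarrow> nat) \<Rightarrow> ('i \<Rightarrow> 'g free_alg) \<Rightarrow> 'i \<Rightarrow> 'i \<Rightarrow> 'g free_alg" where
  "serre C d X i j =
     (let m = nat (1 - C i j) in
        \<Sum>r = 0..m. ((-1) ^ r * qbinom (vv ^ d i) m r) *\<^sub>Q (X i ^ r * X j * X i ^ (m - r)))"

definition comm_relators :: "'g free_alg set \<Rightarrow> 'g free_alg set" where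
  "comm_relators X = {a * b - b * a | a b. a \<in> X \<and> b \<in> X}"

text \<open>The defining relations of the algebra without inverses, as elements of a free algebra in which
  \<open>e\<close>, \<open>f\<close>, \<open>k\<close>, \<open>k'\<close> are the generators.\<close>

definition U_relators ::
  "('i \<Rightarrow> 'i \<Rightarrow> int) \<Rightarrow> ('i \<Rightarrow> nat) \<Rightarrow> ('i \<Rightarrow> 'g free_alg) \<Rightarrow> ('i \<Rightarrow> 'g free_alg) \<Rightarrow>
   ('i \<Rightarrow> 'g free_alg) \<Rightarrow> ('i \<Rightarrow> 'g free_alg) \<Rightarrow> 'g free_alg set" where
  "U_relators C d e f k k' =
     comm_relators (range k \<union> range k') \<union>
     {e i * f j - f j * e i
        - (if i = j then (inverse (vv ^ d i) - vv ^ d i) *\<^sub>Q (k i - k' i) else 0) | i j. True} \<union>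
     {k i * e j - ((vv ^ d i) powi C i j) *\<^sub>Q (e j * k i) | i j. True} \<union>
     {k i * f j - ((vv ^ d i) powi (- C i j)) *\<^sub>Q (f j * k i) | i j. True} \<union>
     {k' i * e j - ((vv ^ d i) powi (- C i j)) *\<^sub>Q (e j * k' i) | i j. True} \<union>
     {k' i * f j - ((vv ^ d i) powi C i j) *\<^sub>Q (f j * k' i) | i j. True} \<union>
     {serre C d e i j | i j. i \<noteq> j} \<union>
     {serre C d f i j | i j. i \<noteq> j}"

definition inverse_relators :: "('i \<Rightarrow> 'g free_alg) \<Rightarrow> ('i \<Rightarrow> 'g free_alg) \<Rightarrow> 'g free_alg set" where
  "inverse_relators k l = {k i * l i - 1 | i. True} \<union> {l i * k i - 1 | i. True}"

datatype 'i Uhat_gen = GE 'i | GF 'i | GK 'i | GK' 'i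

datatype 'i Util_gen = Base "'i Uhat_gen" | GKinv 'i | GK'inv 'i

definition is_Uhat ::
  "('i \<Rightarrow> 'i \<Rightarrow> int) \<Rightarrow> ('i \<Rightarrow> nat) \<Rightarrow> 'a::qvs alg \<Rightarrow> ('i Uhat_gen \<Rightarrow> 'a) \<Rightarrow> bool" where
  "is_Uhat C d A x \<longleftrightarrow> presented_by A x
     (U_relators C d (\<lambda>i. gen (GE i)) (\<lambda>i. gen (GF i)) (\<lambda>i. gen (GK i)) (\<lambda>i. gen (GK' i)))"

definition Util_relators ::
  "('i \<Rightarrow> 'i \<Rightarrow> int) \<Rightarrow> ('i \<Rightarrow> nat) \<Rightarrow> 'i Util_gen free_alg set" where
  "Util_relators C d =
     U_relators C d (\<lambda>i. gen (Base (GE i))) (\<lambda>i. gen (Base (GF i)))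
       (\<lambda>i. gen (Base (GK i))) (\<lambda>i. gen (Base (GK' i))) \<union>
     inverse_relators (\<lambda>i. gen (Base (GK i))) (\<lambda>i. gen (GKinv i)) \<union>
     inverse_relators (\<lambda>i. gen (Base (GK' i))) (\<lambda>i. gen (GK'inv i))"

definition is_Util ::
  "('i \<Rightarrow> 'i \<Rightarrow> int) \<Rightarrow> ('i \<Rightarrow> nat) \<Rightarrow> 'a::qvs hopf \<Rightarrow> ('i Util_gen \<Rightarrow> 'a) \<Rightarrow> bool" where
  "is_Util C d H x \<longleftrightarrow>
     presented_by H x (Util_relators C d) \<and> hopf_algebra H \<and>
     (\<forall>i. let E = x (Base (GE i)); F = x (Base (GF i));
              K = x (Base (GK i)); K' = x (Base (GK' i));
              Kinv = x (GKinv i); K'inv = x (GK'inv i) in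
        comult H E = E \<otimes> aone H + K \<otimes> E \<and>
        comult H F = aone H \<otimes> F + F \<otimes> K' \<and>
        comult H K = K \<otimes> K \<and>
        comult H K' = K' \<otimes> K' \<and>
        counit H E = 0 \<and> counit H F = 0 \<and> counit H K = 1 \<and> counit H K' = 1 \<and>
        antipode H E = - amult H Kinv E \<and>
        antipode H F = - amult H F K'inv \<and>
        antipode H K = Kinv \<and>
        antipode H K' = K'inv)"

datatype 'i B_gen = GTheta 'i | GH 'i | GHinv 'i

definition B_relators ::
  "('i \<Rightarrow> 'i \<Rightarrow> int) \<Rightarrow> ('i \<Rightarrow> nat) \<Rightarrow> 'i B_gen free_alg set" where
  "B_relators C d =
     comm_relators (range (\<lambda>i. gen (GH i))) \<union>
     inverse_relators (\<lambda>i. gen (GH i)) (\<lambda>i. gen (GHinv i)) \<union>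
     {gen (GH i) * gen (GTheta j)
        - ((vv ^ d i) powi C i j) *\<^sub>Q (gen (GTheta j) * gen (GH i)) | i j. True} \<union>
     {serre C d (\<lambda>i. gen (GTheta i)) i j | i j. i \<noteq> j}"

definition is_Btil ::
  "('i \<Rightarrow> 'i \<Rightarrow> int) \<Rightarrow> ('i \<Rightarrow> nat) \<Rightarrow> 'a::qvs hopf \<Rightarrow> ('i B_gen \<Rightarrow> 'a) \<Rightarrow> bool" where
  "is_Btil C d H x \<longleftrightarrow>
     presented_by H x (B_relators C d) \<and> hopf_algebra H \<and>
     (\<forall>i. let \<theta> = x (GTheta i); h = x (GH i); hinv = x (GHinv i) in
        comult H \<theta> = \<theta> \<otimes> aone H + h \<otimes> \<theta> \<and>
        comult H h = h \<otimes> h \<and>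
        counit H \<theta> = 0 \<and> counit H h = 1 \<and>
        antipode H \<theta> = - amult H hinv \<theta> \<and>
        antipode H h = hinv)"

definition Bhat :: "'a::qvs hopf \<Rightarrow> ('i B_gen \<Rightarrow> 'a) \<Rightarrow> 'a set" where
  "Bhat H x = subalgebra H hull (range (\<lambda>i. x (GTheta i)) \<union> range (\<lambda>i. x (GH i)))"

definition hopf_pairing :: "'a::qvs hopf \<Rightarrow> ('a \<Rightarrow> 'a \<Rightarrow> qv) \<Rightarrow> bool" where
  "hopf_pairing H \<phi> \<longleftrightarrow> bilinearQ \<phi> \<and>
     (\<forall>a b b'. \<phi> a (amult H b b') = sw2 H a (\<lambda>a1 a2. \<phi> a1 b * \<phi> a2 b')) \<and>
     (\<forall>a a' b. \<phi> (amult H a a') b = sw2 H b (\<lambda>b1 b2. \<phi> a b1 * \<phi> a' b2)) \<and>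
     (\<forall>a. \<phi> a (aone H) = counit H a \<and> \<phi> (aone H) a = counit H a) \<and>
     (\<forall>a b. \<phi> a (antipode H b) = \<phi> (antipode H a) b)"

definition is_Btil_pairing ::
  "('i \<Rightarrow> 'i \<Rightarrow> int) \<Rightarrow> ('i \<Rightarrow> nat) \<Rightarrow> 'a::qvs hopf \<Rightarrow> ('i B_gen \<Rightarrow> 'a) \<Rightarrow> ('a \<Rightarrow> 'a \<Rightarrow> qv) \<Rightarrow> bool" where
  "is_Btil_pairing C d H x \<phi> \<longleftrightarrow> hopf_pairing H \<phi> \<and>
     (\<forall>i j. \<phi> (x (GTheta i)) (x (GTheta j)) = (if i = j then vv ^ d i - inverse (vv ^ d i) else 0) \<and>
            \<phi> (x (GH i)) (x (GH j)) = (vv ^ d i) powi C i j \<and>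
            \<phi> (x (GTheta i)) (x (GH j)) = 0)"


section \<open>The twisted tensor square\<close>

definition iota_hopf :: "'a::qvs hopf \<Rightarrow> ('a \<Rightarrow> 'a \<Rightarrow> qv) \<Rightarrow> ('a, 'a) tensor hopf" where
  "iota_hopf H \<phi> =
     \<lparr>amult = (\<lambda>s t.
        tlift (\<lambda>a b. tlift (\<lambda>c d.
          sw2 H a (\<lambda>a1 a2. sw2 H b (\<lambda>b1 b2. sw2 H c (\<lambda>c1 c2. sw2 H d (\<lambda>d1 d2.
            (\<phi> a1 d2 * \<phi> c2 b1) *\<^sub>Q (amult H a2 c1 \<otimes> amult H b2 d1)))))) t) s),
      aone = aone H \<otimes> aone H,
      comult = tlift (\<lambda>a b.
        sw3 H a (\<lambda>a1 a2 a3. sw3 H b (\<lambda>b1 b2 b3.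
          \<phi> a2 b2 *\<^sub>Q ((a1 \<otimes> b3) \<otimes> (a3 \<otimes> b1))))),
      counit = tlift (\<lambda>a b. \<phi> a (inv (antipode H) b)),
      antipode = tlift (\<lambda>a b. antipode H a \<otimes> inv (antipode H) b)\<rparr>"

definition tensor_subspace :: "'a::qvs set \<Rightarrow> 'b::qvs set \<Rightarrow> ('a, 'b) tensor set" where
  "tensor_subspace V W = qvs.span {a \<otimes> b | a b. a \<in> V \<and> b \<in> W}"

end

theory Submission
  imports Defs
begin

text \<open>
  Write \<open>B\<close> for the Hopf algebra with its pairing. Instead of checking the associativity of the
  twisted product on \<open>B \<otimes> B\<close>, one makes \<open>B \<otimes> B\<close> a module over the quantum group \<open>U\<close>: the
  would-be left multiplications by \<open>a \<otimes> 1\<close> and by \<open>1 \<otimes> b\<close> are two actions of \<open>B\<close>, and one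
  cross relation between them, evaluated on generators, gives the relations of \<open>U\<close>. Acting on
  \<open>1 \<otimes> 1\<close> defines \<open>\<Phi>\<close>. Both halves of \<open>U\<close> receive algebra maps \<open>\<psi>E\<close>, \<open>\<psi>F\<close> from \<open>B\<close>, and \<open>U\<close>
  is spanned by the products \<open>\<psi>E a \<psi>F b\<close>. On these \<open>\<Phi>\<close> takes the explicit value
  \<open>(a \<otimes> 1) * (1 \<otimes> b)\<close>, so that multiplicativity, the coalgebra structure and the inverse
  \<open>a \<otimes> b \<mapsto> \<Sum> \<phi>(S\<^sup>-\<^sup>1 a\<^sub>1, b\<^sub>2) \<psi>E a\<^sub>2 \<psi>F b\<^sub>1\<close> are all read off there. The Hopf algebra axioms of the twisted
  tensor square, associativity included, are then transported from \<open>U\<close>.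
\<close>

text \<open>The twisted counit and antipode contain the inverse of the antipode \<open>S\<close>,
  whose bijectivity is not given and has to be extracted from the presentations. Surjectivity can be
  seen on generators. For injectivity, the antipode of U undoes \<open>S\<close> on the F half,
  \<open>antipode U (\<psi>F (S b)) = \<psi>F b\<close>, and \<Phi> shows that
  \<open>\<psi>F\<close> is injective; so \<Phi> has to be built before the inverse antipode is
  available. The inverse of \<Phi> arises as follows. In
  \<open>\<Phi> (\<psi>E a \<star> \<psi>F b)\<close> = \<Sum> a2 \<otimes> D a1 b the operators
  \<open>D\<close> form an action of B on itself, so the twist is cancelled by acting with the
  inverse antipode of a1, because \<Sum> a2 S^-1(a1) = \<epsilon>(a) 1; with S in place of S^-1 the
  factors would stand in the wrong order. For U itself it is enough that the products span: the
  inverse is defined on all of B \<otimes> B, and the two composites are compared on spanning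
  sets.\<close>

named_theorems lin

section \<open>Linear maps and linear extension\<close>

lemma linearQ_I:
  "(\<And>x y. f (x + y) = f x + f y) \<Longrightarrow> (\<And>c x. f (c *\<^sub>Q x) = c *\<^sub>Q f x) \<Longrightarrow> linearQ f"
  by (simp add: linearQ_iff)

lemma linearQ_add: "linearQ f \<Longrightarrow> f (x + y) = f x + f y"
  and linearQ_scale: "linearQ f \<Longrightarrow> f (c *\<^sub>Q x) = c *\<^sub>Q f x"
  by (simp_all add: linearQ_iff)

lemma linearQ_zero: "linearQ f \<Longrightarrow> f 0 = 0"
  using linearQ_add[of f 0 0] by simp

lemma linearQ_uminus: "linearQ f \<Longrightarrow> f (- x) = - f x"
  using linearQ_add[of f x "- x"] by (simp add: linearQ_zero add_eq_0_iff)

lemma linearQ_diff: "linearQ f \<Longrightarrow> f (x - y) = f x - f y"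
  using linearQ_add[of f x "- y"] by (simp add: linearQ_uminus)

lemma linearQ_sum: "linearQ f \<Longrightarrow> f (sum g I) = (\<Sum>i\<in>I. f (g i))"
  by (induction I rule: infinite_finite_induct) (simp_all add: linearQ_zero linearQ_add)

lemma scaleQ_qv [simp]: "a *\<^sub>Q (x :: qv) = a * x"
  by (simp add: scaleQ_qv_def)

text \<open>The rules tagged \<open>lin\<close> are mostly phrased for an operation applied to an
  inner linear \<open>f x\<close>, not for the bare operation, so that \<open>intro lin\<close>
  peels a nested expression down to its variable and settles the multilinearity conditions of the
  Sweedler calculus.\<close>

lemma linearQ_ident [lin]: "linearQ (\<lambda>x. x)"
  by (simp add: linearQ_iff)

lemma linearQ_0 [lin]: "linearQ (\<lambda>x. 0)"
  by (simp add: linearQ_iff)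

lemma linearQ_id [lin]: "linearQ id"
  by (simp add: linearQ_iff)

lemma linearQ_plus [lin]: "linearQ f \<Longrightarrow> linearQ g \<Longrightarrow> linearQ (\<lambda>x. f x + g x)"
  by (simp add: linearQ_iff scaleQ_add_right)

lemma linearQ_neg [lin]: "linearQ f \<Longrightarrow> linearQ (\<lambda>x. - f x)"
  by (simp add: linearQ_iff)

lemma linearQ_const_scaleQ [lin]: "linearQ f \<Longrightarrow> linearQ (\<lambda>x. c *\<^sub>Q f x)"
  by (simp add: linearQ_iff scaleQ_add_right scaleQ_scaleQ mult.commute)

lemma linearQ_scaleQ_const [lin]: "linearQ f \<Longrightarrow> linearQ (\<lambda>x. f x *\<^sub>Q v)"
  by (simp add: linearQ_iff scaleQ_add_left scaleQ_scaleQ)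

lemma linearQ_times_left [lin]: "linearQ f \<Longrightarrow> linearQ (\<lambda>x. f x * (c :: qv))"
  by (simp add: linearQ_iff algebra_simps)

lemma linearQ_times_right [lin]: "linearQ f \<Longrightarrow> linearQ (\<lambda>x. (c :: qv) * f x)"
  by (simp add: linearQ_iff algebra_simps)

lemma linearQ_tens_left [lin]: "linearQ f \<Longrightarrow> linearQ (\<lambda>x. f x \<otimes> b)"
  by (simp add: linearQ_iff tens_add_left tens_scale_left)

lemma linearQ_tens_right [lin]: "linearQ f \<Longrightarrow> linearQ (\<lambda>x. a \<otimes> f x)"
  by (simp add: linearQ_iff tens_add_right tens_scale_right)

lemma linearQ_compose: "linearQ g \<Longrightarrow> linearQ f \<Longrightarrow> linearQ (\<lambda>x. g (f x))"
  by (simp add: linearQ_iff)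

lemma linearQ_tlift_arg [lin]: "linearQ f \<Longrightarrow> linearQ (\<lambda>x. tlift g (f x))"
  by (rule linearQ_compose[OF linearQ_tlift])

lemma bilinearQ_I:
  "(\<And>b. linearQ (\<lambda>a. f a b)) \<Longrightarrow> (\<And>a. linearQ (\<lambda>b. f a b)) \<Longrightarrow> bilinearQ f"
  by (simp add: bilinearQ_def)

lemma bilinearQ_left: "bilinearQ f \<Longrightarrow> linearQ g \<Longrightarrow> linearQ (\<lambda>x. f (g x) b)"
  and bilinearQ_right: "bilinearQ f \<Longrightarrow> linearQ g \<Longrightarrow> linearQ (\<lambda>x. f a (g x))"
  by (simp_all add: bilinearQ_def linearQ_iff)

lemma linear_image_subspace: "linearQ f \<Longrightarrow> qvs.subspace V \<Longrightarrow> qvs.subspace (f ` V)"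
  by (auto simp: qvs.subspace_def linearQ_zero[symmetric] linearQ_add[symmetric] linearQ_scale[symmetric])

lemma linear_vimage_subspace:
  assumes "linearQ f" "qvs.subspace V"
  shows "qvs.subspace {x. f x \<in> V}"
  using assms by (auto simp: qvs.subspace_def linearQ_zero linearQ_add linearQ_scale)

lemma linear_eq_subspace:
  assumes "linearQ f" "linearQ g"
  shows "qvs.subspace {x. f x = g x}"
  using assms by (auto simp: qvs.subspace_def linearQ_zero linearQ_add linearQ_scale)

lemma linearQ_inv: "linearQ f \<Longrightarrow> bij f \<Longrightarrow> linearQ (inv f)"
  by (rule linearQ_I; rule inv_f_eq[OF bij_is_inj])
     (simp_all add: linearQ_add linearQ_scale surj_f_inv_f[OF bij_is_surj])

lemma lin_ext_mem:
  assumes "qvs.subspace W" "\<And>k. f k \<in> W"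
  shows "lin_ext f p \<in> W"
  unfolding lin_ext_def using assms by (intro qvs.subspace_sum qvs.subspace_scale)

lemma linear_lin_ext: "linearQ T \<Longrightarrow> T (lin_ext f p) = lin_ext (\<lambda>k. T (f k)) p"
  by (simp add: lin_ext_def linearQ_sum linearQ_scale)


lemma lin_ext_basis: "lin_ext (\<lambda>k. Poly_Mapping.single k 1) p = p"
  by (rule poly_mapping_eqI)
     (simp add: lin_ext_def lookup_sum scaleQ_poly_mapping.rep_eq lookup_single when_def
        in_keys_iff if_distrib sum.delta cong: if_cong)

lemma poly_mapping_linear_eqI:
  fixes f g :: "('x \<Rightarrow>\<^sub>0 qv) \<Rightarrow> 'a::qvs"
  assumes "linearQ f" "linearQ g"
    and "\<And>k. f (Poly_Mapping.single k 1) = g (Poly_Mapping.single k 1)"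
  shows "f p = g p"
proof -
  have "f (lin_ext (\<lambda>k. Poly_Mapping.single k 1) p) = g (lin_ext (\<lambda>k. Poly_Mapping.single k 1) p)"
    by (simp only: linear_lin_ext assms)
  then show ?thesis by (simp only: lin_ext_basis)
qed


text \<open>
  Sweedler sums. Unlike \<^const>\<open>tlift\<close>, which is \<open>0\<close> on maps that are not bilinear, \<open>tsum\<close> uses a chosen
  representative of the tensor and is linear in \<open>f\<close> without side conditions, so that independent sums
  commute unconditionally.
\<close>

definition tsum :: "('a::qvs, 'b::qvs) tensor \<Rightarrow> ('a \<Rightarrow> 'b \<Rightarrow> 'c::qvs) \<Rightarrow> 'c" where
  "tsum t f = lin_ext (\<lambda>(a, b). f a b) (rep_tensor t)"

text \<open>For bilinear maps the choice of representative does not matter. Statements about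
  \<open>tlift\<close>, among them the Hopf algebra axioms, enter the Sweedler calculus
  here.\<close>

lemma tsum_tlift:
  assumes "bilinearQ f"
  shows "tsum t f = tlift f t"
proof -
  have "tlift f t = tlift f (abs_tensor (rep_tensor t))"
    by (simp add: Quotient_abs_rep[OF Quotient_tensor])
  also have "\<dots> = tsum t f"
    using assms by (simp add: tlift.abs_eq tsum_def)
  finally show ?thesis by simp
qed

lemma tsum_linear: "linearQ T \<Longrightarrow> T (tsum t f) = tsum t (\<lambda>a b. T (f a b))"
  by (simp add: tsum_def linear_lin_ext case_prod_unfold)

lemma tsum_swap: "tsum s (\<lambda>a b. tsum t (\<lambda>c d. f a b c d)) = tsum t (\<lambda>c d. tsum s (\<lambda>a b. f a b c d))"
  unfolding tsum_def lin_ext_def case_prod_unfold qvs.scale_sum_right scaleQ_scaleQ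
  by (rule trans[OF sum.swap]) (simp only: mult.commute)

lemma tsum_add: "tsum t (\<lambda>a b. f a b + g a b) = tsum t f + tsum t g"
  by (simp add: tsum_def lin_ext_def case_prod_unfold scaleQ_add_right sum.distrib)

lemma tsum_scale: "tsum t (\<lambda>a b. c *\<^sub>Q f a b) = c *\<^sub>Q tsum t f"
  by (rule tsum_linear[symmetric]) (intro lin)

lemma tsum_mem:
  assumes "qvs.subspace W" "\<And>a b. f a b \<in> W"
  shows "tsum t f \<in> W"
  unfolding tsum_def using assms by (intro lin_ext_mem) auto

lemma linearQ_tsum_fun [lin]: "(\<And>a b. linearQ (\<lambda>x. f x a b)) \<Longrightarrow> linearQ (\<lambda>x. tsum t (f x))"
proof (rule linearQ_I)
  assume lin: "\<And>a b. linearQ (\<lambda>x. f x a b)"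
  have "f (x + y) = (\<lambda>a b. f x a b + f y a b)" for x y
    by (intro ext) (rule linearQ_add[OF lin])
  then show "tsum t (f (x + y)) = tsum t (f x) + tsum t (f y)" for x y
    by (simp add: tsum_add)
  have "f (c *\<^sub>Q x) = (\<lambda>a b. c *\<^sub>Q f x a b)" for c x
    by (intro ext) (rule linearQ_scale[OF lin])
  then show "tsum t (f (c *\<^sub>Q x)) = c *\<^sub>Q tsum t (f x)" for c x
    by (simp add: tsum_scale)
qed

text \<open>Linearity in the tensor, unlike linearity in the summand, rests on bilinearity of
  \<open>f\<close>: the chosen representative of a sum need not be the sum of the
  representatives.\<close>

lemma linearQ_tsum_arg [lin]:
  assumes "linearQ g" "\<And>b. linearQ (\<lambda>a. f a b)" "\<And>a. linearQ (\<lambda>b. f a b)"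
  shows "linearQ (\<lambda>x. tsum (g x) f)"
  using assms by (simp add: tsum_tlift bilinearQ_I linearQ_tlift_arg)

lemma tsum_tens:
  "(\<And>b. linearQ (\<lambda>a. f a b)) \<Longrightarrow> (\<And>a. linearQ (\<lambda>b. f a b)) \<Longrightarrow> tsum (a \<otimes> b) f = f a b"
  by (simp add: tsum_tlift bilinearQ_I tlift_tens)

text \<open>A tensor is the sum of the pure tensors listed in its representative; this is what
  reduces linear identities to pure tensors in \<open>tensor_eqI\<close>.\<close>

lemma tsum_tensor: "tsum t (\<otimes>) = t"
proof -
  have "tsum t (\<otimes>) = tlift (\<otimes>) t" by (simp add: tsum_tlift bilinearQ_tens)
  also have "\<dots> = abs_tensor (rep_tensor t)"
  proof -
    interpret l: Vector_Spaces.linear scaleQ scaleQ "abs_tensor :: ('a \<times> 'b \<Rightarrow>\<^sub>0 qv) \<Rightarrow> _"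
      by (rule linearQ_I) (simp_all add: plus_tensor.abs_eq scaleQ_tensor.abs_eq)
    have *: "abs_tensor p = lin_ext (\<lambda>(a, b). a \<otimes> b) p" for p :: "'a \<times> 'b \<Rightarrow>\<^sub>0 qv"
    proof -
      have "abs_tensor p = abs_tensor (lin_ext (\<lambda>k. Poly_Mapping.single k 1) p)"
        by (simp add: lin_ext_basis)
      also have "\<dots> = lin_ext (\<lambda>k. abs_tensor (Poly_Mapping.single k 1)) p"
        by (rule linear_lin_ext) (rule l.linear_axioms)
      finally show ?thesis
        by (simp add: case_prod_unfold tens.abs_eq)
    qed
    show ?thesis
      by (simp add: * tsum_tlift[OF bilinearQ_tens, symmetric] tsum_def)
  qed
  also have "\<dots> = t" by (rule Quotient_abs_rep[OF Quotient_tensor])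
  finally show ?thesis .
qed

lemma tensor_subspace_UNIV:
  assumes "qvs.subspace W" "\<And>a b. a \<otimes> b \<in> W"
  shows "t \<in> W"
  using tsum_mem[of W "(\<otimes>)" t] assms by (simp add: tsum_tensor)

lemma tensor_eqI:
  assumes "linearQ f" "linearQ g" "\<And>a b. f (a \<otimes> b) = g (a \<otimes> b)"
  shows "f t = g t"
  using tensor_subspace_UNIV[OF linear_eq_subspace[OF assms(1,2)], of t] assms(3) by simp

lemma bilinearQ_tmap: "linearQ f \<Longrightarrow> linearQ g \<Longrightarrow> bilinearQ (\<lambda>a b. f a \<otimes> g b)"
  by (intro bilinearQ_I lin)

lemma tmap_tens: "linearQ f \<Longrightarrow> linearQ g \<Longrightarrow> tmap f g (a \<otimes> b) = f a \<otimes> g b"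
  by (simp add: tmap_def tlift_tens bilinearQ_tmap)

lemma tmap_tsum: "linearQ f \<Longrightarrow> linearQ g \<Longrightarrow> tmap f g t = tsum t (\<lambda>a b. f a \<otimes> g b)"
  by (simp add: tmap_def tsum_tlift bilinearQ_tmap)

lemma linearQ_tmap [lin]: "linearQ h \<Longrightarrow> linearQ (\<lambda>x. tmap f g (h x))"
  unfolding tmap_def by (intro lin)

lemma tmap_tmap:
  assumes "linearQ f" "linearQ g" "linearQ f'" "linearQ g'"
  shows "tmap f g (tmap f' g' t) = tmap (\<lambda>x. f (f' x)) (\<lambda>x. g (g' x)) t"
  by (rule tensor_eqI[where t = t]) (simp_all add: assms lin tmap_tens linearQ_compose)

lemma tassoc_tens: "tassoc ((a \<otimes> b) \<otimes> c) = a \<otimes> (b \<otimes> c)"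
  unfolding tassoc_def
  by (subst tlift_tens, rule bilinearQ_I, intro lin)
     (simp add: bilinearQ_I lin flip: tsum_tlift, simp add: tlift_tens bilinearQ_I lin)

lemma linearQ_tassoc: "linearQ tassoc"
  unfolding tassoc_def by (rule linearQ_tlift)

section \<open>Algebras\<close>

lemma linearQ_amult_left [lin]: "algebra A \<Longrightarrow> linearQ f \<Longrightarrow> linearQ (\<lambda>x. amult A (f x) c)"
  and linearQ_amult_right [lin]: "algebra A \<Longrightarrow> linearQ f \<Longrightarrow> linearQ (\<lambda>x. amult A c (f x))"
  by (simp_all add: algebra_def bilinearQ_left bilinearQ_right)

lemma algebra_assoc: "algebra A \<Longrightarrow> amult A (amult A a b) c = amult A a (amult A b c)"
  and algebra_one_left: "algebra A \<Longrightarrow> amult A (aone A) a = a"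
  and algebra_one_right: "algebra A \<Longrightarrow> amult A a (aone A) = a"
  by (simp_all add: algebra_def)

lemmas algebra_rules = algebra_assoc algebra_one_left algebra_one_right

lemma
  assumes "algebra A"
  shows amult_add_left: "amult A (a + b) c = amult A a c + amult A b c"
    and amult_add_right: "amult A c (a + b) = amult A c a + amult A c b"
    and amult_scale_left: "amult A (s *\<^sub>Q a) c = s *\<^sub>Q amult A a c"
    and amult_scale_right: "amult A c (s *\<^sub>Q a) = s *\<^sub>Q amult A c a"
    and amult_minus_left: "amult A (- a) c = - amult A a c"
    and amult_minus_right: "amult A c (- a) = - amult A c a"
    and amult_diff_left: "amult A (a - b) c = amult A a c - amult A b c"
    and amult_diff_right: "amult A c (a - b) = amult A c a - amult A c b"
    and amult_zero_left: "amult A 0 c = 0"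
    and amult_zero_right: "amult A c 0 = 0"
  using linearQ_amult_left[OF assms linearQ_ident, of c] linearQ_amult_right[OF assms linearQ_ident, of c]
  by (blast dest: linearQ_add linearQ_scale linearQ_uminus linearQ_diff linearQ_zero)+

lemmas amult_simps = amult_add_left amult_add_right amult_scale_left amult_scale_right
  amult_minus_left amult_minus_right amult_diff_left amult_diff_right amult_zero_left amult_zero_right

text \<open>Products live in records, so the class operation \<open>^\<close> serves the free
  algebra only; \<open>eval_free_power\<close> translates between the two.\<close>

definition apow :: "('a::qvs, 'z) alg_scheme \<Rightarrow> 'a \<Rightarrow> nat \<Rightarrow> 'a" where
  "apow A a n = (amult A a ^^ n) (aone A)"

lemma apow_0 [simp]: "apow A a 0 = aone A"
  and apow_Suc [simp]: "apow A a (Suc n) = amult A a (apow A a n)"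
  by (simp_all add: apow_def)

lemma alg_hom_linear: "alg_hom A B f \<Longrightarrow> linearQ f"
  and alg_hom_one: "alg_hom A B f \<Longrightarrow> f (aone A) = aone B"
  and alg_hom_mult: "alg_hom A B f \<Longrightarrow> f (amult A a b) = amult B (f a) (f b)"
  by (simp_all add: alg_hom_def)

lemma alg_hom_apow:
  assumes "alg_hom A B f"
  shows "f (apow A a n) = apow B (f a) n"
  by (induction n) (simp_all add: alg_hom_one[OF assms] alg_hom_mult[OF assms])

text \<open>Antimultiplicative maps such as the antipode become homomorphisms into the opposite
  algebra, so that they too can be compared on generators by
  \<open>presented_by_hom_eq\<close>.\<close>

definition opposite :: "('a::qvs, 'z) alg_scheme \<Rightarrow> 'a alg" where
  "opposite A = \<lparr>amult = (\<lambda>a b. amult A b a), aone = aone A\<rparr>"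

lemma opposite_sel [simp]: "amult (opposite A) a b = amult A b a" "aone (opposite A) = aone A"
  by (simp_all add: opposite_def)

section \<open>Linear endomorphisms\<close>

text \<open>The universal property of a presentation targets algebras whose carrier is a whole type
  of class \<open>qvs\<close>; a representation is a homomorphism into this one.\<close>

typedef (overloaded) 'm lin_end = "{f :: 'm::qvs \<Rightarrow> 'm. linearQ f}"
  morphisms app End
  by (auto intro: linearQ_ident)

lemma linearQ_app: "linearQ (app T)"
  using app[of T] by simp

lemma app_End: "linearQ f \<Longrightarrow> app (End f) = f"
  by (simp add: End_inverse)

lemma lin_end_eqI: "(\<And>m. app S m = app T m) \<Longrightarrow> S = T"
  by (simp add: app_inject[symmetric] fun_eq_iff)

instantiation lin_end :: (qvs) qvs
begin
definition "0 = End (\<lambda>m. 0)"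
definition "S + T = End (\<lambda>m. app S m + app T m)"
definition "S - T = End (\<lambda>m. app S m - app T m)"
definition "- T = End (\<lambda>m. - app T m)"
definition "c *\<^sub>Q T = End (\<lambda>m. c *\<^sub>Q app T m)"

lemma app_zero: "app 0 m = 0"
  and app_plus: "app (S + T) m = app S m + app T m"
  and app_diff: "app (S - T) m = app S m - app T m"
  and app_minus: "app (- T) m = - app T m"
  and app_scale: "app (c *\<^sub>Q T) m = c *\<^sub>Q app T m"
proof -
  have [simp]: "linearQ (\<lambda>m. 0 :: 'a)" by (simp add: linearQ_iff)
  have [simp]: "linearQ (\<lambda>m. app S m - app T m)" for S T :: "'a lin_end"
    using linearQ_plus[OF linearQ_app linearQ_neg[OF linearQ_app], of S T] by simp
  show "app 0 m = 0" by (simp add: zero_lin_end_def app_End)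
  show "app (S + T) m = app S m + app T m" by (simp add: plus_lin_end_def app_End linearQ_plus linearQ_app)
  show "app (S - T) m = app S m - app T m" by (simp add: minus_lin_end_def app_End)
  show "app (- T) m = - app T m" by (simp add: uminus_lin_end_def app_End linearQ_neg linearQ_app)
  show "app (c *\<^sub>Q T) m = c *\<^sub>Q app T m"
    by (simp add: scaleQ_lin_end_def app_End linearQ_const_scaleQ linearQ_app)
qed

instance
  by standard (rule lin_end_eqI; simp add: app_zero app_plus app_diff app_minus app_scale
      scaleQ_add_right scaleQ_add_left scaleQ_scaleQ scaleQ_one)+
end

definition end_alg :: "'m::qvs lin_end alg" where
  "end_alg = \<lparr>amult = (\<lambda>S T. End (\<lambda>m. app S (app T m))), aone = End (\<lambda>m. m)\<rparr>"

lemma app_mult: "app (amult end_alg S T) m = app S (app T m)"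
  by (simp add: end_alg_def app_End linearQ_compose linearQ_app)

lemma app_one: "app (aone end_alg) m = m"
  by (simp add: end_alg_def app_End linearQ_ident)

lemma linearQ_app_fun: "linearQ (\<lambda>T. app T m)"
  by (rule linearQ_I) (simp_all add: app_plus app_scale)

lemma algebra_end_alg: "algebra end_alg"
  unfolding algebra_def bilinearQ_def linearQ_iff
  by (auto intro!: lin_end_eqI simp: app_mult app_one app_plus app_scale
        linearQ_add[OF linearQ_app] linearQ_scale[OF linearQ_app])


section \<open>Evaluation of noncommutative polynomials\<close>

lemma linearQ_eval_free: "linearQ (eval_free A x)"
  unfolding eval_free_def by (rule linearQ_lin_ext)

lemma eval_free_word:
  "eval_free A x (Poly_Mapping.single w 1) = foldr (amult A) (map x (letters w)) (aone A)"
  by (simp add: eval_free_def lin_ext_single)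

lemma scaleQ_single: "c *\<^sub>Q Poly_Mapping.single k a = Poly_Mapping.single k (c * a)"
  by (rule poly_mapping_eqI) (simp add: scaleQ_poly_mapping.rep_eq lookup_single when_def)

text \<open>Scalars are the polynomials supported on the empty word \<open>0\<close>, so
  compatibility of scaling with the product becomes associativity together with centrality of these
  constants.\<close>

lemma scaleQ_conv_times: "c *\<^sub>Q p = Poly_Mapping.single 0 c * (p :: 'g free_alg)"
proof -
  have "c *\<^sub>Q p = Poly_Mapping.map ((*) c) p"
    by (rule poly_mapping_eqI) (simp add: scaleQ_poly_mapping.rep_eq Poly_Mapping.map.rep_eq when_def)
  then show ?thesis by (simp only: mult_map_scale_conv_mult)
qed

lemma free_scaleQ_left: "(c *\<^sub>Q p) * q = c *\<^sub>Q (p * q)" for p q :: "'g free_alg"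
  by (simp add: scaleQ_conv_times mult.assoc)

lemma free_scaleQ_right: "p * (c *\<^sub>Q q) = c *\<^sub>Q (p * q)" for p q :: "'g free_alg"
proof -
  have "Poly_Mapping.single 0 c * lin_ext (\<lambda>k. Poly_Mapping.single k 1) p
      = lin_ext (\<lambda>k. Poly_Mapping.single k 1) p * Poly_Mapping.single 0 c"
    by (simp add: lin_ext_def sum_distrib_left sum_distrib_right scaleQ_single mult_single mult.commute)
  then have "Poly_Mapping.single 0 c * p = p * Poly_Mapping.single 0 c"
    by (simp only: lin_ext_basis)
  then show ?thesis by (simp add: scaleQ_conv_times flip: mult.assoc)
qed

text \<open>Both sides are bilinear, so words suffice, and there the fold over a concatenation
  splits into a product of two folds.\<close>

lemma eval_free_mult:
  fixes x :: "'g \<Rightarrow> 'a::qvs"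
  assumes A: "algebra A"
  shows "eval_free A x (p * q) = amult A (eval_free A x p) (eval_free A x q)"
proof -
  have fold: "foldr (amult A) (map x (ls @ ms)) (aone A) =
      amult A (foldr (amult A) (map x ls) (aone A)) (foldr (amult A) (map x ms) (aone A))" for ls ms
    by (induction ls) (simp_all add: algebra_rules[OF A])
  have *: "eval_free A x (Poly_Mapping.single v 1 * Poly_Mapping.single w 1) =
      amult A (eval_free A x (Poly_Mapping.single v 1)) (eval_free A x (Poly_Mapping.single w 1))" for v w
    by (simp add: mult_single eval_free_word plus_word_def fold[simplified])
  have mult_left: "linearQ (\<lambda>p. p * q)" "linearQ (\<lambda>p. q * p)" for q :: "'g free_alg"
    by (simp_all add: linearQ_iff distrib_left distrib_right free_scaleQ_left free_scaleQ_right)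
  have **: "eval_free A x (p * Poly_Mapping.single w 1) =
      amult A (eval_free A x p) (eval_free A x (Poly_Mapping.single w 1))" for w
    by (rule poly_mapping_linear_eqI[where p = p])
       (simp_all add: linearQ_compose[OF linearQ_eval_free] mult_left lin linearQ_eval_free A *)
  show ?thesis
    by (rule poly_mapping_linear_eqI[where p = q])
       (simp_all add: linearQ_compose[OF linearQ_eval_free] mult_left lin linearQ_eval_free A **)
qed

lemma eval_free_one: "eval_free A x 1 = aone A"
  using eval_free_word[of A x 0] unfolding single_one by (simp add: zero_word_def)

lemma eval_free_gen: "algebra A \<Longrightarrow> eval_free A x (gen g) = x g"
  by (simp add: gen_def eval_free_word algebra_rules)

lemma eval_free_power: "algebra A \<Longrightarrow> eval_free A x (p ^ n) = apow A (eval_free A x p) n"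
  by (induction n) (simp_all add: eval_free_one eval_free_mult)

lemmas eval_free_linear = linearQ_add[OF linearQ_eval_free] linearQ_diff[OF linearQ_eval_free]
  linearQ_scale[OF linearQ_eval_free] linearQ_zero[OF linearQ_eval_free] linearQ_sum[OF linearQ_eval_free]

lemmas eval_free_simps = eval_free_linear eval_free_mult eval_free_one eval_free_gen eval_free_power

text \<open>The Serre relator evaluated in an arbitrary algebra; in this form the relation travels
  along homomorphisms by \<open>alg_hom_serre\<close>.\<close>

definition serre_value ::
  "('i \<Rightarrow> 'i \<Rightarrow> int) \<Rightarrow> ('i \<Rightarrow> nat) \<Rightarrow> ('a::qvs, 'z) alg_scheme \<Rightarrow> ('i \<Rightarrow> 'a) \<Rightarrow> 'i \<Rightarrow> 'i \<Rightarrow> 'a" where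
  "serre_value C d A e i j =
     (let m = nat (1 - C i j) in
        \<Sum>r = 0..m. ((-1) ^ r * qbinom (vv ^ d i) m r) *\<^sub>Q
          amult A (amult A (apow A (e i) r) (e j)) (apow A (e i) (m - r)))"

lemma eval_free_serre:
  "algebra A \<Longrightarrow> eval_free A x (serre C d X i j) = serre_value C d A (\<lambda>i. eval_free A x (X i)) i j"
  by (simp add: serre_def serre_value_def Let_def eval_free_simps)

lemma alg_hom_serre:
  assumes "alg_hom A B f"
  shows "f (serre_value C d A e i j) = serre_value C d B (\<lambda>i. f (e i)) i j"
  by (simp add: serre_value_def Let_def linearQ_sum[OF alg_hom_linear[OF assms]]
      linearQ_scale[OF alg_hom_linear[OF assms]] alg_hom_mult[OF assms] alg_hom_apow[OF assms])


section \<open>Presented algebras\<close>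

lemma presented_by_relation:
  assumes "presented_by A x R" "r \<in> R"
  shows "eval_free A x r = 0"
proof -
  have "1 * r * 1 \<in> two_sided_ideal R"
    unfolding two_sided_ideal_def using assms(2) by (intro qvs.span_base) blast
  then show ?thesis using assms(1) unfolding presented_by_def by auto
qed

text \<open>Universal property of the presentation: two polynomials with the same value in A differ
  by an element of the ideal generated by R, which evaluation in B kills.\<close>

lemma presented_by_hom:
  assumes "presented_by A x R" "algebra B" "\<And>r. r \<in> R \<Longrightarrow> eval_free B y r = 0"
  obtains f where "alg_hom A B f" "\<And>g. f (x g) = y g"
proof -
  have A: "algebra A" and surj: "surj (eval_free A x)" and ker: "{p. eval_free A x p = 0} = two_sided_ideal R"
    using assms(1) unfolding presented_by_def by auto
  have vanish: "eval_free B y p = 0" if "p \<in> two_sided_ideal R" for p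
    using that[unfolded two_sided_ideal_def]
  proof (rule qvs.span_induct[where P = "\<lambda>p. eval_free B y p = 0"])
    show "qvs.subspace {p. eval_free B y p = 0}"
      by (intro linear_eq_subspace linearQ_0 linearQ_eval_free)
  qed (auto simp: eval_free_mult assms(2,3) amult_simps[OF assms(2)])
  have 0: "eval_free B y p = eval_free B y q" if "eval_free A x p = eval_free A x q" for p q
  proof -
    have "eval_free A x (p - q) = 0" using that by (simp add: eval_free_linear)
    then have "eval_free B y (p - q) = 0" using ker vanish by blast
    then show ?thesis by (simp add: eval_free_linear)
  qed
  \<comment> \<open>An arbitrary section, in general not linear; fact \<open>0\<close> makes
    \<open>f\<close> independent of the choice.\<close>
  define s where "s = inv (eval_free A x)"
  define f where "f a = eval_free B y (s a)" for a
  have s: "eval_free A x (s a) = a" for a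
    unfolding s_def by (rule surj_f_inv_f[OF surj])
  have f: "f (eval_free A x p) = eval_free B y p" for p
    unfolding f_def by (rule 0) (simp add: s)
  show thesis
  proof
    show "f (x g) = y g" for g
      using f[of "gen g"] by (simp add: eval_free_gen A assms(2))
    have "f (a + b) = f a + f b" for a b
      using f[of "s a + s b"] by (simp add: eval_free_linear s f_def)
    moreover have "f (c *\<^sub>Q a) = c *\<^sub>Q f a" for c a
      using f[of "c *\<^sub>Q s a"] by (simp add: eval_free_linear s f_def)
    moreover have "f (amult A a b) = amult B (f a) (f b)" for a b
      using f[of "s a * s b"] by (simp add: eval_free_mult A assms(2) s f_def)
    moreover have "f (aone A) = aone B"
      using f[of 1] by (simp add: eval_free_one)
    ultimately show "alg_hom A B f"
      unfolding alg_hom_def by (auto intro: linearQ_I)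
  qed
qed

text \<open>Induction over words, built by prefixing letters. Stability is required under left
  multiplication by generators only, so V may be a subspace that is not visibly a
  subalgebra.\<close>

lemma presented_by_subspace:
  assumes "presented_by A x R" "qvs.subspace V" "aone A \<in> V"
    and "\<And>g a. a \<in> V \<Longrightarrow> amult A (x g) a \<in> V"
  shows "a \<in> V"
proof -
  obtain p where "a = eval_free A x p"
    using assms(1) unfolding presented_by_def surj_def by blast
  moreover have "foldr (amult A) (map x ls) (aone A) \<in> V" for ls
    by (induction ls) (simp_all add: assms)
  ultimately show ?thesis
    by (simp add: eval_free_def lin_ext_mem[OF assms(2)])
qed

lemma presented_by_hom_eq:
  assumes "presented_by A x R" and f: "alg_hom A B f" and g: "alg_hom A B g"
    and "\<And>k. f (x k) = g (x k)"
  shows "f a = g a"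
proof -
  have "a \<in> {a. f a = g a}"
    by (rule presented_by_subspace[OF assms(1)])
       (simp_all add: linear_eq_subspace alg_hom_linear[OF f] alg_hom_linear[OF g]
          alg_hom_one[OF f] alg_hom_one[OF g] alg_hom_mult[OF f] alg_hom_mult[OF g] assms(4))
  then show ?thesis by simp
qed

section \<open>Tensor products of algebras\<close>

lemma tensor_alg_one: "aone (tensor_alg A B) = aone A \<otimes> aone B"
  by (simp add: tensor_alg_def)

lemma tensor_alg_tsum:
  assumes "algebra A" "algebra B"
  shows "amult (tensor_alg A B) s t = tsum s (\<lambda>a b. tsum t (\<lambda>a' b'. amult A a a' \<otimes> amult B b b'))"
proof -
  have "tlift (\<lambda>a' b'. amult A a a' \<otimes> amult B b b') t = tsum t (\<lambda>a' b'. amult A a a' \<otimes> amult B b b')" for a b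
    by (intro tsum_tlift[symmetric] bilinearQ_I lin assms)
  moreover have "tlift (\<lambda>a b. tsum t (\<lambda>a' b'. amult A a a' \<otimes> amult B b b')) s
      = tsum s (\<lambda>a b. tsum t (\<lambda>a' b'. amult A a a' \<otimes> amult B b b'))"
    by (intro tsum_tlift[symmetric] bilinearQ_I lin assms)
  ultimately show ?thesis by (simp add: tensor_alg_def)
qed

lemma tensor_alg_tens:
  assumes "algebra A" "algebra B"
  shows "amult (tensor_alg A B) (a \<otimes> b) (a' \<otimes> b') = amult A a a' \<otimes> amult B b b'"
  by (simp add: tensor_alg_tsum assms tsum_tens lin)

lemma algebra_tensor_alg:
  fixes A :: "('a::qvs, 'y) alg_scheme" and B :: "('b::qvs, 'z) alg_scheme"
  assumes A: "algebra A" and B: "algebra B"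
  shows "algebra (tensor_alg A B)"
proof -
  let ?T = "tensor_alg A B"
  have lin_left [lin]: "linearQ (\<lambda>x. amult ?T (f x) t)" if "linearQ f" for f :: "'c::qvs \<Rightarrow> _" and t
    unfolding tensor_alg_tsum[OF A B] by (intro lin that A B)
  have lin_right [lin]: "linearQ (\<lambda>x. amult ?T t (f x))" if "linearQ f" for f :: "'c::qvs \<Rightarrow> _" and t
    unfolding tensor_alg_tsum[OF A B] by (intro lin that A B)
  have bil: "bilinearQ (amult ?T)"
    by (rule bilinearQ_I) (auto intro!: lin_left lin_right lin)
  have assoc: "amult ?T (amult ?T r s) t = amult ?T r (amult ?T s t)" for r s t
  proof -
    have 1: "amult ?T (amult ?T (a \<otimes> b) (a' \<otimes> b')) (a'' \<otimes> b'') = amult ?T (a \<otimes> b) (amult ?T (a' \<otimes> b') (a'' \<otimes> b''))"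
      for a b a' b' a'' b''
      by (simp add: tensor_alg_tens A B algebra_rules)
    have 2: "amult ?T (amult ?T (a \<otimes> b) (a' \<otimes> b')) t = amult ?T (a \<otimes> b) (amult ?T (a' \<otimes> b') t)" for a b a' b'
      by (rule tensor_eqI[where t = t]) (intro lin_left lin_right lin 1)+
    have 3: "amult ?T (amult ?T (a \<otimes> b) s) t = amult ?T (a \<otimes> b) (amult ?T s t)" for a b
      by (rule tensor_eqI[where t = s]) (intro lin_left lin_right lin 2)+
    show ?thesis
      by (rule tensor_eqI[where t = r]) (intro lin_left lin_right lin 3)+
  qed
  have "amult ?T (aone ?T) t = t" for t
    unfolding tensor_alg_one
    by (rule tensor_eqI[where t = t]) (simp_all add: lin lin_right tensor_alg_tens A B algebra_rules)
  moreover have "amult ?T t (aone ?T) = t" for t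
    unfolding tensor_alg_one
    by (rule tensor_eqI[where t = t]) (simp_all add: lin lin_left tensor_alg_tens A B algebra_rules)
  ultimately show ?thesis
    unfolding algebra_def using bil assoc by blast
qed


section \<open>Sweedler calculus\<close>

locale hopf_alg =
  fixes H :: "'a::qvs hopf"
  assumes hopf: "hopf_algebra H"
begin

abbreviation mul (infixl \<open>\<cdot>\<close> 77) where "a \<cdot> b \<equiv> amult H a b"
abbreviation one (\<open>\<one>\<close>) where "\<one> \<equiv> aone H"
abbreviation \<Delta> where "\<Delta> \<equiv> comult H"
abbreviation \<epsilon> where "\<epsilon> \<equiv> counit H"
abbreviation S where "S \<equiv> antipode H"

text \<open>Agrees with \<open>sw2\<close> on bilinear maps, but being built on \<open>tsum\<close>
  it inherits the rules for swapping sums and for pushing linear maps inside, with no condition on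
  \<open>f\<close>.\<close>

definition sw :: "'a \<Rightarrow> ('a \<Rightarrow> 'a \<Rightarrow> 'c::qvs) \<Rightarrow> 'c" where
  "sw a f = tsum (\<Delta> a) f"

lemma alg: "algebra H"
  and comult_hom: "alg_hom H (tensor_alg H H) \<Delta>"
  and counit_hom: "alg_hom H base_alg \<epsilon>"
  and linear_antipode: "linearQ S"
  using hopf by (simp_all add: hopf_algebra_def)

lemmas [simp] = algebra_one_left[OF alg] algebra_one_right[OF alg]
lemmas assoc = algebra_assoc[OF alg]
lemmas mult_lin [lin] = linearQ_amult_left[OF alg] linearQ_amult_right[OF alg]

lemma S_lin [lin]: "linearQ f \<Longrightarrow> linearQ (\<lambda>x. S (f x))"
  and \<Delta>_lin [lin]: "linearQ f \<Longrightarrow> linearQ (\<lambda>x. \<Delta> (f x))"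
  and \<epsilon>_lin [lin]: "linearQ f \<Longrightarrow> linearQ (\<lambda>x. \<epsilon> (f x))"
  by (intro linearQ_compose[OF linear_antipode] linearQ_compose[OF alg_hom_linear[OF comult_hom]]
      linearQ_compose[OF alg_hom_linear[OF counit_hom]]; assumption)+

lemma sw_lin [lin]:
  "linearQ g \<Longrightarrow> (\<And>q. linearQ (\<lambda>p. f p q)) \<Longrightarrow> (\<And>p. linearQ (\<lambda>q. f p q)) \<Longrightarrow> linearQ (\<lambda>x. sw (g x) f)"
  unfolding sw_def by (intro lin)

lemma sw_fun_lin [lin]: "(\<And>p q. linearQ (\<lambda>x. f x p q)) \<Longrightarrow> linearQ (\<lambda>x. sw a (f x))"
  unfolding sw_def by (intro lin)

lemma sw_swap: "sw a (\<lambda>p q. sw b (\<lambda>r s. f p q r s)) = sw b (\<lambda>r s. sw a (\<lambda>p q. f p q r s))"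
  unfolding sw_def by (rule tsum_swap)

lemma sw_linear: "linearQ T \<Longrightarrow> T (sw a f) = sw a (\<lambda>p q. T (f p q))"
  unfolding sw_def by (rule tsum_linear)

lemma sw_scale: "c *\<^sub>Q sw a f = sw a (\<lambda>p q. c *\<^sub>Q f p q)"
  by (intro sw_linear lin)

lemma sw_tensor: "sw a (\<otimes>) = \<Delta> a"
  by (simp add: sw_def tsum_tensor)

lemma sw2_sw:
  "(\<And>q. linearQ (\<lambda>p. f p q)) \<Longrightarrow> (\<And>p. linearQ (\<lambda>q. f p q)) \<Longrightarrow> sw2 H a f = sw a f"
  by (simp add: sw2_def sw_def tsum_tlift bilinearQ_I)

text \<open>The trilinear \<open>f\<close> induces a linear map \<open>g\<close> on triple tensors;
  applying \<open>g\<close> to the coassociativity axiom gives the two iterated sums.\<close>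

lemma sw_coassoc:
  assumes f: "\<And>b c. linearQ (\<lambda>a. f a b c)" "\<And>a c. linearQ (\<lambda>b. f a b c)" "\<And>a b. linearQ (\<lambda>c. f a b c)"
  shows "sw a (\<lambda>p q. sw p (\<lambda>r s. f r s q)) = sw a (\<lambda>p q. sw q (\<lambda>r s. f p r s))"
proof -
  define g where "g t = tsum t (\<lambda>p s. tsum s (\<lambda>q r. f p q r))" for t
  have g: "linearQ g" unfolding g_def by (intro lin f)
  have g_tens: "g (p \<otimes> s) = tsum s (\<lambda>q r. f p q r)" for p s
    unfolding g_def by (intro tsum_tens lin f)
  have g_tassoc: "g (tassoc (s \<otimes> q)) = tsum s (\<lambda>p1 p2. f p1 p2 q)" for s q
    by (rule tensor_eqI[where t = s])
       (auto intro!: linearQ_compose[OF g] linearQ_compose[OF linearQ_tassoc] lin f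
          simp: tassoc_tens g_tens tsum_tens f)
  have "tassoc (tmap \<Delta> id (\<Delta> a)) = tmap id \<Delta> (\<Delta> a)"
    using hopf by (simp add: hopf_algebra_def)
  then have "g (tassoc (tmap \<Delta> id (\<Delta> a))) = g (tmap id \<Delta> (\<Delta> a))"
    by simp
  moreover have "g (tassoc (tmap \<Delta> id (\<Delta> a))) = sw a (\<lambda>p q. sw p (\<lambda>r s. f r s q))"
    unfolding sw_def
    by (subst tmap_tsum, intro lin, intro lin, subst tsum_linear[of "\<lambda>t. g (tassoc t)"],
        intro linearQ_compose[OF g] linearQ_compose[OF linearQ_tassoc] lin, simp add: g_tassoc)
  moreover have "g (tmap id \<Delta> (\<Delta> a)) = sw a (\<lambda>p q. sw q (\<lambda>r s. f p r s))"
    unfolding sw_def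
    by (subst tmap_tsum, intro lin, intro lin, subst tsum_linear[OF g], simp add: g_tens)
  ultimately show ?thesis by simp
qed

lemma sw_counit_left: "linearQ f \<Longrightarrow> sw a (\<lambda>p q. \<epsilon> p *\<^sub>Q f q) = f a"
  and sw_counit_right: "linearQ f \<Longrightarrow> sw a (\<lambda>p q. \<epsilon> q *\<^sub>Q f p) = f a"
proof -
  have "sw a (\<lambda>p q. \<epsilon> p *\<^sub>Q q) = a" "sw a (\<lambda>p q. \<epsilon> q *\<^sub>Q p) = a"
    using hopf by (simp_all add: hopf_algebra_def sw_def tsum_tlift bilinearQ_I lin)
  then show "linearQ f \<Longrightarrow> sw a (\<lambda>p q. \<epsilon> p *\<^sub>Q f q) = f a" "linearQ f \<Longrightarrow> sw a (\<lambda>p q. \<epsilon> q *\<^sub>Q f p) = f a"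
    using sw_linear[of f a "\<lambda>p q. \<epsilon> p *\<^sub>Q q"] sw_linear[of f a "\<lambda>p q. \<epsilon> q *\<^sub>Q p"]
    by (simp_all add: linearQ_scale)
qed

text \<open>\<open>T\<close> is a linear context: it allows the antipode axiom to be used deep
  inside a larger expression.\<close>

lemma sw_antipode_left: "linearQ T \<Longrightarrow> sw a (\<lambda>p q. T (S p \<cdot> q)) = \<epsilon> a *\<^sub>Q T \<one>"
  and sw_antipode_right: "linearQ T \<Longrightarrow> sw a (\<lambda>p q. T (p \<cdot> S q)) = \<epsilon> a *\<^sub>Q T \<one>"
proof -
  have "sw a (\<lambda>p q. S p \<cdot> q) = \<epsilon> a *\<^sub>Q \<one>" "sw a (\<lambda>p q. p \<cdot> S q) = \<epsilon> a *\<^sub>Q \<one>"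
    using hopf by (simp_all add: hopf_algebra_def sw_def tsum_tlift bilinearQ_I lin)
  then show "linearQ T \<Longrightarrow> sw a (\<lambda>p q. T (S p \<cdot> q)) = \<epsilon> a *\<^sub>Q T \<one>"
      "linearQ T \<Longrightarrow> sw a (\<lambda>p q. T (p \<cdot> S q)) = \<epsilon> a *\<^sub>Q T \<one>"
    using sw_linear[of T a "\<lambda>p q. S p \<cdot> q"] sw_linear[of T a "\<lambda>p q. p \<cdot> S q"]
    by (simp_all add: linearQ_scale)
qed

lemma comult_mult: "\<Delta> (a \<cdot> b) = amult (tensor_alg H H) (\<Delta> a) (\<Delta> b)"
  and comult_one: "\<Delta> \<one> = \<one> \<otimes> \<one>"
  using comult_hom by (simp_all add: alg_hom_def tensor_alg_one)

lemma counit_mult: "\<epsilon> (a \<cdot> b) = \<epsilon> a * \<epsilon> b"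
  and counit_one: "\<epsilon> \<one> = 1"
  using counit_hom by (simp_all add: alg_hom_def base_alg_def)

lemma sw_mult:
  assumes f: "\<And>q. linearQ (\<lambda>p. f p q)" "\<And>p. linearQ (\<lambda>q. f p q)"
  shows "sw (a \<cdot> b) f = sw a (\<lambda>p q. sw b (\<lambda>r s. f (p \<cdot> r) (q \<cdot> s)))"
proof -
  have "linearQ (\<lambda>t. tsum t f)" by (intro lin f)
  then show ?thesis
    by (simp add: sw_def comult_mult tensor_alg_tsum[OF alg alg] tsum_linear[of "\<lambda>t. tsum t f"] tsum_tens f)
qed

lemma sw_one: "(\<And>q. linearQ (\<lambda>p. f p q)) \<Longrightarrow> (\<And>p. linearQ (\<lambda>q. f p q)) \<Longrightarrow> sw \<one> f = f \<one> \<one>"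
  by (simp add: sw_def comult_one tsum_tens)

lemma antipode_one: "S \<one> = \<one>"
  using sw_antipode_left[of "\<lambda>x. x" \<one>] by (simp add: sw_one lin counit_one scaleQ_one)

text \<open>Both sides are convolution inverses of the multiplication.\<close>

lemma antipode_mult: "S (a \<cdot> b) = S b \<cdot> S a"
proof -
  \<comment> \<open>\<open>X\<close> is the triple convolution \<Sum> S(a1 b1) a2 b2 S(b3) S(a3).
    Contracting from the right leaves S(a b), contracting the first two factors leaves S(b)
    S(a).\<close>
  define Y where "Y p q1 q2 r s1 s2 = S (p \<cdot> r) \<cdot> (q1 \<cdot> (s1 \<cdot> S s2) \<cdot> S q2)" for p q1 q2 r s1 s2
  define X where "X = sw a (\<lambda>p q. sw q (\<lambda>q1 q2. sw b (\<lambda>r s. sw s (\<lambda>s1 s2. Y p q1 q2 r s1 s2))))"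
  have 1: "X = S (a \<cdot> b)"
  proof -
    have "sw s (\<lambda>s1 s2. Y p q1 q2 r s1 s2) = \<epsilon> s *\<^sub>Q (S (p \<cdot> r) \<cdot> (q1 \<cdot> S q2))" for p q1 q2 r s
      unfolding Y_def
      by (subst sw_antipode_right[where T = "\<lambda>x. S (p \<cdot> r) \<cdot> (q1 \<cdot> x \<cdot> S q2)"]) (simp_all add: lin)
    then have "X = sw a (\<lambda>p q. sw q (\<lambda>q1 q2. S (p \<cdot> b) \<cdot> (q1 \<cdot> S q2)))"
      by (simp add: X_def sw_counit_right lin)
    also have "\<dots> = sw a (\<lambda>p q. \<epsilon> q *\<^sub>Q (S (p \<cdot> b) \<cdot> \<one>))"
      by (subst sw_antipode_right) (simp_all add: lin)
    also have "\<dots> = S (a \<cdot> b)"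
      by (simp add: sw_counit_right lin)
    finally show ?thesis .
  qed
  have 2: "X = S b \<cdot> S a"
  proof -
    have Y_lin: "linearQ (\<lambda>p. Y p q1 q2 r s1 s2)" "linearQ (\<lambda>q1. Y p q1 q2 r s1 s2)" "linearQ (\<lambda>q2. Y p q1 q2 r s1 s2)"
      "linearQ (\<lambda>r. Y p q1 q2 r s1 s2)" "linearQ (\<lambda>s1. Y p q1 q2 r s1 s2)" "linearQ (\<lambda>s2. Y p q1 q2 r s1 s2)"
      for p q1 q2 r s1 s2
      unfolding Y_def by (intro lin)+
    have uv: "sw u (\<lambda>p q1. sw v (\<lambda>r s1. Y p q1 q2 r s1 s2)) = \<epsilon> u *\<^sub>Q \<epsilon> v *\<^sub>Q (S s2 \<cdot> S q2)" for u v q2 s2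
    proof -
      have "sw u (\<lambda>p q1. sw v (\<lambda>r s1. Y p q1 q2 r s1 s2)) = sw (u \<cdot> v) (\<lambda>p q. (S p \<cdot> q) \<cdot> (S s2 \<cdot> S q2))"
        by (simp add: Y_def sw_mult lin assoc)
      also have "\<dots> = \<epsilon> u *\<^sub>Q \<epsilon> v *\<^sub>Q (S s2 \<cdot> S q2)"
        by (subst sw_antipode_left) (simp_all add: lin counit_mult scaleQ_scaleQ)
      finally show ?thesis .
    qed
    have "X = sw a (\<lambda>u q2. sw u (\<lambda>p q1. sw b (\<lambda>r s. sw s (\<lambda>s1 s2. Y p q1 q2 r s1 s2))))"
      unfolding X_def by (rule sw_coassoc[symmetric]) (intro lin Y_lin)+
    also have "\<dots> = sw a (\<lambda>u q2. sw u (\<lambda>p q1. sw b (\<lambda>v s2. sw v (\<lambda>r s1. Y p q1 q2 r s1 s2))))"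
      by (subst sw_coassoc) (intro Y_lin refl)+
    also have "\<dots> = sw a (\<lambda>u q2. sw b (\<lambda>v s2. sw u (\<lambda>p q1. sw v (\<lambda>r s1. Y p q1 q2 r s1 s2))))"
      by (subst sw_swap) (rule refl)
    also have "\<dots> = S b \<cdot> S a"
      by (simp add: uv sw_counit_left sw_scale[symmetric] lin del: qvs.scale_scale)
    finally show ?thesis .
  qed
  from 1 2 show ?thesis by simp
qed

end

section \<open>Hopf pairings\<close>

locale hopf_pair = hopf_alg +
  fixes \<phi> :: "'a \<Rightarrow> 'a \<Rightarrow> qv"
  assumes pairing: "hopf_pairing H \<phi>"
begin

lemma \<phi>_lin [lin]: "linearQ f \<Longrightarrow> linearQ (\<lambda>x. \<phi> (f x) b)" "linearQ f \<Longrightarrow> linearQ (\<lambda>x. \<phi> a (f x))"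
  using pairing by (simp_all add: hopf_pairing_def bilinearQ_left bilinearQ_right)

lemma \<phi>_mult_right: "\<phi> a (b \<cdot> b') = sw a (\<lambda>p q. \<phi> p b * \<phi> q b')"
  and \<phi>_mult_left: "\<phi> (a \<cdot> a') b = sw b (\<lambda>r s. \<phi> a r * \<phi> a' s)"
  and \<phi>_one_right [simp]: "\<phi> a \<one> = \<epsilon> a"
  and \<phi>_one_left [simp]: "\<phi> \<one> a = \<epsilon> a"
  and \<phi>_antipode: "\<phi> a (S b) = \<phi> (S a) b"
  using pairing by (simp_all add: hopf_pairing_def sw2_sw lin)

text \<open>\<open>D\<close> and \<open>G\<close> are the two actions of B on itself that pair away
  the second leg of the coproduct, through the second and the first slot of the pairing. They absorb
  the scalars of the twisted product, which becomes \<Sum> a2 G(b1)c \<otimes> b2 D(a1)d.\<close>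

definition D :: "'a \<Rightarrow> 'a \<Rightarrow> 'a" where "D p d = sw d (\<lambda>r s. \<phi> p s *\<^sub>Q r)"
definition G :: "'a \<Rightarrow> 'a \<Rightarrow> 'a" where "G r c = sw c (\<lambda>p q. \<phi> q r *\<^sub>Q p)"

lemma D_lin [lin]: "linearQ f \<Longrightarrow> linearQ (\<lambda>x. D (f x) d)" "linearQ f \<Longrightarrow> linearQ (\<lambda>x. D p (f x))"
  unfolding D_def by (intro lin; assumption)+

lemma G_lin [lin]: "linearQ f \<Longrightarrow> linearQ (\<lambda>x. G (f x) c)" "linearQ f \<Longrightarrow> linearQ (\<lambda>x. G r (f x))"
  unfolding G_def by (intro lin; assumption)+

lemma linear_D: "linearQ f \<Longrightarrow> sw d (\<lambda>r s. \<phi> p s *\<^sub>Q f r) = f (D p d)"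
  and linear_G: "linearQ f \<Longrightarrow> sw c (\<lambda>p q. \<phi> q r *\<^sub>Q f p) = f (G r c)"
  unfolding D_def G_def by (simp_all add: sw_linear linearQ_scale)

lemma D_one [simp]: "D \<one> d = d" and G_one [simp]: "G \<one> c = c"
  by (simp_all add: D_def G_def sw_counit_right lin)

lemma \<phi>_D: "\<phi> p (D q d) = \<phi> (p \<cdot> q) d"
  by (simp add: \<phi>_mult_left flip: linear_D[of "\<lambda>x. \<phi> p x"]) (simp add: linear_D[symmetric] lin mult.commute)

lemma \<phi>_G: "\<phi> (G s c) r = \<phi> c (r \<cdot> s)"
  by (subst linear_G[symmetric, of "\<lambda>x. \<phi> x r"]) (simp_all add: \<phi>_mult_right lin mult.commute)

text \<open>The first leg is untouched: \<Delta>(D p d) = \<Sum> d1 \<otimes> D p d2,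
  coassociativity moving the pairing to the last leg.\<close>

lemma sw_D:
  assumes f: "\<And>q. linearQ (\<lambda>p. f p q)" "\<And>p. linearQ (\<lambda>q. f p q)"
  shows "sw (D p d) f = sw d (\<lambda>r s. f r (D p s))"
proof -
  have "sw (D p d) f = sw d (\<lambda>x y. \<phi> p y *\<^sub>Q sw x f)"
    by (rule linear_D[symmetric]) (intro lin f)
  also have "\<dots> = sw d (\<lambda>x y. sw x (\<lambda>r s. \<phi> p y *\<^sub>Q f r s))"
    by (simp only: sw_scale)
  also have "\<dots> = sw d (\<lambda>r y. sw y (\<lambda>s z. \<phi> p z *\<^sub>Q f r s))"
    by (rule sw_coassoc) (intro lin f)+
  also have "\<dots> = sw d (\<lambda>r s. f r (D p s))"
    by (simp add: linear_D f)
  finally show ?thesis .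
qed

lemma sw_G:
  assumes f: "\<And>q. linearQ (\<lambda>p. f p q)" "\<And>p. linearQ (\<lambda>q. f p q)"
  shows "sw (G r c) f = sw c (\<lambda>p q. f p (G r q))"
proof -
  have "sw (G r c) f = sw c (\<lambda>x y. \<phi> y r *\<^sub>Q sw x f)"
    by (rule linear_G[symmetric]) (intro lin f)
  also have "\<dots> = sw c (\<lambda>x y. sw x (\<lambda>p q. \<phi> y r *\<^sub>Q f p q))"
    by (simp only: sw_scale)
  also have "\<dots> = sw c (\<lambda>p y. sw y (\<lambda>q z. \<phi> z r *\<^sub>Q f p q))"
    by (rule sw_coassoc) (intro lin f)+
  also have "\<dots> = sw c (\<lambda>p q. f p (G r q))"
    by (simp add: linear_G f)
  finally show ?thesis .
qed

lemma D_D: "D p (D q d) = D (p \<cdot> q) d"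
  unfolding D_def[of p] D_def[of "p \<cdot> q"] by (simp add: sw_D lin \<phi>_D)

lemma G_G: "G r (G s c) = G (r \<cdot> s) c"
  unfolding G_def[of r] G_def[of "r \<cdot> s"] by (simp add: sw_G lin \<phi>_G)

text \<open>B is a module algebra under \<open>D\<close>: the coproduct is multiplicative, and a
  product in the second slot of the pairing splits \<open>p\<close> by its coproduct.\<close>

lemma D_mult: "D p (b \<cdot> d) = sw p (\<lambda>p1 p2. D p1 b \<cdot> D p2 d)"
proof -
  have "D p (b \<cdot> d) = sw b (\<lambda>b1 b2. sw d (\<lambda>d1 d2. sw p (\<lambda>p1 p2. \<phi> p1 b2 *\<^sub>Q \<phi> p2 d2 *\<^sub>Q (b1 \<cdot> d1))))"
    unfolding D_def by (simp add: sw_mult lin \<phi>_mult_right sw_linear[of "\<lambda>c. c *\<^sub>Q _"])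
  also have "\<dots> = sw p (\<lambda>p1 p2. sw b (\<lambda>b1 b2. sw d (\<lambda>d1 d2. \<phi> p1 b2 *\<^sub>Q \<phi> p2 d2 *\<^sub>Q (b1 \<cdot> d1))))"
    by (simp only: sw_swap[of _ p])
  also have "\<dots> = sw p (\<lambda>p1 p2. D p1 b \<cdot> D p2 d)"
    by (simp add: sw_scale[symmetric] linear_D lin del: qvs.scale_scale)
  finally show ?thesis .
qed

lemma G_mult: "G r (a \<cdot> c) = sw r (\<lambda>r1 r2. G r1 a \<cdot> G r2 c)"
proof -
  have "G r (a \<cdot> c) = sw a (\<lambda>a1 a2. sw c (\<lambda>c1 c2. sw r (\<lambda>r1 r2. \<phi> a2 r1 *\<^sub>Q \<phi> c2 r2 *\<^sub>Q (a1 \<cdot> c1))))"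
    unfolding G_def by (simp add: sw_mult lin \<phi>_mult_left sw_linear[of "\<lambda>c. c *\<^sub>Q _"])
  also have "\<dots> = sw r (\<lambda>r1 r2. sw a (\<lambda>a1 a2. sw c (\<lambda>c1 c2. \<phi> a2 r1 *\<^sub>Q \<phi> c2 r2 *\<^sub>Q (a1 \<cdot> c1))))"
    by (simp only: sw_swap[of _ r])
  also have "\<dots> = sw r (\<lambda>r1 r2. G r1 a \<cdot> G r2 c)"
    by (simp add: sw_scale[symmetric] linear_G lin del: qvs.scale_scale)
  finally show ?thesis .
qed


section \<open>The regular representation\<close>

text \<open>\<open>LE a\<close> and \<open>LF b\<close> are the left multiplications by \<open>a \<otimes> 1\<close> and \<open>1 \<otimes> b\<close> in the twisted product.\<close>

definition LE :: "'a \<Rightarrow> ('a, 'a) tensor \<Rightarrow> ('a, 'a) tensor" where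
  "LE a t = tsum t (\<lambda>c d. sw a (\<lambda>p q. q \<cdot> c \<otimes> D p d))"
definition LF :: "'a \<Rightarrow> ('a, 'a) tensor \<Rightarrow> ('a, 'a) tensor" where
  "LF b t = tsum t (\<lambda>c d. sw b (\<lambda>r s. G r c \<otimes> s \<cdot> d))"

lemma LE_lin [lin]: "linearQ f \<Longrightarrow> linearQ (\<lambda>x. LE (f x) t)" "linearQ g \<Longrightarrow> linearQ (\<lambda>x. LE a (g x))"
  unfolding LE_def by (intro lin; assumption)+

lemma LF_lin [lin]: "linearQ f \<Longrightarrow> linearQ (\<lambda>x. LF (f x) t)" "linearQ g \<Longrightarrow> linearQ (\<lambda>x. LF a (g x))"
  unfolding LF_def by (intro lin; assumption)+

lemma LE_tens: "LE a (c \<otimes> d) = sw a (\<lambda>p q. q \<cdot> c \<otimes> D p d)"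
  and LF_tens: "LF b (c \<otimes> d) = sw b (\<lambda>r s. G r c \<otimes> s \<cdot> d)"
  unfolding LE_def LF_def by (rule tsum_tens; intro lin)+

lemma LE_one: "LE \<one> t = t" and LF_one: "LF \<one> t = t"
  by (rule tensor_eqI[where t = t]; simp add: LE_tens LF_tens lin sw_one)+

lemma LE_mult: "LE (a \<cdot> a') t = LE a (LE a' t)"
proof (rule tensor_eqI[where t = t])
  fix c d
  have "LE a (LE a' (c \<otimes> d)) = sw a' (\<lambda>p' q'. sw a (\<lambda>p q. q \<cdot> (q' \<cdot> c) \<otimes> D p (D p' d)))"
    by (simp add: LE_tens sw_linear[of "LE a"] lin)
  also have "\<dots> = sw a (\<lambda>p q. sw a' (\<lambda>p' q'. q \<cdot> (q' \<cdot> c) \<otimes> D p (D p' d)))"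
    by (rule sw_swap)
  also have "\<dots> = LE (a \<cdot> a') (c \<otimes> d)"
    by (simp add: LE_tens sw_mult lin D_D assoc)
  finally show "LE (a \<cdot> a') (c \<otimes> d) = LE a (LE a' (c \<otimes> d))" by simp
qed (intro lin)+

lemma LF_mult: "LF (b \<cdot> b') t = LF b (LF b' t)"
proof (rule tensor_eqI[where t = t])
  fix c d
  have "LF b (LF b' (c \<otimes> d)) = sw b' (\<lambda>p' q'. sw b (\<lambda>p q. G p (G p' c) \<otimes> q \<cdot> (q' \<cdot> d)))"
    by (simp add: LF_tens sw_linear[of "LF b"] lin)
  also have "\<dots> = sw b (\<lambda>p q. sw b' (\<lambda>p' q'. G p (G p' c) \<otimes> q \<cdot> (q' \<cdot> d)))"
    by (rule sw_swap)
  also have "\<dots> = LF (b \<cdot> b') (c \<otimes> d)"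
    by (simp add: LF_tens sw_mult lin G_G assoc)
  finally show "LF (b \<cdot> b') (c \<otimes> d) = LF b (LF b' (c \<otimes> d))" by simp
qed (intro lin)+

text \<open>Both sides send c \<otimes> d to \<Sum> G(b1)(a2 c) \<otimes> D(a1)(b2 d): on the left
  \<open>D_mult\<close> merges the actions on the second factor, on the right \<open>G_mult\<close>
  those on the first.\<close>

lemma cross: "sw a (\<lambda>p q. LF (D p b) (LE q t)) = sw b (\<lambda>r s. LE (G r a) (LF s t))"
proof (rule tensor_eqI[where t = t])
  fix c d
  have "sw a (\<lambda>p q. LF (D p b) (LE q (c \<otimes> d)))
      = sw a (\<lambda>u v. sw v (\<lambda>p q. sw b (\<lambda>r s. G r (q \<cdot> c) \<otimes> D u s \<cdot> D p d)))"
    by (simp add: LE_tens sw_linear[of "LF _"] LF_tens sw_D lin)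
  also have "\<dots> = sw a (\<lambda>u v. sw u (\<lambda>p q. sw b (\<lambda>r s. G r (v \<cdot> c) \<otimes> D p s \<cdot> D q d)))"
    by (rule sw_coassoc[symmetric]) (intro lin)+
  also have "\<dots> = sw a (\<lambda>u v. sw b (\<lambda>r s. G r (v \<cdot> c) \<otimes> D u (s \<cdot> d)))"
    by (subst sw_swap) (simp add: D_mult sw_linear[of "\<lambda>x. _ \<otimes> x"] lin)
  also have "\<dots> = sw b (\<lambda>r s. sw a (\<lambda>u v. G r (v \<cdot> c) \<otimes> D u (s \<cdot> d)))"
    by (rule sw_swap)
  also have "\<dots> = sw b (\<lambda>u v. sw a (\<lambda>p q. sw u (\<lambda>r s. G r q \<cdot> G s c \<otimes> D p (v \<cdot> d))))"
    by (simp add: G_mult sw_linear[of "\<lambda>x. x \<otimes> _"] lin)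
  also have "\<dots> = sw b (\<lambda>u v. sw u (\<lambda>r s. sw a (\<lambda>p q. G r q \<cdot> G s c \<otimes> D p (v \<cdot> d))))"
    by (subst sw_swap) (rule refl)
  also have "\<dots> = sw b (\<lambda>u v. sw v (\<lambda>r s. sw a (\<lambda>p q. G u q \<cdot> G r c \<otimes> D p (s \<cdot> d))))"
    by (rule sw_coassoc) (intro lin)+
  also have "\<dots> = sw b (\<lambda>r s. LE (G r a) (LF s (c \<otimes> d)))"
    by (simp add: LF_tens sw_linear[of "LE _"] LE_tens sw_G lin)
  finally show "sw a (\<lambda>p q. LF (D p b) (LE q (c \<otimes> d))) = sw b (\<lambda>r s. LE (G r a) (LF s (c \<otimes> d)))" .
qed (intro lin)+


section \<open>The twisted product\<close>

text \<open>\<open>T a b\<close> is the twisted product of \<open>a \<otimes> 1\<close> and \<open>1 \<otimes> b\<close>.\<close>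

definition T :: "'a \<Rightarrow> 'a \<Rightarrow> ('a, 'a) tensor" where
  "T a b = sw a (\<lambda>p q. q \<otimes> D p b)"

lemma T_lin [lin]: "linearQ f \<Longrightarrow> linearQ (\<lambda>x. T (f x) b)" "linearQ f \<Longrightarrow> linearQ (\<lambda>x. T a (f x))"
  unfolding T_def by (intro lin; assumption)+

lemma LE_LF_one: "LE a (LF b (\<one> \<otimes> \<one>)) = T a b"
proof -
  have "LF b (\<one> \<otimes> \<one>) = \<one> \<otimes> b"
    by (simp add: LF_tens G_def sw_one lin tens_scale_left sw_counit_left scaleQ_one)
  then show ?thesis by (simp add: LE_tens T_def)
qed

abbreviation I where "I \<equiv> iota_hopf H \<phi>"

lemma iota_one: "aone I = \<one> \<otimes> \<one>"
  by (simp add: iota_hopf_def)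

lemma iota_mult_sw:
  "amult I s t = tsum s (\<lambda>a b. tsum t (\<lambda>c d. sw a (\<lambda>p q. sw b (\<lambda>r s. q \<cdot> G r c \<otimes> s \<cdot> D p d))))"
proof -
  have "sw d (\<lambda>d1 d2. (\<phi> p d2 * \<phi> c2 r) *\<^sub>Q (q \<cdot> c1 \<otimes> s \<cdot> d1)) = \<phi> c2 r *\<^sub>Q (q \<cdot> c1 \<otimes> s \<cdot> D p d)"
    for p q r s c1 c2 d
    by (subst linear_D[symmetric, of "\<lambda>x. q \<cdot> c1 \<otimes> s \<cdot> x"]) (simp_all add: sw_scale lin mult.commute)
  then have "sw2 H a (\<lambda>a1 a2. sw2 H b (\<lambda>b1 b2. sw2 H c (\<lambda>c1 c2. sw2 H d (\<lambda>d1 d2.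
            (\<phi> a1 d2 * \<phi> c2 b1) *\<^sub>Q (a2 \<cdot> c1 \<otimes> b2 \<cdot> d1)))))
      = sw a (\<lambda>p q. sw b (\<lambda>r s. q \<cdot> G r c \<otimes> s \<cdot> D p d))" for a b c d
    by (simp add: sw2_sw lin linear_G[of "\<lambda>x. _ \<cdot> x \<otimes> _"])
  then show ?thesis
    by (simp add: iota_hopf_def tsum_tlift[symmetric] bilinearQ_I lin)
qed

lemma iota_lin [lin]: "linearQ f \<Longrightarrow> linearQ (\<lambda>x. amult I (f x) t)" "linearQ f \<Longrightarrow> linearQ (\<lambda>x. amult I t (f x))"
  unfolding iota_mult_sw by (intro lin alg; assumption)+

lemma iota_mult_tens: "amult I (a \<otimes> b) (c \<otimes> d) = sw a (\<lambda>p q. sw b (\<lambda>r s. q \<cdot> G r c \<otimes> s \<cdot> D p d))"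
  unfolding iota_mult_sw by (simp add: tsum_tens lin)

text \<open>The bridge from the two actions to the twisted product, obtained by direct expansion
  with \<open>sw_D\<close> and \<open>D_mult\<close>, hence available before the product is known to
  be associative.\<close>

lemma iota_mult_T: "amult I (T a b) t = LE a (LF b t)"
proof (rule tensor_eqI[where t = t])
  fix c d
  have "amult I (T a b) (c \<otimes> d) = sw a (\<lambda>u v. amult I (v \<otimes> D u b) (c \<otimes> d))"
    unfolding T_def by (intro sw_linear lin)
  also have "\<dots> = sw a (\<lambda>u v. sw v (\<lambda>p q. sw b (\<lambda>r s. q \<cdot> G r c \<otimes> D u s \<cdot> D p d)))"
    by (simp add: iota_mult_tens sw_D lin)
  also have "\<dots> = sw a (\<lambda>u v. sw u (\<lambda>p q. sw b (\<lambda>r s. v \<cdot> G r c \<otimes> D p s \<cdot> D q d)))"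
    by (rule sw_coassoc[symmetric]) (intro lin)+
  also have "\<dots> = sw a (\<lambda>u v. sw b (\<lambda>r s. v \<cdot> G r c \<otimes> D u (s \<cdot> d)))"
    by (subst sw_swap) (simp add: D_mult sw_linear[of "\<lambda>x. _ \<otimes> x"] lin)
  also have "\<dots> = LE a (LF b (c \<otimes> d))"
    by (subst sw_swap) (simp add: LF_tens LE_tens sw_linear[of "LE _"] lin)
  finally show "amult I (T a b) (c \<otimes> d) = LE a (LF b (c \<otimes> d))" .
qed (intro lin)+

end

section \<open>The antipode and the coproduct\<close>

context hopf_alg
begin

lemmas algT = algebra_tensor_alg[OF alg alg]
lemmas multT_lin [lin] = linearQ_amult_left[OF algT] linearQ_amult_right[OF algT]

text \<open>As for \<open>antipode_mult\<close>, both sides are convolution inverses, here of the comultiplication.\<close>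

lemma comult_antipode: "\<Delta> (S a) = sw a (\<lambda>p q. S q \<otimes> S p)"
proof -
  let ?m = "amult (tensor_alg H H)"
  define N where "N b = sw b (\<lambda>p q. S q \<otimes> S p)" for b
  have N_lin: "linearQ f \<Longrightarrow> linearQ (\<lambda>x. N (f x))" for f :: "'b::qvs \<Rightarrow> 'a"
    unfolding N_def by (intro lin)
  have N: "sw s (\<lambda>q r. ?m (\<Delta> q) (N r)) = \<epsilon> s *\<^sub>Q (\<one> \<otimes> \<one>)" for s
  proof -
    have mN: "?m (\<Delta> q) (N r) = sw q (\<lambda>q1 q2. sw r (\<lambda>r1 r2. q1 \<cdot> S r2 \<otimes> q2 \<cdot> S r1))" for q r
    proof -
      have "?m (\<Delta> q) (N r) = sw r (\<lambda>r1 r2. sw q (\<lambda>q1 q2. ?m (q1 \<otimes> q2) (S r2 \<otimes> S r1)))"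
        unfolding N_def sw_tensor[of q, symmetric]
        by (simp add: sw_linear[of "?m _"] sw_linear[of "\<lambda>x. ?m x _"] lin)
      then show ?thesis by (simp add: tensor_alg_tens alg sw_swap[of q])
    qed
    have "sw s (\<lambda>q r. ?m (\<Delta> q) (N r))
        = sw s (\<lambda>q1 t. sw t (\<lambda>q2 r. sw r (\<lambda>r1 r2. q1 \<cdot> S r2 \<otimes> q2 \<cdot> S r1)))"
      unfolding mN by (rule sw_coassoc) (intro lin)+
    also have "\<dots> = sw s (\<lambda>q1 t. sw t (\<lambda>u r2. sw u (\<lambda>q2 r1. q1 \<cdot> S r2 \<otimes> q2 \<cdot> S r1)))"
      by (subst sw_coassoc) (intro lin refl)+
    also have "\<dots> = sw s (\<lambda>q1 t. q1 \<cdot> S t \<otimes> \<one>)"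
      by (simp add: sw_antipode_right[of "\<lambda>x. _ \<cdot> S _ \<otimes> x"] sw_counit_left lin)
    also have "\<dots> = \<epsilon> s *\<^sub>Q (\<one> \<otimes> \<one>)"
      by (rule sw_antipode_right) (intro lin)
    finally show ?thesis .
  qed
  \<comment> \<open>Inserting \<epsilon>(u) 1 = \<Sum> S(u1) u2 in front turns \<open>N\<close> into
    the convolution of \<Delta> S, \<Delta> and \<open>N\<close>, whose last two factors cancel by
    fact \<open>N\<close>.\<close>
  have "N a = sw a (\<lambda>u r. \<epsilon> u *\<^sub>Q ?m (\<one> \<otimes> \<one>) (N r))"
    by (simp add: sw_counit_left N_lin lin algebra_one_left[OF algT, unfolded tensor_alg_one])
  also have "\<dots> = sw a (\<lambda>u r. sw u (\<lambda>p q. ?m (\<Delta> (S p \<cdot> q)) (N r)))"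
    by (subst sw_antipode_left[of "\<lambda>x. ?m (\<Delta> x) (N _)"]) (simp_all add: comult_one lin)
  also have "\<dots> = sw a (\<lambda>p s. sw s (\<lambda>q r. ?m (\<Delta> (S p \<cdot> q)) (N r)))"
    by (rule sw_coassoc) (intro lin N_lin)+
  also have "\<dots> = sw a (\<lambda>p s. ?m (\<Delta> (S p)) (sw s (\<lambda>q r. ?m (\<Delta> q) (N r))))"
    by (simp add: comult_mult algebra_assoc[OF algT] sw_linear[of "?m _"] lin)
  also have "\<dots> = \<Delta> (S a)"
    by (simp add: N amult_scale_right[OF algT] algebra_one_right[OF algT, unfolded tensor_alg_one]
        sw_counit_right lin)
  finally show ?thesis by (simp add: N_def)
qed

lemma sw_antipode:
  assumes f: "\<And>q. linearQ (\<lambda>p. f p q)" "\<And>p. linearQ (\<lambda>q. f p q)"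
  shows "sw (S a) f = sw a (\<lambda>p q. f (S q) (S p))"
proof -
  have "sw (S a) f = sw a (\<lambda>p q. tsum (S q \<otimes> S p) f)"
    unfolding sw_def[of "S a"] comult_antipode by (rule sw_linear) (intro lin f)
  then show ?thesis by (simp add: tsum_tens f)
qed

lemma sw3_sw:
  assumes f: "\<And>b c. linearQ (\<lambda>a. f a b c)" "\<And>a c. linearQ (\<lambda>b. f a b c)" "\<And>a b. linearQ (\<lambda>c. f a b c)"
  shows "sw3 H a f = sw a (\<lambda>p q. sw q (\<lambda>r s. f p r s))"
proof -
  have "sw3 H a f = tsum (tmap id \<Delta> (\<Delta> a)) (\<lambda>p t. tsum t (\<lambda>q r. f p q r))"
    by (simp add: sw3_def tsum_tlift[symmetric] bilinearQ_I f lin)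
  also have "\<dots> = sw a (\<lambda>p q. sw q (\<lambda>r s. f p r s))"
    unfolding sw_def
    by (subst tmap_tsum, intro lin, intro lin,
        subst tsum_linear[of "\<lambda>t. tsum t (\<lambda>p s. tsum s (\<lambda>q r. f p q r))"]) (simp_all add: f lin tsum_tens)
  finally show ?thesis .
qed

end

text \<open>Bijectivity is isolated as an assumption because it is established only after \<Phi> has
  been constructed; until then no statement may use the inverse antipode.\<close>

locale hopf_pair_bij = hopf_pair +
  assumes bij_antipode: "bij S"
begin

definition R :: "'a \<Rightarrow> 'a" where "R = inv S"

lemma S_R [simp]: "S (R a) = a" and R_S [simp]: "R (S a) = a"
  unfolding R_def using bij_antipode by (simp_all add: bij_is_surj surj_f_inv_f bij_is_inj)

lemma R_eqI: "S a = b \<Longrightarrow> R b = a"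
  by auto

lemma R_lin [lin]: "linearQ f \<Longrightarrow> linearQ (\<lambda>x. R (f x))"
  unfolding R_def by (rule linearQ_compose[OF linearQ_inv[OF linear_antipode bij_antipode]])

lemma R_mult: "R (a \<cdot> b) = R b \<cdot> R a"
  by (rule R_eqI) (simp add: antipode_mult)

lemma R_one: "R \<one> = \<one>"
  by (rule R_eqI) (rule antipode_one)

lemma \<phi>_R: "\<phi> (R a) b = \<phi> a (R b)"
  using \<phi>_antipode[of "R a" "R b"] by simp

lemma sw_R:
  assumes f: "\<And>q. linearQ (\<lambda>p. f p q)" "\<And>p. linearQ (\<lambda>q. f p q)"
  shows "sw (R a) f = sw a (\<lambda>p q. f (R q) (R p))"
proof -
  have "sw (S (R a)) (\<lambda>p q. f (R q) (R p)) = sw (R a) (\<lambda>p q. f (R (S p)) (R (S q)))"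
    by (rule sw_antipode) (intro lin linearQ_compose[OF f(1)] linearQ_compose[OF f(2)])+
  then show ?thesis by simp
qed

text \<open>The inverse antipode is an antipode for the opposite coproduct: apply \<open>R\<close>,
  which reverses products, to the antipode axiom.\<close>

lemma sw_R_left: "linearQ t \<Longrightarrow> sw a (\<lambda>p q. t (R q \<cdot> p)) = \<epsilon> a *\<^sub>Q t \<one>"
  using sw_antipode_left[of "\<lambda>x. t (R x)" a] by (simp add: R_mult R_one linearQ_compose R_lin lin)

lemma sw_R_right: "linearQ t \<Longrightarrow> sw a (\<lambda>p q. t (q \<cdot> R p)) = \<epsilon> a *\<^sub>Q t \<one>"
  using sw_antipode_right[of "\<lambda>x. t (R x)" a] by (simp add: R_mult R_one linearQ_compose R_lin lin)

text \<open>Solves \<open>T\<close> for pure tensors: since \<open>D\<close> is an action, the sum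
  is \<Sum> a3 \<otimes> D(a2 R(a1)) b, and a2 R(a1) collapses to the counit.\<close>

lemma tens_conv_T: "sw a (\<lambda>p q. T q (D (R p) b)) = a \<otimes> b"
proof -
  have "sw a (\<lambda>p q. T q (D (R p) b)) = sw a (\<lambda>p q. sw q (\<lambda>r s. s \<otimes> D (r \<cdot> R p) b))"
    by (simp add: T_def D_D)
  also have "\<dots> = sw a (\<lambda>q s. sw q (\<lambda>p r. s \<otimes> D (r \<cdot> R p) b))"
    by (rule sw_coassoc[symmetric]) (intro lin)+
  also have "\<dots> = a \<otimes> b"
    by (simp add: sw_R_right[of "\<lambda>x. _ \<otimes> D x b"] sw_counit_left lin)
  finally show ?thesis .
qed

text \<open>The inversion in the other order, tested against a bilinear \<open>f\<close>; it now
  rests on \<Sum> R(a2) a1 = \<epsilon>(a) 1. The case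
  \<open>f a b = \<psi>E a \<star> \<psi>F b\<close> yields \<open>\<Psi>_\<Phi>\<close>.\<close>

lemma T_conv_tens:
  assumes f: "\<And>q. linearQ (\<lambda>p. f p q)" "\<And>p. linearQ (\<lambda>q. f p q)"
  shows "tsum (T a b) (\<lambda>c d. sw c (\<lambda>p q. f q (D (R p) d))) = f a b"
proof -
  note f_lin = linearQ_compose[OF f(1)] linearQ_compose[OF f(2)]
  have "tsum (T a b) (\<lambda>c d. sw c (\<lambda>p q. f q (D (R p) d)))
      = sw a (\<lambda>u v. tsum (v \<otimes> D u b) (\<lambda>c d. sw c (\<lambda>p q. f q (D (R p) d))))"
    unfolding T_def by (rule sw_linear) (intro lin f_lin)
  also have "\<dots> = sw a (\<lambda>u v. sw v (\<lambda>p q. f q (D (R p \<cdot> u) b)))"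
    by (subst tsum_tens) (simp_all add: lin f_lin D_D)
  also have "\<dots> = sw a (\<lambda>v q. sw v (\<lambda>u p. f q (D (R p \<cdot> u) b)))"
    by (rule sw_coassoc[symmetric]) (intro lin f_lin)+
  also have "\<dots> = sw a (\<lambda>v q. \<epsilon> v *\<^sub>Q f q b)"
    by (subst sw_R_left[of "\<lambda>x. f _ (D x b)"]) (simp_all add: lin f_lin)
  also have "\<dots> = f a b"
    by (rule sw_counit_left) (rule f)
  finally show ?thesis .
qed

lemma iota_comult_lin [lin]: "linearQ f \<Longrightarrow> linearQ (\<lambda>x. comult I (f x))"
  and iota_counit_lin [lin]: "linearQ f \<Longrightarrow> linearQ (\<lambda>x. counit I (f x))"
  and iota_antipode_lin [lin]: "linearQ f \<Longrightarrow> linearQ (\<lambda>x. antipode I (f x))"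
  by (simp_all add: iota_hopf_def linearQ_tlift_arg)

text \<open>The pairing of the middle legs a2, b2 together with the outer legs a3, b1 is exactly an
  instance of \<open>T\<close>.\<close>

lemma iota_comult_tens: "comult I (a \<otimes> b) = sw a (\<lambda>p q. sw b (\<lambda>r s. (p \<otimes> s) \<otimes> T q r))"
proof -
  have "comult I (a \<otimes> b) = sw a (\<lambda>a1 w. sw w (\<lambda>a2 a3. sw b (\<lambda>b1 y. sw y (\<lambda>b2 b3.
          \<phi> a2 b2 *\<^sub>Q ((a1 \<otimes> b3) \<otimes> (a3 \<otimes> b1))))))"
    by (simp add: iota_hopf_def sw3_sw lin tlift_tens bilinearQ_I)
  also have "\<dots> = sw a (\<lambda>a1 w. sw w (\<lambda>a2 a3. sw b (\<lambda>y b3. sw y (\<lambda>b1 b2.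
          \<phi> a2 b2 *\<^sub>Q ((a1 \<otimes> b3) \<otimes> (a3 \<otimes> b1))))))"
    by (subst sw_coassoc) (intro lin refl)+
  also have "\<dots> = sw a (\<lambda>a1 w. sw b (\<lambda>y b3. sw w (\<lambda>a2 a3. (a1 \<otimes> b3) \<otimes> (a3 \<otimes> D a2 y))))"
    by (subst sw_swap) (simp add: linear_D[of "\<lambda>x. _ \<otimes> (_ \<otimes> x)"] lin)
  also have "\<dots> = sw a (\<lambda>p q. sw b (\<lambda>r s. (p \<otimes> s) \<otimes> T q r))"
    by (simp add: T_def sw_linear[of "\<lambda>x. _ \<otimes> x"] lin)
  finally show ?thesis .
qed

text \<open>The legs of \<open>b\<close> come out reversed, as they must: the coproduct of U is the
  opposite one on the F half, see \<open>comult_\<psi>F\<close>.\<close>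

lemma iota_comult_T: "comult I (T a b) = sw a (\<lambda>p q. sw b (\<lambda>r s. T p s \<otimes> T q r))"
proof -
  have T: "sw w (\<lambda>u p. (p \<otimes> D u s) \<otimes> t) = T w s \<otimes> t" for w s and t :: "('a, 'a) tensor"
    unfolding T_def by (rule sw_linear[symmetric]) (intro lin)
  have "comult I (T a b) = sw a (\<lambda>u v. sw v (\<lambda>p q. sw b (\<lambda>r s. (p \<otimes> D u s) \<otimes> T q r)))"
    unfolding T_def[of a b] by (simp add: sw_linear[of "comult I"] iota_comult_tens sw_D lin)
  also have "\<dots> = sw a (\<lambda>w q. sw w (\<lambda>u p. sw b (\<lambda>r s. (p \<otimes> D u s) \<otimes> T q r)))"
    by (rule sw_coassoc[symmetric]) (intro lin)+
  also have "\<dots> = sw a (\<lambda>w q. sw b (\<lambda>r s. sw w (\<lambda>u p. (p \<otimes> D u s) \<otimes> T q r)))"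
    by (subst sw_swap) (rule refl)
  also have "\<dots> = sw a (\<lambda>p q. sw b (\<lambda>r s. T p s \<otimes> T q r))"
    by (simp add: T)
  finally show ?thesis .
qed

text \<open>The inverse antipode moves across the pairing and \<open>D\<close> turns into a product,
  giving \<Sum> \<phi>(R(a2) a1, b), where \<open>sw_R_left\<close> applies.\<close>

lemma iota_counit_T: "counit I (T a b) = \<epsilon> a * \<epsilon> b"
proof -
  have tens: "counit I (a \<otimes> b) = \<phi> a (R b)" for a b
    by (simp add: iota_hopf_def R_def[symmetric] tlift_tens bilinearQ_I lin)
  have "counit I (T a b) = sw a (\<lambda>p q. \<phi> q (R (D p b)))"
    unfolding T_def by (simp add: sw_linear[of "counit I"] tens lin)
  also have "\<dots> = sw a (\<lambda>p q. \<phi> (R q \<cdot> p) b)"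
    by (simp add: \<phi>_R[symmetric] \<phi>_D)
  also have "\<dots> = \<epsilon> a * \<epsilon> b"
    by (subst sw_R_left) (simp_all add: lin)
  finally show ?thesis .
qed

lemma iota_antipode_T: "antipode I (T a b) = LF (R b) (LE (S a) (\<one> \<otimes> \<one>))"
proof -
  have tens: "antipode I (a \<otimes> b) = S a \<otimes> R b" for a b
    by (simp add: iota_hopf_def R_def[symmetric] tlift_tens bilinearQ_I lin)
  have "LE (S a) (\<one> \<otimes> \<one>) = S a \<otimes> \<one>"
    by (simp add: LE_tens D_def sw_one lin tens_scale_right sw_counit_left scaleQ_one)
  then have "LF (R b) (LE (S a) (\<one> \<otimes> \<one>)) = sw b (\<lambda>r s. G (R s) (S a) \<otimes> R r)"
    by (simp add: LF_tens sw_R lin)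
  also have "\<dots> = sw b (\<lambda>r s. sw a (\<lambda>p q. \<phi> p s *\<^sub>Q (S q \<otimes> R r)))"
    by (simp add: G_def sw_antipode lin \<phi>_antipode[symmetric] sw_linear[of "\<lambda>x. x \<otimes> _"] tens_scale_left)
  also have "\<dots> = sw a (\<lambda>p q. sw b (\<lambda>r s. \<phi> p s *\<^sub>Q (S q \<otimes> R r)))"
    by (rule sw_swap)
  also have "\<dots> = antipode I (T a b)"
    unfolding T_def by (simp add: sw_linear[of "antipode I"] tens lin linear_D[of "\<lambda>x. _ \<otimes> R x"])
  finally show ?thesis by simp
qed

end

section \<open>Transport of Hopf algebra structures\<close>

lemma tsum_tmap:
  assumes f: "linearQ f" "linearQ g" and F: "\<And>q. linearQ (\<lambda>p. F p q)" "\<And>p. linearQ (\<lambda>q. F p q)"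
  shows "tsum (tmap f g t) F = tsum t (\<lambda>a b. F (f a) (g b))"
proof -
  have "tsum (tmap f g t) F = tsum t (\<lambda>a b. tsum (f a \<otimes> g b) F)"
    unfolding tmap_tsum[OF f] by (rule tsum_linear) (intro lin F)
  then show ?thesis by (simp add: tsum_tens F)
qed

text \<open>Nothing is presupposed about V beyond the compatibilities: since \<open>f\<close> is
  bijective, each operation of V is the conjugate of that of U, so linearity and all axioms carry
  over.\<close>

lemma hopf_iso_transport:
  fixes U :: "'u::qvs hopf" and V :: "'v::qvs hopf"
  assumes U: "hopf_algebra U" and bij: "bij f" and lin_f: "linearQ f"
    and one: "f (aone U) = aone V"
    and mult: "\<And>a b. f (amult U a b) = amult V (f a) (f b)"
    and comult: "\<And>a. comult V (f a) = tmap f f (comult U a)"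
    and counit: "\<And>a. counit V (f a) = counit U a"
    and antipode: "\<And>a. antipode V (f a) = f (antipode U a)"
  shows "hopf_iso U V f"
proof -
  interpret U: hopf_alg U by unfold_locales (rule U)
  define g where "g = inv f"
  have fg: "f (g v) = v" for v
    unfolding g_def by (rule surj_f_inv_f[OF bij_is_surj[OF bij]])
  have lin_g: "linearQ g"
    unfolding g_def by (rule linearQ_inv[OF lin_f bij])
  note f_lin [lin] = linearQ_compose[OF lin_f]
  note g_lin [lin] = linearQ_compose[OF lin_g]
  have all: "(\<And>a. P (f a)) \<Longrightarrow> P v" for P v
    using fg[of v] by metis
  have mult_conv: "amult V s t = f (amult U (g s) (g t))" for s t
    by (simp add: mult fg)
  have algV: "algebra V"
    unfolding algebra_def
  proof (intro conjI allI)
    show "bilinearQ (amult V)"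
      by (rule bilinearQ_I; subst mult_conv; intro lin)
    have "amult V (amult V (f a) (f b)) (f c) = amult V (f a) (amult V (f b) (f c))" for a b c
      by (simp add: U.assoc flip: mult)
    from this[of "g _" "g _" "g _"]
    show "amult V (amult V a b) c = amult V a (amult V b c)" for a b c
      by (simp add: fg)
    show "amult V (aone V) a = a" "amult V a (aone V) = a" for a
      by (rule all[of "\<lambda>a. _ a = a"]; simp flip: one mult)+
  qed
  note V_lin [lin] = linearQ_amult_left[OF algV] linearQ_amult_right[OF algV]
  have comult_conv: "comult V = (\<lambda>v. tmap f f (comult U (g v)))"
    by (simp add: fun_eq_iff fg flip: comult)
  have antipode_conv: "antipode V = (\<lambda>v. f (antipode U (g v)))"
    by (simp add: fun_eq_iff fg flip: antipode)
  have counit_conv: "counit V = (\<lambda>v. counit U (g v))"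
    by (simp add: fun_eq_iff fg flip: counit)
  have comult_lin [lin]: "linearQ h \<Longrightarrow> linearQ (\<lambda>x. comult V (h x))" for h :: "'c::qvs \<Rightarrow> 'v"
    unfolding comult_conv by (intro lin)
  have counit_lin [lin]: "linearQ h \<Longrightarrow> linearQ (\<lambda>x. counit V (h x))" for h :: "'c::qvs \<Rightarrow> 'v"
    unfolding counit_conv by (intro lin)
  have antipode_lin [lin]: "linearQ h \<Longrightarrow> linearQ (\<lambda>x. antipode V (h x))" for h :: "'c::qvs \<Rightarrow> 'v"
    unfolding antipode_conv by (intro lin)
  have tmap_mult: "tmap f f (amult (tensor_alg U U) s t) = amult (tensor_alg V V) (tmap f f s) (tmap f f t)" for s t
  proof -
    have "amult (tensor_alg V V) (tmap f f s) (tmap f f t)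
        = tsum s (\<lambda>a b. tsum t (\<lambda>a' b'. amult V (f a) (f a') \<otimes> amult V (f b) (f b')))"
      by (simp add: tensor_alg_tsum[OF algV algV] tsum_tmap lin lin_f)
    then show ?thesis
      by (simp add: tensor_alg_tsum[OF U.alg U.alg] tsum_linear[of "tmap f f"] tmap_tens lin lin_f mult)
  qed
  have tassoc_tmap: "tassoc (tmap (tmap f f) f w) = tmap f (tmap f f) (tassoc w)" for w
  proof (rule tensor_eqI[where t = w])
    fix s c
    show "tassoc (tmap (tmap f f) f (s \<otimes> c)) = tmap f (tmap f f) (tassoc (s \<otimes> c))"
      by (rule tensor_eqI[where t = s])
         (simp_all add: lin lin_f tmap_tens tassoc_tens linearQ_compose[OF linearQ_tassoc])
  qed (simp_all add: lin linearQ_tassoc linearQ_compose[OF linearQ_tassoc])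
  have "alg_hom V (tensor_alg V V) (comult V)"
    unfolding alg_hom_def
  proof (intro conjI allI)
    show "linearQ (comult V)" by (intro lin)
    show "comult V (aone V) = aone (tensor_alg V V)"
      by (simp add: tensor_alg_one comult U.comult_one tmap_tens lin_f flip: one)
    have "comult V (amult V (f a) (f b)) = amult (tensor_alg V V) (comult V (f a)) (comult V (f b))" for a b
      by (simp add: comult U.comult_mult tmap_mult flip: mult)
    from this[of "g _" "g _"]
    show "comult V (amult V a b) = amult (tensor_alg V V) (comult V a) (comult V b)" for a b
      by (simp add: fg)
  qed
  moreover have "alg_hom V base_alg (counit V)"
    unfolding alg_hom_def
  proof (intro conjI allI)
    show "linearQ (counit V)" by (intro lin)
    show "counit V (aone V) = aone base_alg"
      by (simp add: base_alg_def counit U.counit_one flip: one)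
    have "counit V (amult V (f a) (f b)) = counit V (f a) * counit V (f b)" for a b
      by (simp add: counit U.counit_mult flip: mult)
    from this[of "g _" "g _"]
    show "counit V (amult V a b) = amult base_alg (counit V a) (counit V b)" for a b
      by (simp add: fg base_alg_def)
  qed
  moreover have "tassoc (tmap (comult V) id (comult V v)) = tmap id (comult V) (comult V v)" for v
  proof (rule all[of _ v])
    fix u
    have "tassoc (tmap (comult V) id (comult V (f u))) = tassoc (tmap (tmap f f) f (tmap (comult U) id (comult U u)))"
      by (simp add: comult tmap_tmap lin lin_f)
    also have "\<dots> = tmap f (tmap f f) (tmap id (comult U) (comult U u))"
      using U unfolding tassoc_tmap by (simp add: hopf_algebra_def)
    also have "\<dots> = tmap id (comult V) (comult V (f u))"
      by (simp add: comult tmap_tmap lin lin_f)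
    finally show "tassoc (tmap (comult V) id (comult V (f u))) = tmap id (comult V) (comult V (f u))" .
  qed
  moreover have "tlift F (comult V (f u)) = U.sw u (\<lambda>p q. F (f p) (f q))" if "bilinearQ F" for F :: "'v \<Rightarrow> 'v \<Rightarrow> 'v" and u
    using that by (simp add: comult U.sw_def tsum_tmap lin_f bilinearQ_def flip: tsum_tlift)
  note tlift_comult = this
  have "tlift (\<lambda>b c. counit V b *\<^sub>Q c) (comult V v) = v" for v
    by (rule all[of _ v]) (subst tlift_comult, simp_all add: bilinearQ_I lin counit U.sw_counit_left lin_f)
  moreover have "tlift (\<lambda>b c. counit V c *\<^sub>Q b) (comult V v) = v" for v
    by (rule all[of _ v]) (subst tlift_comult, simp_all add: bilinearQ_I lin counit U.sw_counit_right lin_f)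
  moreover have "linearQ (antipode V)"
    by (intro lin)
  moreover have "tlift (\<lambda>b c. amult V (antipode V b) c) (comult V v) = counit V v *\<^sub>Q aone V" for v
    by (rule all[of _ v])
       (subst tlift_comult, simp_all add: bilinearQ_I lin antipode U.sw_antipode_left lin_f counit flip: mult one)
  moreover have "tlift (\<lambda>b c. amult V b (antipode V c)) (comult V v) = counit V v *\<^sub>Q aone V" for v
    by (rule all[of _ v])
       (subst tlift_comult, simp_all add: bilinearQ_I lin antipode U.sw_antipode_right lin_f counit flip: mult one)
  ultimately have "hopf_algebra V"
    using algV unfolding hopf_algebra_def by blast
  then show ?thesis
    unfolding hopf_iso_def alg_hom_def using assms by auto
qed


section \<open>The defining relations\<close>

lemma ball_Collect1: "(\<forall>r\<in>{f i | i. True}. Q r) \<longleftrightarrow> (\<forall>i. Q (f i))"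
  by blast

lemma ball_Collect2: "(\<forall>r\<in>{f i j | i j. P i j}. Q r) \<longleftrightarrow> (\<forall>i j. P i j \<longrightarrow> Q (f i j))"
  by blast

lemma vanish_comm_relators:
  "algebra A \<Longrightarrow> (\<forall>r\<in>comm_relators X. eval_free A x r = 0) \<longleftrightarrow>
     (\<forall>a\<in>X. \<forall>b\<in>X.
        amult A (eval_free A x a) (eval_free A x b) = amult A (eval_free A x b) (eval_free A x a))"
  unfolding comm_relators_def ball_Collect2 by (auto simp: eval_free_simps)

lemma vanish_inverse_relators:
  "algebra A \<Longrightarrow> (\<forall>r\<in>inverse_relators k l. eval_free A x r = 0) \<longleftrightarrow>
     (\<forall>i. amult A (eval_free A x (k i)) (eval_free A x (l i)) = aone A \<and>
          amult A (eval_free A x (l i)) (eval_free A x (k i)) = aone A)"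
  unfolding inverse_relators_def ball_Un ball_Collect1 by (auto simp: eval_free_simps)

text \<open>An equivalence, so that it serves both to read the relations off a presented algebra and
  to verify them in the target of a homomorphism.\<close>

lemma vanish_B_relators:
  fixes y :: "'i B_gen \<Rightarrow> 'a::qvs"
  assumes A: "algebra A"
  defines "\<theta> \<equiv> \<lambda>i. y (GTheta i)" and "h \<equiv> \<lambda>i. y (GH i)" and "l \<equiv> \<lambda>i. y (GHinv i)"
  shows "(\<forall>r\<in>B_relators C d. eval_free A y r = 0) \<longleftrightarrow>
     (\<forall>i j. amult A (h i) (h j) = amult A (h j) (h i)) \<and>
     (\<forall>i. amult A (h i) (l i) = aone A \<and> amult A (l i) (h i) = aone A) \<and>
     (\<forall>i j. amult A (h i) (\<theta> j) = ((vv ^ d i) powi C i j) *\<^sub>Q amult A (\<theta> j) (h i)) \<and>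
     (\<forall>i j. i \<noteq> j \<longrightarrow> serre_value C d A \<theta> i j = 0)"
  unfolding B_relators_def ball_Un ball_Collect2 vanish_comm_relators[OF A] vanish_inverse_relators[OF A]
    assms(2-4)
  by (simp add: eval_free_simps A eval_free_serre)

lemma vanish_Util_relators:
  fixes y :: "'i Util_gen \<Rightarrow> 'a::qvs"
  assumes A: "algebra A"
  defines "e \<equiv> \<lambda>i. y (Base (GE i))" and "f \<equiv> \<lambda>i. y (Base (GF i))"
    and "k \<equiv> \<lambda>i. y (Base (GK i))" and "k' \<equiv> \<lambda>i. y (Base (GK' i))"
    and "l \<equiv> \<lambda>i. y (GKinv i)" and "l' \<equiv> \<lambda>i. y (GK'inv i)"
  shows "(\<forall>r\<in>Util_relators C d. eval_free A y r = 0) \<longleftrightarrow>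
     (\<forall>i j. amult A (k i) (k j) = amult A (k j) (k i)) \<and>
     (\<forall>i j. amult A (k i) (k' j) = amult A (k' j) (k i)) \<and>
     (\<forall>i j. amult A (k' i) (k' j) = amult A (k' j) (k' i)) \<and>
     (\<forall>i j. amult A (e i) (f j) - amult A (f j) (e i)
        = (if i = j then (inverse (vv ^ d i) - vv ^ d i) *\<^sub>Q (k i - k' i) else 0)) \<and>
     (\<forall>i j. amult A (k i) (e j) = ((vv ^ d i) powi C i j) *\<^sub>Q amult A (e j) (k i)) \<and>
     (\<forall>i j. amult A (k i) (f j) = ((vv ^ d i) powi (- C i j)) *\<^sub>Q amult A (f j) (k i)) \<and>
     (\<forall>i j. amult A (k' i) (e j) = ((vv ^ d i) powi (- C i j)) *\<^sub>Q amult A (e j) (k' i)) \<and>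
     (\<forall>i j. amult A (k' i) (f j) = ((vv ^ d i) powi C i j) *\<^sub>Q amult A (f j) (k' i)) \<and>
     (\<forall>i j. i \<noteq> j \<longrightarrow> serre_value C d A e i j = 0) \<and>
     (\<forall>i j. i \<noteq> j \<longrightarrow> serre_value C d A f i j = 0) \<and>
     (\<forall>i. amult A (k i) (l i) = aone A \<and> amult A (l i) (k i) = aone A) \<and>
     (\<forall>i. amult A (k' i) (l' i) = aone A \<and> amult A (l' i) (k' i) = aone A)"
proof -
  have comm: "(\<forall>r\<in>comm_relators (range (\<lambda>i. gen (Base (GK i))) \<union> range (\<lambda>i. gen (Base (GK' i)))). eval_free A y r = 0) \<longleftrightarrow>
     (\<forall>i j. amult A (k i) (k j) = amult A (k j) (k i)) \<and>
     (\<forall>i j. amult A (k i) (k' j) = amult A (k' j) (k i)) \<and>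
     (\<forall>i j. amult A (k' i) (k' j) = amult A (k' j) (k' i))"
    unfolding vanish_comm_relators[OF A] assms(2-7) by (auto simp: eval_free_gen[OF A] ball_Un)
  show ?thesis
    unfolding Util_relators_def U_relators_def ball_Un ball_Collect2 comm vanish_inverse_relators[OF A]
    by (simp add: eval_free_simps A eval_free_serre if_distrib[of "eval_free A y"] assms(2-7) cong: if_cong)
qed


section \<open>The indeterminate\<close>

lemma v_half_power: "v_half ^ n = abs_qv (Fract (monom 1 n) 1)"
proof (induction n)
  case 0
  then show ?case by (simp add: one_qv.abs_eq One_fract_def monom_0 pCons_one)
next
  case (Suc n)
  then show ?case by (simp add: v_half_def times_qv.abs_eq monom_Suc)
qed

lemma vv_nonzero: "vv \<noteq> 0"
  by (simp add: vv_def v_half_power zero_qv.abs_eq abs_qv_inject Zero_fract_def eq_fract)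

text \<open>The powers are monomials of positive degree, so \<open>vv\<close> is not a root of
  unity.\<close>

lemma vv_power_neq_1: "0 < n \<Longrightarrow> vv ^ n \<noteq> 1"
  unfolding vv_def power_mult[symmetric]
  by (simp add: v_half_power one_qv.abs_eq abs_qv_inject One_fract_def eq_fract monom_eq_1_iff)

section \<open>The isomorphism\<close>

locale twisted_double = hopf_pair +
  fixes C :: "'i::finite \<Rightarrow> 'i \<Rightarrow> int" and d :: "'i \<Rightarrow> nat"
    and U :: "'u::qvs hopf" and x :: "'i Util_gen \<Rightarrow> 'u" and z :: "'i B_gen \<Rightarrow> 'a"
  assumes gcm: "symmetrizable_GCM C d"
    and Util: "is_Util C d U x"
    and Btil: "is_Btil C d H z"
    and Btil_pairing: "is_Btil_pairing C d H z \<phi>"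
begin

sublocale U: hopf_alg U
  using Util by unfold_locales (simp add: is_Util_def)

abbreviation Umul (infixl \<open>\<star>\<close> 77) where "a \<star> b \<equiv> amult U a b"

abbreviation \<theta> where "\<theta> i \<equiv> z (GTheta i)"
abbreviation h where "h i \<equiv> z (GH i)"
abbreviation l where "l i \<equiv> z (GHinv i)"
abbreviation E where "E i \<equiv> x (Base (GE i))"
abbreviation F where "F i \<equiv> x (Base (GF i))"
abbreviation K where "K i \<equiv> x (Base (GK i))"
abbreviation K' where "K' i \<equiv> x (Base (GK' i))"
abbreviation L where "L i \<equiv> x (GKinv i)"
abbreviation L' where "L' i \<equiv> x (GK'inv i)"
abbreviation q where "q i \<equiv> vv ^ d i"

lemma B_presented: "presented_by H z (B_relators C d)"
  and comult_\<theta>: "\<Delta> (\<theta> i) = \<theta> i \<otimes> \<one> + h i \<otimes> \<theta> i"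
  and comult_h: "\<Delta> (h i) = h i \<otimes> h i"
  and counit_\<theta> [simp]: "\<epsilon> (\<theta> i) = 0" and counit_h [simp]: "\<epsilon> (h i) = 1"
  and antipode_\<theta>: "S (\<theta> i) = - (l i \<cdot> \<theta> i)" and antipode_h: "S (h i) = l i"
  using Btil by (simp_all add: is_Btil_def Let_def)

lemma U_presented: "presented_by U x (Util_relators C d)"
  and comult_E: "comult U (E i) = E i \<otimes> aone U + K i \<otimes> E i"
  and comult_F: "comult U (F i) = aone U \<otimes> F i + F i \<otimes> K' i"
  and comult_K: "comult U (K i) = K i \<otimes> K i" and comult_K': "comult U (K' i) = K' i \<otimes> K' i"
  and antipode_E: "antipode U (E i) = - (L i \<star> E i)" and antipode_F: "antipode U (F i) = - (F i \<star> L' i)"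
  and antipode_K: "antipode U (K i) = L i" and antipode_K': "antipode U (K' i) = L' i"
  and counit_E: "counit U (E i) = 0" and counit_F: "counit U (F i) = 0"
  and counit_K: "counit U (K i) = 1" and counit_K': "counit U (K' i) = 1"
  using Util by (simp_all add: is_Util_def Let_def)

lemma B_relations:
  "h i \<cdot> h j = h j \<cdot> h i"
  "h i \<cdot> l i = \<one>" "l i \<cdot> h i = \<one>"
  "h i \<cdot> \<theta> j = (q i powi C i j) *\<^sub>Q (\<theta> j \<cdot> h i)"
  "i \<noteq> j \<Longrightarrow> serre_value C d H \<theta> i j = 0"
proof -
  have "\<forall>r\<in>B_relators C d. eval_free H z r = 0"
    using presented_by_relation[OF B_presented] by blast
  note r = this[unfolded vanish_B_relators[OF alg]]
  show "h i \<cdot> h j = h j \<cdot> h i" "h i \<cdot> l i = \<one>" "l i \<cdot> h i = \<one>"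
    "h i \<cdot> \<theta> j = (q i powi C i j) *\<^sub>Q (\<theta> j \<cdot> h i)"
    "i \<noteq> j \<Longrightarrow> serre_value C d H \<theta> i j = 0"
    using r by blast+
qed

lemma U_relations:
  "K i \<star> K j = K j \<star> K i" "K i \<star> K' j = K' j \<star> K i" "K' i \<star> K' j = K' j \<star> K' i"
  "E i \<star> F j - F j \<star> E i = (if i = j then (inverse (q i) - q i) *\<^sub>Q (K i - K' i) else 0)"
  "K i \<star> E j = (q i powi C i j) *\<^sub>Q (E j \<star> K i)" "K i \<star> F j = (q i powi (- C i j)) *\<^sub>Q (F j \<star> K i)"
  "K' i \<star> E j = (q i powi (- C i j)) *\<^sub>Q (E j \<star> K' i)" "K' i \<star> F j = (q i powi C i j) *\<^sub>Q (F j \<star> K' i)"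
  "i \<noteq> j \<Longrightarrow> serre_value C d U E i j = 0" "i \<noteq> j \<Longrightarrow> serre_value C d U F i j = 0"
  "K i \<star> L i = aone U" "L i \<star> K i = aone U" "K' i \<star> L' i = aone U" "L' i \<star> K' i = aone U"
proof -
  have "\<forall>r\<in>Util_relators C d. eval_free U x r = 0"
    using presented_by_relation[OF U_presented] by blast
  note r = this[unfolded vanish_Util_relators[OF U.alg]]
  show "K i \<star> K j = K j \<star> K i" using r by (elim conjE) metis
  show "K i \<star> K' j = K' j \<star> K i" using r by (elim conjE) metis
  show "K' i \<star> K' j = K' j \<star> K' i" using r by (elim conjE) metis
  show "E i \<star> F j - F j \<star> E i = (if i = j then (inverse (q i) - q i) *\<^sub>Q (K i - K' i) else 0)" using r by (elim conjE) metis
  show "K i \<star> E j = (q i powi C i j) *\<^sub>Q (E j \<star> K i)" using r by (elim conjE) metis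
  show "K i \<star> F j = (q i powi (- C i j)) *\<^sub>Q (F j \<star> K i)" using r by (elim conjE) metis
  show "K' i \<star> E j = (q i powi (- C i j)) *\<^sub>Q (E j \<star> K' i)" using r by (elim conjE) metis
  show "K' i \<star> F j = (q i powi C i j) *\<^sub>Q (F j \<star> K' i)" using r by (elim conjE) metis
  show "i \<noteq> j \<Longrightarrow> serre_value C d U E i j = 0" using r by (elim conjE) metis
  show "i \<noteq> j \<Longrightarrow> serre_value C d U F i j = 0" using r by (elim conjE) metis
  show "K i \<star> L i = aone U" "L i \<star> K i = aone U" "K' i \<star> L' i = aone U" "L' i \<star> K' i = aone U" using r by ((elim conjE), metis)+
qed

lemma symmetric: "int (d i) * C i j = int (d j) * C j i" and C_diag: "C i i = 2" and d_pos: "d i > 0"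
  using gcm by (simp_all add: symmetrizable_GCM_def)

lemma q_nonzero [simp]: "q i \<noteq> 0"
  by (simp add: vv_nonzero)

lemma q_powi_symmetric: "q i powi C i j = q j powi C j i"
  by (simp only: power_int_mult[symmetric] power_int_of_nat[symmetric] symmetric[of i])

lemma \<phi>_\<theta>\<theta>: "\<phi> (\<theta> i) (\<theta> j) = (if i = j then q i - inverse (q i) else 0)"
  and \<phi>_hh: "\<phi> (h i) (h j) = q i powi C i j"
  and \<phi>_\<theta>h: "\<phi> (\<theta> i) (h j) = 0"
  using Btil_pairing by (simp_all add: is_Btil_pairing_def)

lemma sw_h:
  "(\<And>q. linearQ (\<lambda>p. f p q)) \<Longrightarrow> (\<And>p. linearQ (\<lambda>q. f p q)) \<Longrightarrow> sw (h i) f = f (h i) (h i)"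
  by (simp add: sw_def comult_h tsum_tens)

lemma sw_\<theta>:
  assumes f: "\<And>q. linearQ (\<lambda>p. f p q)" "\<And>p. linearQ (\<lambda>q. f p q)"
  shows "sw (\<theta> i) f = f (\<theta> i) \<one> + f (h i) (\<theta> i)"
proof -
  have "linearQ (\<lambda>t. tsum t f)" by (intro lin f)
  from linearQ_add[OF this] show ?thesis by (simp add: sw_def comult_\<theta> tsum_tens f)
qed

text \<open>\<open>\<phi> (h i)\<close> is a character, so it kills the \<open>q\<close>-commuting \<open>\<theta> j\<close>.\<close>

lemma \<phi>_h\<theta>: "\<phi> (h i) (\<theta> j) = 0"
proof -
  have "\<phi> (h i) (h j \<cdot> \<theta> j) = \<phi> (h i) (h j) * \<phi> (h i) (\<theta> j)"
    "\<phi> (h i) (\<theta> j \<cdot> h j) = \<phi> (h i) (\<theta> j) * \<phi> (h i) (h j)"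
    by (simp_all add: \<phi>_mult_right sw_h lin)
  moreover have "\<phi> (h i) (h j \<cdot> \<theta> j) = (q j powi C j j) * \<phi> (h i) (\<theta> j \<cdot> h j)"
    using linearQ_scale[OF \<phi>_lin(2)[OF linearQ_ident, of "h i"]] by (simp add: B_relations(4)[of j j])
  \<comment> \<open>The square is the diagonal entry 2 of the Cartan matrix.\<close>
  ultimately have "(q j ^ 2 - 1) * (\<phi> (h i) (h j) * \<phi> (h i) (\<theta> j)) = 0"
    by (simp add: C_diag algebra_simps)
  moreover have "q j ^ 2 - 1 \<noteq> 0"
    using vv_power_neq_1[of "d j * 2"] d_pos[of j] by (simp add: power_mult)
  moreover have "\<phi> (h i) (h j) \<noteq> 0"
    by (simp add: \<phi>_hh power_int_eq_0_iff vv_nonzero)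
  ultimately show ?thesis by simp
qed

text \<open>\<open>D (\<theta> i)\<close> turns \<open>\<theta> j\<close> into a multiple of the
  group-like \<open>h j\<close>, the source of the Cartan terms in the commutator of E and F;
  \<open>\<phi>_h\<theta>\<close> is what makes \<open>D (h i)\<close> fix
  \<open>\<theta> j\<close>.\<close>

lemma D_gens:
  "D (\<theta> i) (\<theta> j) = \<phi> (\<theta> i) (\<theta> j) *\<^sub>Q h j" "D (h i) (\<theta> j) = \<theta> j"
  "D (\<theta> i) (h j) = 0" "D (h i) (h j) = \<phi> (h i) (h j) *\<^sub>Q h j"
  by (simp_all add: D_def sw_h sw_\<theta> lin \<phi>_\<theta>h \<phi>_h\<theta> scaleQ_one)

lemma G_gens:
  "G (\<theta> j) (\<theta> i) = \<phi> (\<theta> i) (\<theta> j) *\<^sub>Q h i" "G (h j) (\<theta> i) = \<theta> i"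
  "G (\<theta> j) (h i) = 0" "G (h j) (h i) = \<phi> (h i) (h j) *\<^sub>Q h i"
  by (simp_all add: G_def sw_h sw_\<theta> lin \<phi>_\<theta>h \<phi>_h\<theta> scaleQ_one)

lemma LE_simps: "LE 0 t = 0" "LE (c *\<^sub>Q a) t = c *\<^sub>Q LE a t"
  and LF_simps: "LF 0 t = 0" "LF (c *\<^sub>Q a) t = c *\<^sub>Q LF a t"
  by (rule linearQ_zero[OF LE_lin(1)[OF linearQ_ident]] linearQ_scale[OF LE_lin(1)[OF linearQ_ident]]
      linearQ_zero[OF LF_lin(1)[OF linearQ_ident]] linearQ_scale[OF LF_lin(1)[OF linearQ_ident]])+

lemma cross_h\<theta>: "LE (h i) (LF (\<theta> j) t) = (q i powi (- C i j)) *\<^sub>Q LF (\<theta> j) (LE (h i) t)"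
proof -
  have "LF (\<theta> j) (LE (h i) t) = (q i powi C i j) *\<^sub>Q LE (h i) (LF (\<theta> j) t)"
    using cross[of "h i" "\<theta> j" t]
    by (simp add: sw_h sw_\<theta> lin D_gens G_gens LE_simps LF_simps LE_one LF_one \<phi>_hh)
  then show ?thesis
    by (simp add: power_int_minus power_int_eq_0_iff vv_nonzero scaleQ_one)
qed

lemma cross_\<theta>h: "LF (h i) (LE (\<theta> j) t) = (q i powi (- C i j)) *\<^sub>Q LE (\<theta> j) (LF (h i) t)"
proof -
  have "LE (\<theta> j) (LF (h i) t) = (q i powi C i j) *\<^sub>Q LF (h i) (LE (\<theta> j) t)"
    using cross[of "\<theta> j" "h i" t]
    by (simp add: sw_h sw_\<theta> lin D_gens G_gens LE_simps LF_simps LE_one LF_one \<phi>_hh q_powi_symmetric[of i])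
  then show ?thesis
    by (simp add: power_int_minus power_int_eq_0_iff vv_nonzero scaleQ_one)
qed

lemma cross_hh: "LE (h i) (LF (h j) t) = LF (h j) (LE (h i) t)"
  using cross[of "h i" "h j" t]
  by (simp add: sw_h lin D_gens G_gens LE_simps LF_simps \<phi>_hh power_int_eq_0_iff vv_nonzero)

text \<open>In \<open>cross\<close> the \<open>F\<close>-side Cartan term carries \<phi>(\<theta> i,
  \<theta> j) on the left and the \<open>E\<close>-side one on the right; collecting them reverses
  the sign of q i - 1/q i.\<close>

lemma cross_\<theta>\<theta>: "LE (\<theta> i) (LF (\<theta> j) t) - LF (\<theta> j) (LE (\<theta> i) t) =
    (if i = j then (inverse (q i) - q i) *\<^sub>Q (LE (h i) t - LF (h i) t) else 0)"
proof -
  have "\<phi> (\<theta> i) (\<theta> j) *\<^sub>Q LF (h j) t + LF (\<theta> j) (LE (\<theta> i) t)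
      = \<phi> (\<theta> i) (\<theta> j) *\<^sub>Q LE (h i) t + LE (\<theta> i) (LF (\<theta> j) t)"
    using cross[of "\<theta> i" "\<theta> j" t]
    by (simp add: sw_\<theta> lin D_gens G_gens LE_simps LF_simps LE_one LF_one)
  then show ?thesis
    by (auto simp: \<phi>_\<theta>\<theta> algebra_simps qvs.scale_right_diff_distrib qvs.scale_left_diff_distrib)
qed

section \<open>The representation of U on the tensor square\<close>

definition LEe :: "'a \<Rightarrow> ('a, 'a) tensor lin_end" where "LEe a = End (LE a)"
definition LFe :: "'a \<Rightarrow> ('a, 'a) tensor lin_end" where "LFe a = End (LF a)"

lemma app_LEe: "app (LEe a) t = LE a t" and app_LFe: "app (LFe a) t = LF a t"
  by (simp_all add: LEe_def LFe_def app_End lin)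

lemma LEe_hom: "alg_hom H end_alg LEe" and LFe_hom: "alg_hom H end_alg LFe"
  unfolding alg_hom_def
  by (auto intro!: linearQ_I lin_end_eqI simp: app_LEe app_LFe app_plus app_scale app_one app_mult
      LE_one LF_one LE_mult LF_mult linearQ_add[OF LE_lin(1)[OF linearQ_ident]]
      linearQ_add[OF LF_lin(1)[OF linearQ_ident]] linearQ_scale[OF LE_lin(1)[OF linearQ_ident]]
      linearQ_scale[OF LF_lin(1)[OF linearQ_ident]])

fun end_gen :: "'i Util_gen \<Rightarrow> ('a, 'a) tensor lin_end" where
  "end_gen (Base (GE i)) = LEe (\<theta> i)"
| "end_gen (Base (GF i)) = LFe (\<theta> i)"
| "end_gen (Base (GK i)) = LEe (h i)"
| "end_gen (Base (GK' i)) = LFe (h i)"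
| "end_gen (GKinv i) = LEe (l i)"
| "end_gen (GK'inv i) = LFe (l i)"

text \<open>Relations within one half, Serre relations included, are images of relations of B under
  \<open>LEe\<close> or \<open>LFe\<close>; the mixed ones are the instances of \<open>cross\<close>
  on generators.\<close>

lemma end_gen_relators: "r \<in> Util_relators C d \<Longrightarrow> eval_free end_alg end_gen r = 0"
proof -
  have E: "amult end_alg (LEe a) (LEe b) = LEe (a \<cdot> b)" and F: "amult end_alg (LFe a) (LFe b) = LFe (a \<cdot> b)" for a b
    by (simp_all add: alg_hom_mult[OF LEe_hom] alg_hom_mult[OF LFe_hom])
  have s: "LEe (c *\<^sub>Q a) = c *\<^sub>Q LEe a" "LFe (c *\<^sub>Q a) = c *\<^sub>Q LFe a" for c a
    by (simp_all add: linearQ_scale[OF alg_hom_linear[OF LEe_hom]] linearQ_scale[OF alg_hom_linear[OF LFe_hom]])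
  have "\<forall>r\<in>Util_relators C d. eval_free end_alg end_gen r = 0"
    unfolding vanish_Util_relators[OF algebra_end_alg] end_gen.simps
  proof (intro conjI allI impI)
    fix i j
    show "amult end_alg (LEe (h i)) (LEe (h j)) = amult end_alg (LEe (h j)) (LEe (h i))"
      "amult end_alg (LFe (h i)) (LFe (h j)) = amult end_alg (LFe (h j)) (LFe (h i))"
      by (simp_all add: E F B_relations(1)[of i])
    show "amult end_alg (LEe (h i)) (LFe (h j)) = amult end_alg (LFe (h j)) (LEe (h i))"
      by (rule lin_end_eqI) (simp add: app_mult app_LEe app_LFe cross_hh)
    show "amult end_alg (LEe (\<theta> i)) (LFe (\<theta> j)) - amult end_alg (LFe (\<theta> j)) (LEe (\<theta> i)) =
        (if i = j then (inverse (q i) - q i) *\<^sub>Q (LEe (h i) - LFe (h i)) else 0)"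
      by (rule lin_end_eqI) (simp add: app_mult app_LEe app_LFe app_diff app_scale app_zero cross_\<theta>\<theta>)
    show "amult end_alg (LEe (h i)) (LEe (\<theta> j)) = (q i powi C i j) *\<^sub>Q amult end_alg (LEe (\<theta> j)) (LEe (h i))"
      "amult end_alg (LFe (h i)) (LFe (\<theta> j)) = (q i powi C i j) *\<^sub>Q amult end_alg (LFe (\<theta> j)) (LFe (h i))"
      by (simp_all add: E F B_relations(4) s)
    show "amult end_alg (LEe (h i)) (LFe (\<theta> j)) = (q i powi (- C i j)) *\<^sub>Q amult end_alg (LFe (\<theta> j)) (LEe (h i))"
      by (rule lin_end_eqI) (simp add: app_mult app_LEe app_LFe app_scale cross_h\<theta>)
    show "amult end_alg (LFe (h i)) (LEe (\<theta> j)) = (q i powi (- C i j)) *\<^sub>Q amult end_alg (LEe (\<theta> j)) (LFe (h i))"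
      by (rule lin_end_eqI) (simp add: app_mult app_LEe app_LFe app_scale cross_\<theta>h)
    show "serre_value C d end_alg (\<lambda>i. LEe (\<theta> i)) i j = 0" "serre_value C d end_alg (\<lambda>i. LFe (\<theta> i)) i j = 0" if "i \<noteq> j"
      by (simp_all add: alg_hom_serre[OF LEe_hom, symmetric] alg_hom_serre[OF LFe_hom, symmetric] B_relations(5)[OF that]
          linearQ_zero[OF alg_hom_linear[OF LEe_hom]] linearQ_zero[OF alg_hom_linear[OF LFe_hom]])
    show "amult end_alg (LEe (h i)) (LEe (l i)) = aone end_alg" "amult end_alg (LEe (l i)) (LEe (h i)) = aone end_alg"
      "amult end_alg (LFe (h i)) (LFe (l i)) = aone end_alg" "amult end_alg (LFe (l i)) (LFe (h i)) = aone end_alg"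
      by (simp_all add: E F B_relations alg_hom_one[OF LEe_hom] alg_hom_one[OF LFe_hom])
  qed
  then show "r \<in> Util_relators C d \<Longrightarrow> eval_free end_alg end_gen r = 0" by blast
qed

definition \<rho> :: "'u \<Rightarrow> ('a, 'a) tensor lin_end" where
  "\<rho> = (SOME f. alg_hom U end_alg f \<and> (\<forall>g. f (x g) = end_gen g))"

lemma \<rho>_hom: "alg_hom U end_alg \<rho>" and \<rho>_gen: "\<rho> (x g) = end_gen g"
proof -
  have "\<exists>f. alg_hom U end_alg f \<and> (\<forall>g. f (x g) = end_gen g)"
    using presented_by_hom[OF U_presented algebra_end_alg end_gen_relators] by metis
  from someI_ex[OF this] show "alg_hom U end_alg \<rho>" "\<rho> (x g) = end_gen g"
    unfolding \<rho>_def by blast+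
qed

section \<open>The two halves of U\<close>

fun E_gen :: "'i B_gen \<Rightarrow> 'u" where
  "E_gen (GTheta i) = E i" | "E_gen (GH i) = K i" | "E_gen (GHinv i) = L i"

fun F_gen :: "'i B_gen \<Rightarrow> 'u" where
  "F_gen (GTheta i) = F i" | "F_gen (GH i) = K' i" | "F_gen (GHinv i) = L' i"

text \<open>K' commutes past F with the same exponent as K past E, so both halves, not just the E
  half, receive an algebra homomorphism from B.\<close>

lemma E_gen_relators: "r \<in> B_relators C d \<Longrightarrow> eval_free U E_gen r = 0"
  and F_gen_relators: "r \<in> B_relators C d \<Longrightarrow> eval_free U F_gen r = 0"
proof -
  have "\<forall>r\<in>B_relators C d. eval_free U E_gen r = 0" "\<forall>r\<in>B_relators C d. eval_free U F_gen r = 0"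
    unfolding vanish_B_relators[OF U.alg] by (auto simp: U_relations)
  then show "r \<in> B_relators C d \<Longrightarrow> eval_free U E_gen r = 0" "r \<in> B_relators C d \<Longrightarrow> eval_free U F_gen r = 0"
    by blast+
qed

definition \<psi>E :: "'a \<Rightarrow> 'u" where "\<psi>E = (SOME f. alg_hom H U f \<and> (\<forall>g. f (z g) = E_gen g))"
definition \<psi>F :: "'a \<Rightarrow> 'u" where "\<psi>F = (SOME f. alg_hom H U f \<and> (\<forall>g. f (z g) = F_gen g))"

lemma \<psi>E_hom: "alg_hom H U \<psi>E" and \<psi>E_gen: "\<psi>E (z g) = E_gen g"
proof -
  have "\<exists>f. alg_hom H U f \<and> (\<forall>g. f (z g) = E_gen g)"
    using presented_by_hom[OF B_presented U.alg E_gen_relators] by metis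
  from someI_ex[OF this] show "alg_hom H U \<psi>E" "\<psi>E (z g) = E_gen g"
    unfolding \<psi>E_def by blast+
qed

lemma \<psi>F_hom: "alg_hom H U \<psi>F" and \<psi>F_gen: "\<psi>F (z g) = F_gen g"
proof -
  have "\<exists>f. alg_hom H U f \<and> (\<forall>g. f (z g) = F_gen g)"
    using presented_by_hom[OF B_presented U.alg F_gen_relators] by metis
  from someI_ex[OF this] show "alg_hom H U \<psi>F" "\<psi>F (z g) = F_gen g"
    unfolding \<psi>F_def by blast+
qed

end

lemma alg_hom_comp: "alg_hom A B f \<Longrightarrow> alg_hom B C g \<Longrightarrow> alg_hom A C (\<lambda>a. g (f a))"
  unfolding alg_hom_def by (auto intro: linearQ_compose)

lemma linear_span_mem:
  assumes "linearQ f" "qvs.subspace W" "\<And>g. g \<in> X \<Longrightarrow> f g \<in> W" "v \<in> qvs.span X"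
  shows "f v \<in> W"
  using assms(4) by (rule qvs.span_induct) (use assms in \<open>auto intro: linear_vimage_subspace\<close>)

context twisted_double
begin

lemma \<psi>E_mult: "\<psi>E (a \<cdot> b) = \<psi>E a \<star> \<psi>E b" and \<psi>F_mult: "\<psi>F (a \<cdot> b) = \<psi>F a \<star> \<psi>F b"
  and \<psi>E_one: "\<psi>E \<one> = aone U" and \<psi>F_one: "\<psi>F \<one> = aone U"
  using \<psi>E_hom \<psi>F_hom by (simp_all add: alg_hom_def)

lemma \<psi>E_lin [lin]: "linearQ f \<Longrightarrow> linearQ (\<lambda>x. \<psi>E (f x))" and \<psi>F_lin [lin]: "linearQ f \<Longrightarrow> linearQ (\<lambda>x. \<psi>F (f x))"
  by (intro linearQ_compose[OF alg_hom_linear[OF \<psi>E_hom]] linearQ_compose[OF alg_hom_linear[OF \<psi>F_hom]]; assumption)+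

lemma \<psi>E_simps [simp]: "\<psi>E (\<theta> i) = E i" "\<psi>E (h i) = K i" "\<psi>E (l i) = L i"
  and \<psi>F_simps [simp]: "\<psi>F (\<theta> i) = F i" "\<psi>F (h i) = K' i" "\<psi>F (l i) = L' i"
  by (simp_all add: \<psi>E_gen \<psi>F_gen)

section \<open>Spanning U by products from its two halves\<close>

lemma inverse_commutes:
  assumes "k \<star> m = aone U" "m \<star> k = aone U" "k \<star> y = c *\<^sub>Q (y \<star> k)"
  shows "y \<star> m = c *\<^sub>Q (m \<star> y)"
proof -
  have "y \<star> m = m \<star> (k \<star> y) \<star> m" by (simp add: assms(2) flip: U.assoc)
  also have "\<dots> = c *\<^sub>Q (m \<star> y \<star> (k \<star> m))"
    by (simp add: assms(3) amult_simps[OF U.alg] U.assoc)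
  finally show ?thesis by (simp add: assms(1))
qed

definition V where "V = qvs.span {\<psi>E a \<star> \<psi>F b | a b. True}"

lemma subspace_V: "qvs.subspace V"
  by (simp add: V_def qvs.subspace_span)

lemma V_base: "\<psi>E a \<star> \<psi>F b \<in> V"
  unfolding V_def by (rule qvs.span_base) blast

lemma V_E_gen: "w \<in> V \<Longrightarrow> E_gen g \<star> w \<in> V"
  unfolding V_def
proof (rule linear_span_mem[where f = "\<lambda>w. E_gen g \<star> w"])
  show "linearQ ((\<star>) (E_gen g))" by (intro lin U.alg)
  fix y assume "y \<in> {\<psi>E a \<star> \<psi>F b |a b. True}"
  then obtain a b where y: "y = \<psi>E a \<star> \<psi>F b" by blast
  show "E_gen g \<star> y \<in> qvs.span {\<psi>E a \<star> \<psi>F b |a b. True}"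
    using V_base[of "z g \<cdot> a" b] by (simp add: y \<psi>E_mult \<psi>E_gen U.assoc V_def)
qed (simp_all add: qvs.subspace_span)

text \<open>Induction on the E factor: \<open>y\<close> moves right past one generator at a time
  until it meets some \<open>\<psi>F b\<close>. The step is given \<open>w\<close> as well as
  \<open>y \<star> w\<close> in V, because a commutator leaves terms without
  \<open>y\<close>.\<close>

lemma V_closed:
  assumes base: "\<And>b. y \<star> \<psi>F b \<in> V"
    and step: "\<And>g w. w \<in> V \<Longrightarrow> y \<star> w \<in> V \<Longrightarrow> y \<star> (E_gen g \<star> w) \<in> V"
    and w: "w \<in> V"
  shows "y \<star> w \<in> V"
proof (rule linear_span_mem[where f = "\<lambda>w. y \<star> w", OF _ subspace_V _ w[unfolded V_def]])
  show "linearQ ((\<star>) y)" by (intro lin U.alg)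
  fix u assume "u \<in> {\<psi>E a \<star> \<psi>F b |a b. True}"
  then obtain a b where u: "u = \<psi>E a \<star> \<psi>F b" by blast
  have "a \<in> {a. y \<star> (\<psi>E a \<star> \<psi>F b) \<in> V}"
  proof (rule presented_by_subspace[OF B_presented])
    show "qvs.subspace {a. y \<star> (\<psi>E a \<star> \<psi>F b) \<in> V}"
      by (rule linear_vimage_subspace[OF _ subspace_V]) (intro lin U.alg)
    show "\<one> \<in> {a. y \<star> (\<psi>E a \<star> \<psi>F b) \<in> V}" by (simp add: \<psi>E_one base)
    show "z g \<cdot> a \<in> {a. y \<star> (\<psi>E a \<star> \<psi>F b) \<in> V}" if "a \<in> {a. y \<star> (\<psi>E a \<star> \<psi>F b) \<in> V}" for g a
      using step[OF V_base, of a b g] that by (simp add: \<psi>E_mult \<psi>E_gen U.assoc)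
  qed
  then show "y \<star> u \<in> V" by (simp add: u)
qed

lemma V_commuting:
  assumes base: "\<And>b. y \<star> \<psi>F b \<in> V"
    and step: "\<And>g. \<exists>c. y \<star> E_gen g = c *\<^sub>Q (E_gen g \<star> y)"
    and w: "w \<in> V"
  shows "y \<star> w \<in> V"
proof (rule V_closed[OF base _ w])
  fix g w assume "y \<star> w \<in> V"
  moreover obtain c where "y \<star> E_gen g = c *\<^sub>Q (E_gen g \<star> y)" using step by blast
  then have "y \<star> (E_gen g \<star> w) = c *\<^sub>Q (E_gen g \<star> (y \<star> w))"
    by (simp add: amult_simps[OF U.alg] flip: U.assoc)
  ultimately show "y \<star> (E_gen g \<star> w) \<in> V"
    by (simp add: V_E_gen qvs.subspace_scale[OF subspace_V])
qed

lemma V_F_base: "F_gen g \<star> \<psi>F b \<in> V"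
  using V_base[of \<one> "z g \<cdot> b"] by (simp add: \<psi>E_one \<psi>F_mult \<psi>F_gen)

text \<open>That the scalar is nonzero allows it to be inverted for L' in
  \<open>V_L'\<close>.\<close>

lemma K'_E_gen: "\<exists>c. c \<noteq> 0 \<and> K' i \<star> E_gen g = c *\<^sub>Q (E_gen g \<star> K' i)"
proof (cases g)
  case (GTheta j)
  then show ?thesis
    by (intro exI[of _ "q i powi (- C i j)"]) (simp add: U_relations(7) power_int_eq_0_iff vv_nonzero)
next
  case (GH j)
  then show ?thesis by (intro exI[of _ 1]) (simp add: U_relations(2)[of j i] scaleQ_one)
next
  case (GHinv j)
  have "K' i \<star> L j = 1 *\<^sub>Q (L j \<star> K' i)"
    by (rule inverse_commutes[OF U_relations(11,12)]) (simp add: U_relations(2) scaleQ_one)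
  then show ?thesis using GHinv by (intro exI[of _ 1]) simp
qed

lemma V_K': "w \<in> V \<Longrightarrow> K' i \<star> w \<in> V"
  by (rule V_commuting) (use V_F_base[of "GH i"] K'_E_gen in \<open>simp_all, blast\<close>)

lemma V_L': "w \<in> V \<Longrightarrow> L' i \<star> w \<in> V"
proof (rule V_commuting)
  fix g
  obtain c where c: "c \<noteq> 0" "K' i \<star> E_gen g = c *\<^sub>Q (E_gen g \<star> K' i)"
    using K'_E_gen by blast
  have "E_gen g \<star> L' i = c *\<^sub>Q (L' i \<star> E_gen g)"
    by (rule inverse_commutes[OF U_relations(13,14) c(2)])
  with c(1) have "L' i \<star> E_gen g = inverse c *\<^sub>Q (E_gen g \<star> L' i)"
    by (simp add: scaleQ_one)
  then show "\<exists>c. L' i \<star> E_gen g = c *\<^sub>Q (E_gen g \<star> L' i)" ..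
qed (use V_F_base[of "GHinv i"] in simp_all)

text \<open>Moving \<open>F i\<close> past \<open>E j\<close> leaves K and K' terms. The former are
  absorbed by the E factor, the latter need \<open>V_K'\<close>, which therefore comes
  earlier.\<close>

lemma V_F: "w \<in> V \<Longrightarrow> F i \<star> w \<in> V"
proof (rule V_closed)
  fix g w assume w: "w \<in> V" "F i \<star> w \<in> V"
  show "F i \<star> (E_gen g \<star> w) \<in> V"
  proof (cases g)
    case (GTheta j)
    have "F i \<star> E j = E j \<star> F i - (if j = i then (inverse (q j) - q j) *\<^sub>Q (K j - K' j) else 0)"
      unfolding U_relations(4)[of j i, symmetric] by simp
    then have "F i \<star> (E j \<star> w) = E j \<star> (F i \<star> w) - (if j = i then (inverse (q j) - q j) *\<^sub>Q (K j \<star> w - K' j \<star> w) else 0)"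
      by (simp add: amult_simps[OF U.alg] flip: U.assoc)
    also have "\<dots> \<in> V"
      using V_E_gen[OF w(2), of "GTheta j"] V_E_gen[OF w(1), of "GH j"] V_K'[OF w(1)]
      by (auto intro!: qvs.subspace_diff[OF subspace_V] qvs.subspace_scale[OF subspace_V] qvs.subspace_0[OF subspace_V])
    finally show ?thesis by (simp add: GTheta)
  next
    case (GH j)
    have "F i \<star> K j = (q j powi C j i) *\<^sub>Q (K j \<star> F i)"
      by (simp add: U_relations(6) power_int_minus power_int_eq_0_iff vv_nonzero scaleQ_one)
    then have "F i \<star> (K j \<star> w) = (q j powi C j i) *\<^sub>Q (K j \<star> (F i \<star> w))"
      by (simp add: amult_simps[OF U.alg] flip: U.assoc)
    then show ?thesis
      using V_E_gen[OF w(2), of "GH j"] by (simp add: GH qvs.subspace_scale[OF subspace_V])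
  next
    case (GHinv j)
    have "F i \<star> L j = (q j powi (- C j i)) *\<^sub>Q (L j \<star> F i)"
      by (rule inverse_commutes[OF U_relations(11,12,6)])
    then have "F i \<star> (L j \<star> w) = (q j powi (- C j i)) *\<^sub>Q (L j \<star> (F i \<star> w))"
      by (simp add: amult_simps[OF U.alg] flip: U.assoc)
    then show ?thesis
      using V_E_gen[OF w(2), of "GHinv j"] by (simp add: GHinv qvs.subspace_scale[OF subspace_V])
  qed
qed (use V_F_base[of "GTheta i"] in simp_all)

lemma U_span: "u \<in> V"
proof (rule presented_by_subspace[OF U_presented subspace_V])
  show "aone U \<in> V" using V_base[of \<one> \<one>] by (simp add: \<psi>E_one \<psi>F_one)
  fix g w assume w: "w \<in> V"
  show "x g \<star> w \<in> V"
  proof (cases g)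
    case (Base b)
    then show ?thesis
      using V_E_gen[OF w, of "GTheta _"] V_E_gen[OF w, of "GH _"] V_F[OF w] V_K'[OF w] by (cases b) auto
  next
    case (GKinv i)
    then show ?thesis using V_E_gen[OF w, of "GHinv i"] by simp
  next
    case (GK'inv i)
    then show ?thesis using V_L'[OF w] by simp
  qed
qed

text \<open>Every identity between linear maps on U is checked below on products of the two halves,
  where \<Phi> is given by \<open>T\<close>.\<close>

lemma U_eqI:
  assumes "linearQ f" "linearQ g" "\<And>a b. f (\<psi>E a \<star> \<psi>F b) = g (\<psi>E a \<star> \<psi>F b)"
  shows "f u = g u"
  using U_span[of u] unfolding V_def
  by (rule qvs.span_induct) (use assms in \<open>auto intro: linear_eq_subspace\<close>)


section \<open>The map \<Phi> and its multiplicativity\<close>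

definition \<Phi> :: "'u \<Rightarrow> ('a, 'a) tensor" where "\<Phi> u = app (\<rho> u) (\<one> \<otimes> \<one>)"

lemma \<rho>_lin [lin]: "linearQ f \<Longrightarrow> linearQ (\<lambda>u. app (\<rho> (f u)) t)"
  by (intro linearQ_compose[OF linearQ_app_fun] linearQ_compose[OF alg_hom_linear[OF \<rho>_hom]])

lemma \<Phi>_lin [lin]: "linearQ f \<Longrightarrow> linearQ (\<lambda>u. \<Phi> (f u))"
  unfolding \<Phi>_def by (intro lin)

lemma \<rho>_\<psi>E: "\<rho> (\<psi>E a) = LEe a" and \<rho>_\<psi>F: "\<rho> (\<psi>F a) = LFe a"
proof -
  have "\<rho> (\<psi>E (z g)) = LEe (z g)" "\<rho> (\<psi>F (z g)) = LFe (z g)" for g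
    by (cases g; simp add: \<rho>_gen)+
  then show "\<rho> (\<psi>E a) = LEe a" "\<rho> (\<psi>F a) = LFe a"
    using presented_by_hom_eq[OF B_presented alg_hom_comp[OF \<psi>E_hom \<rho>_hom] LEe_hom]
      presented_by_hom_eq[OF B_presented alg_hom_comp[OF \<psi>F_hom \<rho>_hom] LFe_hom] by simp_all
qed

lemma \<rho>_mult: "app (\<rho> (u \<star> v)) t = app (\<rho> u) (app (\<rho> v) t)"
  by (simp add: alg_hom_mult[OF \<rho>_hom] app_mult)

lemma \<Phi>_T: "\<Phi> (\<psi>E a \<star> \<psi>F b) = T a b"
  by (simp add: \<Phi>_def \<rho>_mult \<rho>_\<psi>E \<rho>_\<psi>F app_LEe app_LFe LE_LF_one)

text \<open>On products of the two halves this is \<open>iota_mult_T\<close>. It identifies the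
  action with left twisted multiplication, so multiplicativity of \<Phi> is inherited from the
  representation.\<close>

lemma \<rho>_iota: "app (\<rho> u) t = amult I (\<Phi> u) t"
  by (rule U_eqI[where u = u])
     (simp_all add: lin \<Phi>_T iota_mult_T \<rho>_mult \<rho>_\<psi>E \<rho>_\<psi>F app_LEe app_LFe)

lemma \<Phi>_mult: "\<Phi> (u \<star> v) = amult I (\<Phi> u) (\<Phi> v)"
  unfolding \<rho>_iota[symmetric] by (simp add: \<Phi>_def \<rho>_mult)

lemma \<Phi>_one: "\<Phi> (aone U) = aone I"
  by (simp add: \<Phi>_def alg_hom_one[OF \<rho>_hom] app_one iota_one)

lemma \<Phi>_\<psi>F: "\<Phi> (\<psi>F b) = \<one> \<otimes> b"
  using \<Phi>_T[of \<one> b] by (simp add: \<psi>E_one T_def sw_one lin)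

lemma \<Phi>_\<psi>E: "\<Phi> (\<psi>E a) = a \<otimes> \<one>"
  using \<Phi>_T[of a \<one>] by (simp add: \<psi>F_one T_def D_def sw_one lin tens_scale_right sw_counit_left scaleQ_one)

section \<open>Bijectivity of the antipode\<close>

lemma antipode_l: "S (l i) = h i"
proof -
  have "S (l i) \<cdot> l i = \<one>"
    using antipode_mult[of "h i" "l i"] by (simp add: B_relations antipode_h antipode_one)
  then have "S (l i) \<cdot> (l i \<cdot> h i) = h i" by (simp flip: assoc)
  then show ?thesis by (simp add: B_relations)
qed

lemma antipode_L: "antipode U (L i) = K i" and antipode_L': "antipode U (L' i) = K' i"
proof -
  have "antipode U (L i) \<star> L i = aone U"
    using U.antipode_mult[of "K i" "L i"] by (simp add: U_relations antipode_K U.antipode_one)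
  moreover have "antipode U (L' i) \<star> L' i = aone U"
    using U.antipode_mult[of "K' i" "L' i"] by (simp add: U_relations antipode_K' U.antipode_one)
  ultimately have "antipode U (L i) \<star> (L i \<star> K i) = K i" "antipode U (L' i) \<star> (L' i \<star> K' i) = K' i"
    by (simp_all flip: U.assoc)
  then show "antipode U (L i) = K i" "antipode U (L' i) = K' i" by (simp_all add: U_relations)
qed

text \<open>Two antihomomorphisms compose to a homomorphism, so generators suffice. On the F half
  the coproduct is reversed, hence the antipode of U inverts \<open>S\<close> there.\<close>

lemma antipode_\<psi>F: "antipode U (\<psi>F (S b)) = \<psi>F b"
proof (rule presented_by_hom_eq[OF B_presented _ \<psi>F_hom])
  show "alg_hom H U (\<lambda>b. antipode U (\<psi>F (S b)))"
    unfolding alg_hom_def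
    by (intro conjI allI lin) (simp_all add: antipode_one \<psi>F_one U.antipode_one antipode_mult \<psi>F_mult U.antipode_mult)
  show "antipode U (\<psi>F (S (z g))) = \<psi>F (z g)" for g
    by (cases g)
       (simp_all add: antipode_\<theta> antipode_h antipode_l \<psi>F_mult U.antipode_mult antipode_K' antipode_L' antipode_F
         linearQ_uminus[OF \<psi>F_lin[OF linearQ_ident]] linearQ_uminus[OF U.S_lin[OF linearQ_ident]]
         amult_simps[OF U.alg] U.assoc U_relations)
qed

lemma antipode_\<psi>E: "antipode U (\<psi>E a) = \<psi>E (S a)"
proof (rule presented_by_hom_eq[OF B_presented, where B = "opposite U" and f = "\<lambda>a. antipode U (\<psi>E a)" and g = "\<lambda>a. \<psi>E (S a)"])
  show "alg_hom H (opposite U) (\<lambda>a. antipode U (\<psi>E a))" "alg_hom H (opposite U) (\<lambda>a. \<psi>E (S a))"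
    unfolding alg_hom_def
    by (intro conjI allI lin;
        simp add: antipode_one \<psi>E_one U.antipode_one antipode_mult \<psi>E_mult U.antipode_mult)+
  show "antipode U (\<psi>E (z g)) = \<psi>E (S (z g))" for g
    by (cases g)
       (simp_all add: antipode_\<theta> antipode_h antipode_l \<psi>E_mult antipode_K antipode_L antipode_E
         linearQ_uminus[OF \<psi>E_lin[OF linearQ_ident]])
qed

text \<open>By \<open>antipode_\<psi>F\<close> the value of \<open>S\<close> determines
  \<open>\<psi>F\<close>, whose image under \<Phi> is \<one> \<otimes> a; the counit on the first
  factor recovers a.\<close>

lemma inj_antipode: "inj S"
proof (rule injI)
  fix a b assume "S a = S b"
  then have "\<psi>F a = \<psi>F b" by (metis antipode_\<psi>F)
  then have "\<one> \<otimes> a = \<one> \<otimes> b" by (metis \<Phi>_\<psi>F)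
  then have "tsum (\<one> \<otimes> a) (\<lambda>p q. \<epsilon> p *\<^sub>Q q) = tsum (\<one> \<otimes> b) (\<lambda>p q. \<epsilon> p *\<^sub>Q q)" by simp
  then show "a = b" by (simp add: tsum_tens lin counit_one scaleQ_one)
qed

lemma surj_antipode: "surj S"
proof -
  have "z g \<in> range S" for g
  proof (cases g)
    case (GTheta i)
    \<comment> \<open>The preimage of \<open>\<theta> i\<close> is \<theta> multiplied on the right
      by the inverse of h: reversal of the product puts h in front of l.\<close>
    have "S (- (\<theta> i \<cdot> l i)) = h i \<cdot> l i \<cdot> \<theta> i"
      by (simp add: linearQ_uminus[OF linear_antipode] antipode_mult antipode_l antipode_\<theta> amult_simps[OF alg] assoc)
    then have "\<theta> i = S (- (\<theta> i \<cdot> l i))" by (simp add: B_relations)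
    then show ?thesis unfolding GTheta by (rule range_eqI)
  next
    case (GH i)
    then show ?thesis using antipode_l[of i] by (metis rangeI)
  next
    case (GHinv i)
    then show ?thesis using antipode_h[of i] by (metis rangeI)
  qed
  moreover have "a \<cdot> b \<in> range S" if "a \<in> range S" "b \<in> range S" for a b
    using that by (auto simp flip: antipode_mult)
  moreover have "\<one> \<in> range S" by (metis antipode_one rangeI)
  ultimately have "a \<in> range S" for a
    by (intro presented_by_subspace[OF B_presented, of "range S" a] linear_image_subspace linear_antipode qvs.subspace_UNIV) blast+
  then show ?thesis by blast
qed

sublocale hopf_pair_bij
  by unfold_locales (simp add: bij_def inj_antipode surj_antipode)

section \<open>The inverse of \<Phi>\<close>

definition \<Psi> :: "('a, 'a) tensor \<Rightarrow> 'u" where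
  "\<Psi> t = tsum t (\<lambda>c d. sw c (\<lambda>p q. \<psi>E q \<star> \<psi>F (D (R p) d)))"

lemma \<Psi>_lin [lin]: "linearQ f \<Longrightarrow> linearQ (\<lambda>x. \<Psi> (f x))"
  unfolding \<Psi>_def by (intro lin U.alg)

lemma \<Psi>_\<Phi>: "\<Psi> (\<Phi> u) = u"
  by (rule U_eqI[where u = u])
     (simp_all add: lin \<Phi>_T \<Psi>_def T_conv_tens[of "\<lambda>a b. \<psi>E a \<star> \<psi>F b"])

lemma \<Psi>_tens: "\<Psi> (a \<otimes> b) = sw a (\<lambda>p q. \<psi>E q \<star> \<psi>F (D (R p) b))"
  unfolding \<Psi>_def by (rule tsum_tens) (intro lin U.alg)+

lemma \<Phi>_\<Psi>: "\<Phi> (\<Psi> t) = t"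
  by (rule tensor_eqI[where t = t])
     (simp_all add: lin \<Psi>_tens sw_linear[of \<Phi>] \<Phi>_T tens_conv_T)

lemma bij_\<Phi>: "bij \<Phi>"
  by (rule o_bij[of \<Psi>]) (simp_all add: fun_eq_iff \<Psi>_\<Phi> \<Phi>_\<Psi>)

end

section \<open>Compatibility with coproduct, counit and antipode\<close>

context twisted_double
begin

text \<open>The coproduct is prescribed on \<open>\<theta>\<close> and \<open>h\<close> only;
  writing \<open>l i\<close> as the antipode of \<open>h i\<close> shows that it is group-like as
  well.\<close>

lemma sw_l:
  assumes f: "\<And>q. linearQ (\<lambda>p. f p q)" "\<And>p. linearQ (\<lambda>q. f p q)"
  shows "sw (l i) f = f (l i) (l i)"
proof -
  have "linearQ (\<lambda>q. f (S p) q)" "linearQ (\<lambda>q. f q (S p))" "linearQ (\<lambda>q. f (S q) p)" "linearQ (\<lambda>q. f p (S q))" for p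
    by (intro f linearQ_compose[OF f(1) linear_antipode] linearQ_compose[OF f(2) linear_antipode])+
  then show ?thesis
    using f by (simp add: sw_antipode sw_h linearQ_compose[OF f(1) linear_antipode] linearQ_compose[OF f(2) linear_antipode] flip: antipode_h)
qed

lemma comult_L: "comult U (L i) = L i \<otimes> L i" and comult_L': "comult U (L' i) = L' i \<otimes> L' i"
proof -
  have "U.sw (K i) (\<lambda>p q. antipode U q \<otimes> antipode U p) = L i \<otimes> L i"
    "U.sw (K' i) (\<lambda>p q. antipode U q \<otimes> antipode U p) = L' i \<otimes> L' i"
    unfolding U.sw_def comult_K comult_K' by (simp_all add: tsum_tens lin antipode_K antipode_K')
  then show "comult U (L i) = L i \<otimes> L i" "comult U (L' i) = L' i \<otimes> L' i"
    using U.comult_antipode[of "K i"] U.comult_antipode[of "K' i"] by (simp_all add: antipode_K antipode_K')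
qed

lemma comult_\<psi>E: "comult U (\<psi>E a) = sw a (\<lambda>p q. \<psi>E p \<otimes> \<psi>E q)"
proof -
  define N where "N b = sw b (\<lambda>p q. \<psi>E p \<otimes> \<psi>E q)" for b
  have N_lin: "linearQ N" unfolding N_def by (intro lin)
  have N_mult: "amult (tensor_alg U U) (N b) (N c) = N (b \<cdot> c)" for b c
    unfolding N_def
    by (simp add: sw_linear[of "amult (tensor_alg U U) _"] sw_linear[of "\<lambda>t. amult (tensor_alg U U) t _"]
        lin tensor_alg_tens U.alg sw_mult \<psi>E_mult sw_swap[of c])
  have gens: "comult U (E_gen g) = N (z g)" for g
    by (cases g) (simp_all add: N_def sw_\<theta> sw_h sw_l lin \<psi>E_one comult_E comult_K comult_L)
  have "a \<in> {a. comult U (\<psi>E a) = N a}"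
  proof (rule presented_by_subspace[OF B_presented])
    show "qvs.subspace {a. comult U (\<psi>E a) = N a}"
      by (intro linear_eq_subspace lin N_lin)
  qed (simp_all add: \<psi>E_mult U.comult_mult \<psi>E_gen gens N_mult \<psi>E_one U.comult_one, simp add: N_def sw_one lin \<psi>E_one)
  then show ?thesis by (simp add: N_def)
qed

text \<open>The flip comes from \<Delta>(F) = 1 \<otimes> F + F \<otimes> K', against \<theta>
  \<otimes> 1 + h \<otimes> \<theta> in B. Both sides are multiplicative, so generators
  suffice.\<close>

lemma comult_\<psi>F: "comult U (\<psi>F b) = sw b (\<lambda>r s. \<psi>F s \<otimes> \<psi>F r)"
proof -
  define N where "N b = sw b (\<lambda>p q. \<psi>F q \<otimes> \<psi>F p)" for b
  have N_lin: "linearQ N" unfolding N_def by (intro lin)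
  have N_mult: "amult (tensor_alg U U) (N b) (N c) = N (b \<cdot> c)" for b c
    unfolding N_def
    by (simp add: sw_linear[of "amult (tensor_alg U U) _"] sw_linear[of "\<lambda>t. amult (tensor_alg U U) t _"]
        lin tensor_alg_tens U.alg sw_mult \<psi>F_mult sw_swap[of c])
  have gens: "comult U (F_gen g) = N (z g)" for g
    by (cases g) (simp_all add: N_def sw_\<theta> sw_h sw_l lin \<psi>F_one comult_F comult_K' comult_L')
  have "b \<in> {a. comult U (\<psi>F a) = N a}"
  proof (rule presented_by_subspace[OF B_presented])
    show "qvs.subspace {a. comult U (\<psi>F a) = N a}"
      by (intro linear_eq_subspace lin N_lin)
  qed (simp_all add: \<psi>F_mult U.comult_mult \<psi>F_gen gens N_mult \<psi>F_one U.comult_one, simp add: N_def sw_one lin \<psi>F_one)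
  then show ?thesis by (simp add: N_def)
qed

lemma counit_inverse: "\<epsilon> a = 1 \<Longrightarrow> a \<cdot> b = \<one> \<Longrightarrow> \<epsilon> b = 1"
  using counit_mult[of a b] by (simp add: counit_one)

lemma U_counit_inverse: "counit U a = 1 \<Longrightarrow> a \<star> b = aone U \<Longrightarrow> counit U b = 1"
  using U.counit_mult[of a b] by (simp add: U.counit_one)

lemma counit_\<psi>E: "counit U (\<psi>E a) = \<epsilon> a" and counit_\<psi>F: "counit U (\<psi>F a) = \<epsilon> a"
proof -
  have "counit U (\<psi>E (z g)) = \<epsilon> (z g)" "counit U (\<psi>F (z g)) = \<epsilon> (z g)" for g
    using counit_inverse[OF counit_h B_relations(2)] U_counit_inverse[OF counit_K U_relations(11)]
      U_counit_inverse[OF counit_K' U_relations(13)]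
    by (cases g; simp add: counit_E counit_F counit_K counit_K')+
  then show "counit U (\<psi>E a) = \<epsilon> a" "counit U (\<psi>F a) = \<epsilon> a"
    using presented_by_hom_eq[OF B_presented alg_hom_comp[OF \<psi>E_hom U.counit_hom] counit_hom]
      presented_by_hom_eq[OF B_presented alg_hom_comp[OF \<psi>F_hom U.counit_hom] counit_hom] by simp_all
qed

lemma linear_\<Phi>: "linearQ \<Phi>"
  by (intro lin)

lemma comult_\<Phi>: "comult I (\<Phi> u) = tmap \<Phi> \<Phi> (comult U u)"
proof (rule U_eqI[where u = u])
  fix a b
  have "comult U (\<psi>E a \<star> \<psi>F b) = sw a (\<lambda>p q. sw b (\<lambda>r s. (\<psi>E p \<star> \<psi>F s) \<otimes> (\<psi>E q \<star> \<psi>F r)))"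
    unfolding U.comult_mult comult_\<psi>E comult_\<psi>F
    by (simp add: sw_linear[of "amult (tensor_alg U U) _"] sw_linear[of "\<lambda>t. amult (tensor_alg U U) t _"]
        lin tensor_alg_tens U.alg sw_swap[of b])
  then show "comult I (\<Phi> (\<psi>E a \<star> \<psi>F b)) = tmap \<Phi> \<Phi> (comult U (\<psi>E a \<star> \<psi>F b))"
    by (simp add: \<Phi>_T iota_comult_T sw_linear[of "tmap \<Phi> \<Phi>"] tmap_tens lin)
qed (intro lin)+

lemma counit_\<Phi>: "counit I (\<Phi> u) = counit U u"
  by (rule U_eqI[where u = u])
     (simp_all add: lin \<Phi>_T iota_counit_T U.counit_mult counit_\<psi>E counit_\<psi>F)

text \<open>The antipode of U reverses a product of the two halves and acts by \<open>R\<close> on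
  the F factor and by \<open>S\<close> on the E factor, which is the shape found in
  \<open>iota_antipode_T\<close>.\<close>

lemma antipode_\<Phi>: "antipode I (\<Phi> u) = \<Phi> (antipode U u)"
proof (rule U_eqI[where u = u])
  fix a b
  have "antipode U (\<psi>F b) = \<psi>F (R b)"
    using antipode_\<psi>F[of "R b"] by simp
  moreover have "\<Phi> (\<psi>F (R b) \<star> \<psi>E (S a)) = LF (R b) (LE (S a) (\<one> \<otimes> \<one>))"
    by (simp add: \<Phi>_def \<rho>_mult \<rho>_\<psi>E \<rho>_\<psi>F app_LEe app_LFe)
  ultimately show "antipode I (\<Phi> (\<psi>E a \<star> \<psi>F b)) = \<Phi> (antipode U (\<psi>E a \<star> \<psi>F b))"
    by (simp add: \<Phi>_T iota_antipode_T U.antipode_mult antipode_\<psi>E)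
qed (intro lin)+

lemma hopf_iso_\<Phi>: "hopf_iso U I \<Phi>"
  by (intro hopf_iso_transport U.hopf bij_\<Phi> linear_\<Phi> \<Phi>_one \<Phi>_mult comult_\<Phi> counit_\<Phi> antipode_\<Phi>)


section \<open>The subalgebras without inverses of the group-likes\<close>

abbreviation Bh where "Bh \<equiv> Bhat H z"
abbreviation W where "W \<equiv> tensor_subspace Bh Bh"

lemma subalgebra_Bh: "subalgebra H Bh"
  unfolding Bhat_def by (rule hull_in) (auto simp: subalgebra_def intro: qvs.subspace_Inter)

lemma subspace_Bh: "qvs.subspace Bh" and Bh_one: "\<one> \<in> Bh"
  and Bh_mult: "a \<in> Bh \<Longrightarrow> b \<in> Bh \<Longrightarrow> a \<cdot> b \<in> Bh"
  using subalgebra_Bh by (simp_all add: subalgebra_def)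

lemma Bh_\<theta>: "\<theta> i \<in> Bh" and Bh_h: "h i \<in> Bh"
  unfolding Bhat_def using hull_subset[of "range \<theta> \<union> range h" "subalgebra H"] by auto

lemma Bh_minimal:
  assumes "subalgebra H X" "\<And>i. \<theta> i \<in> X" "\<And>i. h i \<in> X"
  shows "Bh \<subseteq> X"
  unfolding Bhat_def by (rule hull_minimal) (use assms in auto)

lemma subspace_W: "qvs.subspace W"
  by (simp add: tensor_subspace_def)

lemma W_base: "a \<in> Bh \<Longrightarrow> b \<in> Bh \<Longrightarrow> a \<otimes> b \<in> W"
  unfolding tensor_subspace_def by (rule qvs.span_base) blast

lemma W_linear_mem:
  assumes "linearQ f" "qvs.subspace X" "\<And>a b. a \<in> Bh \<Longrightarrow> b \<in> Bh \<Longrightarrow> f (a \<otimes> b) \<in> X" "t \<in> W"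
  shows "f t \<in> X"
  by (rule linear_span_mem[OF assms(1,2) _ assms(4)[unfolded tensor_subspace_def]]) (use assms(3) in auto)

lemma W_mult:
  assumes s: "s \<in> W" and t: "t \<in> W"
  shows "amult (tensor_alg H H) s t \<in> W"
proof (rule W_linear_mem[where f = "\<lambda>s. amult (tensor_alg H H) s t", OF _ subspace_W _ s])
  fix a b assume ab: "a \<in> Bh" "b \<in> Bh"
  show "amult (tensor_alg H H) (a \<otimes> b) t \<in> W"
    by (rule W_linear_mem[where f = "\<lambda>t. amult (tensor_alg H H) (a \<otimes> b) t", OF _ subspace_W _ t])
       (simp_all add: lin tensor_alg_tens alg ab Bh_mult W_base)
qed (intro lin)

text \<open>The right-hand set is a subalgebra, and the coproducts of \<open>\<theta>\<close> and
  \<open>h\<close> involve no inverse of \<open>h\<close>.\<close>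

lemma comult_Bh: "Bh \<subseteq> {a. \<Delta> a \<in> W}"
proof (rule Bh_minimal)
  show "subalgebra H {a. \<Delta> a \<in> W}"
    unfolding subalgebra_def
    by (auto simp: comult_one comult_mult intro!: W_mult W_base Bh_one linear_vimage_subspace[OF _ subspace_W] lin)
qed (auto simp: comult_\<theta> comult_h intro!: qvs.subspace_add[OF subspace_W] W_base Bh_\<theta> Bh_h Bh_one)

lemma Bh_sw:
  assumes "a \<in> Bh" "qvs.subspace X" "\<And>p q. p \<in> Bh \<Longrightarrow> q \<in> Bh \<Longrightarrow> f p q \<in> X"
    and f: "\<And>q. linearQ (\<lambda>p. f p q)" "\<And>p. linearQ (\<lambda>q. f p q)"
  shows "sw a f \<in> X"
  unfolding sw_def
  by (rule W_linear_mem[where f = "\<lambda>t. tsum t f"])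
     (use assms comult_Bh in \<open>auto simp: tsum_tens intro!: lin\<close>)

text \<open>\<open>p\<close> is arbitrary because it only enters a scalar. This matters for
  \<open>\<Psi>\<close>, which uses \<open>D (R p)\<close>, and \<open>R\<close> sends
  \<open>h i\<close> to \<open>l i\<close>.\<close>

lemma Bh_D: "b \<in> Bh \<Longrightarrow> D p b \<in> Bh" and Bh_G: "c \<in> Bh \<Longrightarrow> G r c \<in> Bh"
  unfolding D_def G_def by (auto intro!: Bh_sw subspace_Bh qvs.subspace_scale[OF subspace_Bh] lin)

lemma W_LE: "a \<in> Bh \<Longrightarrow> t \<in> W \<Longrightarrow> LE a t \<in> W"
  by (rule W_linear_mem[OF _ subspace_W])
     (auto simp: LE_tens intro!: lin Bh_sw subspace_W W_base Bh_mult Bh_D)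

lemma W_LF: "b \<in> Bh \<Longrightarrow> t \<in> W \<Longrightarrow> LF b t \<in> W"
  by (rule W_linear_mem[OF _ subspace_W])
     (auto simp: LF_tens intro!: lin Bh_sw subspace_W W_base Bh_mult Bh_G)

text \<open>The image lies in W because each generator acts through \<open>LE\<close> or
  \<open>LF\<close>, which preserve W. Conversely the explicit inverse \<open>\<Psi>\<close> sends W
  into \<open>range f\<close>: the coproduct preserves \<open>Bh\<close>, and so does
  \<open>D (R p)\<close>.\<close>

lemma image_\<Phi>:
  fixes Uh :: "'w::qvs alg"
  assumes Uh: "presented_by Uh y Rel" and hom: "alg_hom Uh U f" and gens: "\<And>g. f (y g) = x (Base g)"
  shows "\<Phi> ` range f = W"
proof -
  let ?A = "range f"
  have sub: "qvs.subspace ?A"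
    by (rule linear_image_subspace[OF alg_hom_linear[OF hom] qvs.subspace_UNIV])
  have A_mult: "u \<star> v \<in> ?A" if "u \<in> ?A" "v \<in> ?A" for u v
    using that by (auto simp flip: alg_hom_mult[OF hom])
  have A_one: "aone U \<in> ?A"
    by (metis alg_hom_one[OF hom] rangeI)
  have A_gen: "x (Base g) \<in> ?A" for g
    by (metis gens rangeI)
  have "Bh \<subseteq> {a. \<psi>E a \<in> ?A}" "Bh \<subseteq> {a. \<psi>F a \<in> ?A}"
    by (rule Bh_minimal;
        simp add: subalgebra_def \<psi>E_mult \<psi>F_mult \<psi>E_one \<psi>F_one A_mult A_one A_gen linear_vimage_subspace[OF _ sub] lin)+
  then have \<psi>_A: "\<psi>E a \<star> \<psi>F b \<in> ?A" if "a \<in> Bh" "b \<in> Bh" for a b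
    using that by (intro A_mult) blast+
  have \<Psi>_W: "\<Psi> t \<in> ?A" if "t \<in> W" for t
  proof (rule W_linear_mem[where f = \<Psi>, OF _ sub _ that])
    fix a b assume "a \<in> Bh" "b \<in> Bh"
    then show "\<Psi> (a \<otimes> b) \<in> ?A"
      unfolding \<Psi>_tens by (intro Bh_sw[OF _ sub] \<psi>_A Bh_D lin U.alg)
  qed (intro lin)
  have gen_W: "app (\<rho> (x (Base g))) t \<in> W" if "t \<in> W" for g t
    by (cases g) (simp_all add: \<rho>_gen app_LEe app_LFe W_LE W_LF that Bh_\<theta> Bh_h)
  have "w \<in> {w. \<Phi> (f w) \<in> W}" for w
  proof (rule presented_by_subspace[OF Uh])
    show "qvs.subspace {w. \<Phi> (f w) \<in> W}"
      by (rule linear_vimage_subspace[OF linearQ_compose[OF linear_\<Phi> alg_hom_linear[OF hom]] subspace_W])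
  qed (simp_all add: alg_hom_one[OF hom] alg_hom_mult[OF hom] gens \<Phi>_one iota_one W_base Bh_one
         \<Phi>_mult gen_W flip: \<rho>_iota)
  then have "\<Phi> ` ?A \<subseteq> W" by blast
  moreover have "W \<subseteq> \<Phi> ` ?A"
    using \<Psi>_W \<Phi>_\<Psi> by (metis image_eqI subsetI)
  ultimately show ?thesis by blast
qed

end

theorem lemma4p1:
  fixes C :: "'i::finite \<Rightarrow> 'i \<Rightarrow> int" and d :: "'i \<Rightarrow> nat"
    and U :: "'u::qvs hopf" and x :: "'i Util_gen \<Rightarrow> 'u"
    and Uh :: "'w::qvs alg" and y :: "'i Uhat_gen \<Rightarrow> 'w" and \<iota> :: "'w \<Rightarrow> 'u"
    and B :: "'b::qvs hopf" and z :: "'i B_gen \<Rightarrow> 'b" and \<phi> :: "'b \<Rightarrow> 'b \<Rightarrow> qv"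
  assumes "symmetrizable_GCM C d"
    and "is_Util C d U x"
    and "is_Uhat C d Uh y"
    and "alg_hom Uh U \<iota>" and "\<And>g. \<iota> (y g) = x (Base g)"
    and "is_Btil C d B z"
    and "is_Btil_pairing C d B z \<phi>"
  shows "\<exists>\<Phi>. hopf_iso U (iota_hopf B \<phi>) \<Phi> \<and>
           (\<forall>i. \<Phi> (x (Base (GE i))) = z (GTheta i) \<otimes> aone B \<and>
                \<Phi> (x (Base (GF i))) = aone B \<otimes> z (GTheta i) \<and>
                \<Phi> (x (Base (GK i))) = z (GH i) \<otimes> aone B \<and>
                \<Phi> (x (Base (GK' i))) = aone B \<otimes> z (GH i)) \<and>
           \<Phi> ` range \<iota> = tensor_subspace (Bhat B z) (Bhat B z)"
proof -
  interpret twisted_double B \<phi> C d U x z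
    using assms by unfold_locales (simp_all add: is_Btil_def is_Btil_pairing_def)
  show ?thesis
  proof (intro exI conjI allI)
    show "hopf_iso U (iota_hopf B \<phi>) \<Phi>" by (rule hopf_iso_\<Phi>)
    fix i
    show "\<Phi> (x (Base (GE i))) = z (GTheta i) \<otimes> aone B" "\<Phi> (x (Base (GK i))) = z (GH i) \<otimes> aone B"
      by (simp_all flip: \<psi>E_simps add: \<Phi>_\<psi>E)
    show "\<Phi> (x (Base (GF i))) = aone B \<otimes> z (GTheta i)" "\<Phi> (x (Base (GK' i))) = aone B \<otimes> z (GH i)"
      by (simp_all flip: \<psi>F_simps add: \<Phi>_\<psi>F)
    show "\<Phi> ` range \<iota> = tensor_subspace (Bhat B z) (Bhat B z)"
      using assms(3-5) unfolding is_Uhat_def by (rule image_\<Phi>)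
  qed
qed

end
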